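(* A binary matroid is strongly Rayleigh if and only if it is regular.
   Context: For a matroid $\mathcal{M}$ on a finite set $E$ with variables $\mathbf{y}=\{y_c:c\in E\}$ and disjoint $I,J\subseteq E$, $M_I^J(\mathbf{y}):=\sum_B\prod_{c\in B\setminus I}y_c$, summed over bases $B$ with $I\subseteq B$, $B\cap J=\varnothing$. For distinct $e,f$: $\Delta M\{e,f\}:=M_e^fM_f^e-M_{ef}M^{ef}$. $\mathcal{M}$ is strongly Rayleigh if $\Delta M\{e,f\}(\mathbf{y})\ge0$ for all distinct $e,f\in E$ and all real $\mathbf{y}\in\mathbb{R}^E$ (positive, negative or zero). *)

theory Defs
  imports
    "Jordan_Normal_Form.DL_Submatrix"
    "Jordan_Normal_Form.Determinant"
    "Jordan_Normal_Form.VS_Connect"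
    "HOL-Library.Z2"
begin

locale matroid =
  fixes E :: "'a set" and Bs :: "'a set set"
  assumes finite_ground: "finite E"
    and bases_subset: "B \<in> Bs \<Longrightarrow> B \<subseteq> E"
    and bases_nonempty: "Bs \<noteq> {}"
    and basis_exchange:
      "\<lbrakk>B1 \<in> Bs; B2 \<in> Bs; x \<in> B1 - B2\<rbrakk> \<Longrightarrow> \<exists>y \<in> B2 - B1. insert y (B1 - {x}) \<in> Bs"

definition matroid_indep :: "'a set set \<Rightarrow> 'a set \<Rightarrow> bool" where
  "matroid_indep Bs X \<longleftrightarrow> (\<exists>B \<in> Bs. X \<subseteq> B)"

(* Linear independence of the family of columns of A indexed by the set J. The AFP predicate
   lin_dep speaks about sets of vectors, so that equal columns (parallel elements of a
   matroid) have to be excluded by injectivity. *)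
definition cols_lin_indpt :: "'k::field mat \<Rightarrow> nat set \<Rightarrow> bool" where
  "cols_lin_indpt A J \<longleftrightarrow>
     inj_on (col A) J \<and>
     \<not> module.lin_dep class_ring (module_vec TYPE('k) (dim_row A)) (col A ` J)"

(* The labelling l matches the elements of E with the columns of A. *)
definition represents ::
  "'k::field mat \<Rightarrow> ('a \<Rightarrow> nat) \<Rightarrow> 'a set \<Rightarrow> 'a set set \<Rightarrow> bool" where
  "represents A l E Bs \<longleftrightarrow>
     bij_betw l E {..<dim_col A} \<and>
     (\<forall>X \<subseteq> E. matroid_indep Bs X \<longleftrightarrow> cols_lin_indpt A (l ` X))"

(* The type bit is the two-element field. *)
definition binary_matroid :: "'a set \<Rightarrow> 'a set set \<Rightarrow> bool" where
  "binary_matroid E Bs \<longleftrightarrow> matroid E Bs \<and> (\<exists>(A :: bit mat) l. represents A l E Bs)"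

definition totally_unimodular :: "real mat \<Rightarrow> bool" where
  "totally_unimodular A \<longleftrightarrow>
     (\<forall>I \<subseteq> {..<dim_row A}. \<forall>J \<subseteq> {..<dim_col A}.
        card I = card J \<longrightarrow> det (submatrix A I J) \<in> {-1, 0, 1})"

(* Representability over every field, which is equivalent to this definition, would need a
   quantifier over types inside the formula. *)
definition regular_matroid :: "'a set \<Rightarrow> 'a set set \<Rightarrow> bool" where
  "regular_matroid E Bs \<longleftrightarrow>
     matroid E Bs \<and> (\<exists>(A :: real mat) l. totally_unimodular A \<and> represents A l E Bs)"

(* basis_poly Bs I J y is the value M_I^J(y). *)
definition basis_poly ::
  "'a set set \<Rightarrow> 'a set \<Rightarrow> 'a set \<Rightarrow> ('a \<Rightarrow> real) \<Rightarrow> real" where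
  "basis_poly Bs I J y = (\<Sum>B \<in> {B \<in> Bs. I \<subseteq> B \<and> B \<inter> J = {}}. \<Prod>c \<in> B - I. y c)"

definition rayleigh_difference ::
  "'a set set \<Rightarrow> 'a \<Rightarrow> 'a \<Rightarrow> ('a \<Rightarrow> real) \<Rightarrow> real" where
  "rayleigh_difference Bs e f y =
     basis_poly Bs {e} {f} y * basis_poly Bs {f} {e} y -
     basis_poly Bs {e, f} {} y * basis_poly Bs {} {e, f} y"

definition strongly_rayleigh :: "'a set \<Rightarrow> 'a set set \<Rightarrow> bool" where
  "strongly_rayleigh E Bs \<longleftrightarrow>
     (\<forall>e \<in> E. \<forall>f \<in> E. e \<noteq> f \<longrightarrow> (\<forall>y. rayleigh_difference Bs e f y \<ge> 0))"

end

(*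
  Regular implies strongly Rayleigh: for a unimodular representation with vectors a_e put
  Q(e,f) = a_e^T adj(A Y A^T) a_f. This form is a signed sum of basis monomials, and the
  identity of projections Q(y) Y Q(y') = M(y) Q(y') yields Delta M{e,f} = Q(e,f)^2.

  For the converse, following Gerards' proof of Tutte's theorem, consider a binary strongly
  Rayleigh matroid which is not regular, with a ground set of least size. After a pivot its
  fundamental graph has a vertex of degree three, and a tree grown from there has three leaves.
  Two of them, x and y, lie in the same colour class; up to duality they are columns. The
  signings of M - x and M - y exist by minimality and agree on M - {x,y} up to scaling. If they do not
  combine to a signing of M, some two-by-two minor on x and y has the wrong sign, and an induced
  path of M - {x,y} between its rows gives a Fano minor, whose Rayleigh difference takes negative
  values.
*)
theory Submission
  imports Defs
begin

section \<open>Coordinates of a represented matroid\<close>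

text \<open>A binary matroid is determined by its fundamental graph over any one basis, because a
  nonzero bit is one. Pivots over the bits and pivots of signs over the reals change the supports by
  the same rule as long as every full two-by-two block is singular over the reals; a nonsingular one
  produces an entry of absolute value two. A signing is thus a choice of signs on the edges of the
  graph that survives all pivots, and the obstacle is formed by the bases that contain both x and y,
  which neither deletion sees. The length of the path is harmless: pivots shorten it until two inner
  columns are left. There the discrepancy of signs shows in the supports, and three basis elements,
  the two inner columns, x and y form the Fano matroid. Its dual never has to be treated, since the
  strong Rayleigh property and signability both pass to the dual, so that the two leaves may always
  be taken as columns.\<close>

lemma if_one_mult: "(if P then 1 else 0) * x = (if P then x else (0::'k::semiring_1))"
  by simp

lemma mult_if_one: "x * (if P then 1 else 0) = (if P then x else (0::'k::semiring_1))"
  by simp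

text \<open>A representation is recorded without an ambient vector space: \<open>N B b e\<close> is the coordinate of \<open>e\<close>
  at \<open>b\<close> in the basis \<open>B\<close>. Changes of basis become the cocycle identity.\<close>

locale coordinatization =
  fixes E :: "'a set" and Bs :: "'a set set" and N :: "'a set \<Rightarrow> 'a \<Rightarrow> 'a \<Rightarrow> 'k::field"
  assumes finite_E: "finite E"
    and nonempty: "Bs \<noteq> {}"
    and base_sub: "B \<in> Bs \<Longrightarrow> B \<subseteq> E"
    and N_base: "\<lbrakk>B \<in> Bs; b \<in> B; e \<in> B\<rbrakk> \<Longrightarrow> N B b e = (if e = b then 1 else 0)"
    and N_exchange: "\<lbrakk>B \<in> Bs; b \<in> B; e \<in> E\<rbrakk> \<Longrightarrow> N B b e \<noteq> 0 \<longleftrightarrow> insert e (B - {b}) \<in> Bs"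
    and N_cocycle: "\<lbrakk>B \<in> Bs; B' \<in> Bs; b \<in> B; e \<in> E\<rbrakk>
      \<Longrightarrow> N B b e = (\<Sum>b'\<in>B'. N B b b' * N B' b' e)"
begin

lemma finite_base: "B \<in> Bs \<Longrightarrow> finite B"
  using base_sub finite_E finite_subset by blast

text \<open>The cocycle replaces a dimension count: an extra element \<open>e\<close> of
  \<open>B'\<close>, expanded through \<open>B\<close>, meets only coefficients that vanish because
  \<open>B\<close> lies in \<open>B'\<close>, yet its coordinate at itself is one.\<close>

lemma antichain:
  assumes "B \<in> Bs" "B' \<in> Bs" "B \<subseteq> B'" shows "B = B'"
proof (rule ccontr)
  assume "B \<noteq> B'"
  then obtain e where e: "e \<in> B'" "e \<notin> B" using assms by blast
  have eE: "e \<in> E" using e base_sub assms by blast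
  have "N B' e e = (\<Sum>b\<in>B. N B' e b * N B b e)"
    by (rule N_cocycle) (use assms e eE in auto)
  also have "\<dots> = 0"
    by (rule sum.neutral) (use N_base[OF assms(2) e(1)] assms e in auto)
  finally show False using N_base[OF assms(2) e(1) e(1)] by simp
qed

text \<open>Expanding \<open>x\<close> through \<open>B'\<close> and back to \<open>B\<close> gives
  the coordinate one, so some summand is nonzero; its two factors certify both exchanges with the
  same \<open>y\<close>.\<close>

lemma symmetric_exchange:
  assumes "B \<in> Bs" "B' \<in> Bs" "x \<in> B" "x \<notin> B'"
  obtains y where "y \<in> B'" "y \<notin> B" "insert y (B - {x}) \<in> Bs" "insert x (B' - {y}) \<in> Bs"
proof -
  have xE: "x \<in> E" using assms base_sub by blast
  have "(\<Sum>b\<in>B'. N B x b * N B' b x) = 1"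
    by (subst N_cocycle[OF assms(1,2,3) xE, symmetric]) (simp add: N_base assms)
  then have "(\<Sum>b\<in>B'. N B x b * N B' b x) \<noteq> 0" by simp
  then obtain y where y: "y \<in> B'" "N B x y * N B' y x \<noteq> 0"
    by (rule sum.not_neutral_contains_not_neutral)
  have yE: "y \<in> E" using y assms base_sub by blast
  have "y \<notin> B" using y N_base[OF assms(1,3), of y] assms by (auto split: if_splits)
  with that y show ?thesis
    using N_exchange[OF assms(1,3) yE] N_exchange[OF assms(2) y(1) xE] by auto
qed

text \<open>The pivot rules are the cocycle identity between adjacent bases: a row of
  \<open>N B\<close> is a unit row on \<open>B\<close>, so only the entering element and at most one
  old element contribute.\<close>

lemma pivot_row:
  assumes "B \<in> Bs" "b \<in> B" "e \<in> E" "e \<notin> B" "insert e (B - {b}) \<in> Bs" "g \<in> E"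
  shows "N (insert e (B - {b})) e g = N B b g / N B b e"
proof -
  let ?B = "insert e (B - {b})"
  have ne: "N B b e \<noteq> 0" using N_exchange assms by blast
  have "N B b g = (\<Sum>b'\<in>?B. N B b b' * N ?B b' g)"
    by (rule N_cocycle) (use assms in auto)
  also have "\<dots> = N B b e * N ?B e g + (\<Sum>b'\<in>B - {b}. N B b b' * N ?B b' g)"
    by (rule sum.insert) (use assms finite_base in auto)
  also have "(\<Sum>b'\<in>B - {b}. N B b b' * N ?B b' g) = 0"
    by (rule sum.neutral) (use N_base[OF assms(1,2)] in auto)
  finally show ?thesis using ne by (simp add: field_simps)
qed

lemma pivot:
  assumes "B \<in> Bs" "b \<in> B" "e \<in> E" "e \<notin> B" "insert e (B - {b}) \<in> Bs" "g \<in> E"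
    "b' \<in> B" "b' \<noteq> b"
  shows "N (insert e (B - {b})) b' g = N B b' g - N B b' e * N B b g / N B b e"
proof -
  let ?B = "insert e (B - {b})"
  have "N B b' g = (\<Sum>c\<in>?B. N B b' c * N ?B c g)"
    by (rule N_cocycle) (use assms in auto)
  also have "\<dots> = N B b' e * N ?B e g + (\<Sum>c\<in>B - {b}. N B b' c * N ?B c g)"
    by (rule sum.insert) (use assms finite_base in auto)
  also have "(\<Sum>c\<in>B - {b}. N B b' c * N ?B c g) = (\<Sum>c\<in>B - {b}. if c = b' then N ?B c g else 0)"
    by (rule sum.cong) (use N_base[OF assms(1,7)] in auto)
  also have "\<dots> = N ?B b' g" using assms finite_base by (simp add: sum.delta')
  finally show ?thesis using pivot_row[OF assms(1-6)] by (simp add: field_simps)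
qed

lemma insert_mem_iff:
  assumes "B \<in> Bs" "b \<in> B" "e \<in> B" shows "insert e (B - {b}) \<in> Bs \<longleftrightarrow> e = b"
proof
  assume "insert e (B - {b}) \<in> Bs"
  with antichain[OF this assms(1)] assms show "e = b" by auto
qed (use assms in \<open>auto simp: insert_absorb\<close>)

lemma matroid: "matroid E Bs"
proof
  fix B1 B2 x assume "B1 \<in> Bs" "B2 \<in> Bs" "x \<in> B1 - B2"
  then show "\<exists>y\<in>B2 - B1. insert y (B1 - {x}) \<in> Bs"
    by (metis DiffE DiffI symmetric_exchange)
qed (use finite_E nonempty base_sub in auto)

lemma restrict_frames:
  assumes "E' \<subseteq> E" "Bs' = {B \<in> Bs. B \<subseteq> E'}" "Bs' \<noteq> {}"
  shows "coordinatization E' Bs' N"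
proof
  show "finite E'" using assms finite_E finite_subset by blast
  fix B b e assume "B \<in> Bs'" "b \<in> B" "e \<in> E'"
  then show "N B b e \<noteq> 0 \<longleftrightarrow> insert e (B - {b}) \<in> Bs'"
    using N_exchange[of B b e] assms by auto
next
  fix B B' b e assume "B \<in> Bs'" "B' \<in> Bs'" "b \<in> B" "e \<in> E'"
  then show "N B b e = (\<Sum>b'\<in>B'. N B b b' * N B' b' e)"
    using N_cocycle[of B B' b e] assms by auto
qed (use assms N_base in auto)

text \<open>Symmetric exchange can always bring in an element of the target \<open>B\<close>, hence
  of \<open>F\<close>, and this shrinks \<open>B0 - B\<close>. A property kept by single exchanges
  therefore spreads from one basis to all others, and with a smaller \<open>F\<close> inside a
  restriction.\<close>

lemma closure_exchange:
  assumes "A \<subseteq> Bs" "A \<noteq> {}" "B \<in> Bs" "B \<subseteq> F"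
    and step: "\<And>B b e. \<lbrakk>B \<in> A; b \<in> B; e \<in> F; insert e (B - {b}) \<in> Bs\<rbrakk> \<Longrightarrow> insert e (B - {b}) \<in> A"
  shows "B \<in> A"
proof -
  obtain B0 where "B0 \<in> A" using assms by blast
  then show ?thesis
  proof (induction "card (B0 - B)" arbitrary: B0 rule: less_induct)
    case less
    have B0: "B0 \<in> Bs" using less assms by blast
    show ?case
    proof (cases "B0 \<subseteq> B")
      case True
      then show ?thesis using antichain[OF B0 assms(3)] less by simp
    next
      case False
      then obtain x where x: "x \<in> B0" "x \<notin> B" by blast
      obtain y where y: "y \<in> B" "y \<notin> B0" "insert y (B0 - {x}) \<in> Bs"
        using symmetric_exchange[OF B0 assms(3) x] by blast
      have "insert y (B0 - {x}) \<in> A" by (rule step[OF less(2) x(1) _ y(3)]) (use y(1) assms(4) in auto)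
      moreover have "insert y (B0 - {x}) - B \<subset> B0 - B" using x y(1) by auto
      then have "card (insert y (B0 - {x}) - B) < card (B0 - B)"
        using finite_base[OF B0] by (intro psubset_card_mono) auto
      ultimately show ?thesis by (intro less(1))
    qed
  qed
qed

text \<open>The hypothesis says that the elements inside and outside \<open>P\<close> span complementary subspaces, which
  does not depend on the basis.\<close>
lemma separator_invariant:
  assumes "B \<in> Bs" "B' \<in> Bs"
    and sep: "\<And>b e. \<lbrakk>b \<in> B; e \<in> E; b \<in> P \<longleftrightarrow> e \<notin> P\<rbrakk> \<Longrightarrow> N B b e = 0"
    and "b \<in> B'" "e \<in> E" "b \<in> P \<longleftrightarrow> e \<notin> P"
  shows "N B' b e = 0"
proof -
  define A where "A = {B \<in> Bs. \<forall>b\<in>B. \<forall>e\<in>E. (b \<in> P \<longleftrightarrow> e \<notin> P) \<longrightarrow> N B b e = 0}"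
  have "B' \<in> A"
  proof (rule closure_exchange[where F = E])
    show "A \<noteq> {}" using assms(1) sep by (auto simp: A_def)
    fix C b e assume C: "C \<in> A" "b \<in> C" "e \<in> E" "insert e (C - {b}) \<in> Bs"
    have CB: "C \<in> Bs" and z: "\<And>b e. \<lbrakk>b \<in> C; e \<in> E; b \<in> P \<longleftrightarrow> e \<notin> P\<rbrakk> \<Longrightarrow> N C b e = 0"
      using C by (auto simp: A_def)
    have nz: "N C b e \<noteq> 0" using N_exchange CB C by blast
    \<comment> \<open>The pivot entry lies in a diagonal block, so every correction term across the
      blocks has a zero factor.\<close>
    then have same: "b \<in> P \<longleftrightarrow> e \<in> P" using z C by blast
    show "insert e (C - {b}) \<in> A"
    proof (cases "e \<in> C")
      case True
      then have "e = b" using insert_mem_iff CB C by blast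
      then show ?thesis using C by (simp add: insert_absorb)
    next
      case False
      have "N (insert e (C - {b})) b' g = 0"
        if "b' \<in> insert e (C - {b})" "g \<in> E" "b' \<in> P \<longleftrightarrow> g \<notin> P" for b' g
      proof (cases "b' = e")
        case True
        then show ?thesis using pivot_row[OF CB C(2,3) False C(4) that(2)] z[of b g] that same C by auto
      next
        case b': False
        then have "b' \<in> C" "b' \<noteq> b" using that by auto
        then show ?thesis
          using pivot[OF CB C(2,3) False C(4) that(2), of b'] z[of b' g] z[of b' e] z[of b g] that same C
          by auto
      qed
      then show ?thesis using C by (auto simp: A_def)
    qed
  qed (use assms base_sub in \<open>auto simp: A_def\<close>)
  then show ?thesis using assms by (auto simp: A_def)
qed

end

text \<open>Both changes of basis invert the same square block of the coordinates over
  \<open>B0\<close>. The calculation is the uniqueness of inverses, with a left inverse from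
  \<open>N'\<close> and a right inverse from \<open>N\<close>.\<close>

lemma coordinatization_agree:
  assumes "coordinatization E Bs N" "coordinatization E Bs N'" "B0 \<in> Bs"
    and agree: "\<And>b e. \<lbrakk>b \<in> B0; e \<in> E\<rbrakk> \<Longrightarrow> N B0 b e = N' B0 b e"
    and "B \<in> Bs" "b \<in> B" "e \<in> E"
  shows "N B b e = N' B b e"
proof -
  interpret N: coordinatization E Bs N by fact
  interpret N': coordinatization E Bs N' by fact
  have "N' B b e = (\<Sum>b0\<in>B0. N' B b b0 * N' B0 b0 e)"
    using N'.N_cocycle assms by blast
  also have "\<dots> = (\<Sum>b0\<in>B0. N' B b b0 * (\<Sum>b'\<in>B. N B0 b0 b' * N B b' e))"
  proof (rule sum.cong)
    fix b0 assume "b0 \<in> B0"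
    then show "N' B b b0 * N' B0 b0 e = N' B b b0 * (\<Sum>b'\<in>B. N B0 b0 b' * N B b' e)"
      using agree[of b0 e] N.N_cocycle[of B0 B b0 e] assms by simp
  qed simp
  also have "\<dots> = (\<Sum>b'\<in>B. (\<Sum>b0\<in>B0. N' B b b0 * N B0 b0 b') * N B b' e)"
    by (simp add: sum_distrib_left sum_distrib_right mult.assoc)
      (rule sum.swap)
  also have "\<dots> = (\<Sum>b'\<in>B. (\<Sum>b0\<in>B0. N' B b b0 * N' B0 b0 b') * N B b' e)"
    using agree N.base_sub[OF assms(5)] by (intro sum.cong refl arg_cong2[where f = "(*)"]) auto
  also have "\<dots> = (\<Sum>b'\<in>B. N' B b b' * N B b' e)"
    using N'.N_cocycle[OF assms(5,3,6)] N.base_sub[OF assms(5)] by (intro sum.cong) auto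
  also have "\<dots> = (\<Sum>b'\<in>B. if b' = b then N B b' e else 0)"
    using N'.N_base[OF assms(5,6)] by (intro sum.cong) auto
  also have "\<dots> = N B b e" using assms N.finite_base by simp
  finally show ?thesis by simp
qed

text \<open>Rows of \<open>w\<close> are indexed by \<open>B0\<close>, so that the square submatrix on the columns \<open>B\<close> has the
  inverse \<open>T\<close>, with rows in \<open>B\<close> and columns in \<open>B0\<close>. Both one-sided conditions are demanded
  because \<open>card B = card B0\<close> is not.\<close>

definition matrix_inverse :: "('a \<Rightarrow> 'a \<Rightarrow> 'k::field) \<Rightarrow> 'a set \<Rightarrow> 'a set \<Rightarrow> ('a \<Rightarrow> 'a \<Rightarrow> 'k) \<Rightarrow> bool" where
  "matrix_inverse w B0 B T \<longleftrightarrow>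
     (\<forall>c\<in>B0. \<forall>d\<in>B0. (\<Sum>b\<in>B. w c b * T b d) = (if c = d then 1 else 0)) \<and>
     (\<forall>a\<in>B. \<forall>b\<in>B. (\<Sum>c\<in>B0. T a c * w c b) = (if a = b then 1 else 0))"

text \<open>Invertibility is expressed by an inverse rather than by a determinant, so that rows and
  columns remain unordered subsets of the ground set.\<close>

definition matrix_bases :: "'a set \<Rightarrow> 'a set \<Rightarrow> ('a \<Rightarrow> 'a \<Rightarrow> 'k::field) \<Rightarrow> 'a set set" where
  "matrix_bases E B0 w = {B. B \<subseteq> E \<and> (\<exists>T. matrix_inverse w B0 B T)}"

definition matrix_coords :: "'a set \<Rightarrow> ('a \<Rightarrow> 'a \<Rightarrow> 'k::field) \<Rightarrow> 'a set \<Rightarrow> 'a \<Rightarrow> 'a \<Rightarrow> 'k" where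
  "matrix_coords B0 w B b e = (\<Sum>c\<in>B0. (SOME T. matrix_inverse w B0 B T) b c * w c e)"

text \<open>A left inverse equals every right inverse, so the choice made in
  \<open>matrix_coords\<close> has no effect.\<close>

lemma matrix_coords_eq:
  assumes fin: "finite B" "finite B0" and T: "matrix_inverse w B0 B T" and b: "b \<in> B"
  shows "matrix_coords B0 w B b e = (\<Sum>c\<in>B0. T b c * w c e)"
proof -
  define T' where "T' = (SOME T. matrix_inverse w B0 B T)"
  have T': "matrix_inverse w B0 B T'" unfolding T'_def by (rule someI[of _ T]) (rule T)
  have "T' b d = T b d" if d: "d \<in> B0" for d
  proof -
    have "T' b d = (\<Sum>c\<in>B0. T' b c * (if c = d then 1 else 0))"
      using d fin by (simp add: mult_if_one)
    also have "\<dots> = (\<Sum>c\<in>B0. T' b c * (\<Sum>a\<in>B. w c a * T a d))"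
      using T d by (intro sum.cong) (auto simp: matrix_inverse_def)
    also have "\<dots> = (\<Sum>a\<in>B. (\<Sum>c\<in>B0. T' b c * w c a) * T a d)"
      by (simp add: sum_distrib_left sum_distrib_right mult.assoc) (rule sum.swap)
    also have "\<dots> = (\<Sum>a\<in>B. (if b = a then 1 else 0) * T a d)"
      using T' b by (intro sum.cong) (auto simp: matrix_inverse_def)
    also have "\<dots> = T b d" using b fin by (simp add: if_one_mult)
    finally show ?thesis .
  qed
  then show ?thesis unfolding matrix_coords_def T'_def[symmetric] by simp
qed

text \<open>\<open>n\<close> holds the coordinates of column \<open>e\<close> over the columns
  \<open>B\<close>. Replacing \<open>b\<close> by \<open>e\<close> is a Gauss-Jordan step on the
  inverse: row \<open>b\<close>, divided by \<open>n b\<close>, becomes row \<open>e\<close>, and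
  multiples of it are subtracted from the other rows.\<close>

lemma matrix_inverse_pivot:
  assumes fin: "finite B" "finite B0" and T: "matrix_inverse w B0 B T"
    and b: "b \<in> B" and e: "e \<notin> B" and n: "\<And>a. n a = (\<Sum>c\<in>B0. T a c * w c e)" and nz: "n b \<noteq> 0"
  defines "T' \<equiv> \<lambda>a d. if a = e then T b d / n b else T a d - n a * T b d / n b"
  shows "matrix_inverse w B0 (insert e (B - {b})) T'"
proof -
  have l: "\<And>c d. \<lbrakk>c \<in> B0; d \<in> B0\<rbrakk> \<Longrightarrow> (\<Sum>a\<in>B. w c a * T a d) = (if c = d then 1 else 0)"
    and r: "\<And>a a'. \<lbrakk>a \<in> B; a' \<in> B\<rbrakk> \<Longrightarrow> (\<Sum>c\<in>B0. T a c * w c a') = (if a = a' then 1 else 0)"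
    using T by (auto simp: matrix_inverse_def)
  have w: "(\<Sum>a\<in>B. w c a * n a) = w c e" if c: "c \<in> B0" for c
  proof -
    have "(\<Sum>a\<in>B. w c a * n a) = (\<Sum>d\<in>B0. (\<Sum>a\<in>B. w c a * T a d) * w d e)"
      unfolding n by (simp add: sum_distrib_left sum_distrib_right mult.assoc) (rule sum.swap)
    also have "\<dots> = (\<Sum>d\<in>B0. (if c = d then 1 else 0) * w d e)"
      by (rule sum.cong) (auto simp: l c)
    also have "\<dots> = w c e" using c fin by (simp add: if_one_mult)
    finally show ?thesis .
  qed
  have 1: "(\<Sum>a\<in>insert e (B - {b}). w c a * T' a d) = (if c = d then 1 else 0)"
    if cd: "c \<in> B0" "d \<in> B0" for c d
  proof -
    have "(\<Sum>a\<in>insert e (B - {b}). w c a * T' a d)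
        = w c e * (T b d / n b) + (\<Sum>a\<in>B - {b}. w c a * (T a d - n a * T b d / n b))"
      using e fin by (subst sum.insert) (auto simp: T'_def intro!: sum.cong arg_cong2[where f = "(*)"])
    \<comment> \<open>The summand at \<open>b\<close> is zero, since \<open>n b / n b\<close> is
      one, so \<open>b\<close> may be put back.\<close>
    also have "(\<Sum>a\<in>B - {b}. w c a * (T a d - n a * T b d / n b)) =
        (\<Sum>a\<in>B. w c a * (T a d - n a * T b d / n b))"
      using b fin nz by (simp add: sum.remove[OF _ b])
    also have "\<dots> = (\<Sum>a\<in>B. w c a * T a d) - (\<Sum>a\<in>B. w c a * n a) * (T b d / n b)"
      by (simp add: right_diff_distrib sum_subtractf sum_distrib_right sum_divide_distrib mult.assoc)
    finally show ?thesis using w[OF cd(1)] l[OF cd] by simp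
  qed
  have 2: "(\<Sum>c\<in>B0. T' a c * w c a') = (if a = a' then 1 else 0)"
    if aa: "a \<in> insert e (B - {b})" "a' \<in> insert e (B - {b})" for a a'
  proof -
    have s: "(\<Sum>c\<in>B0. T x c * w c a') = (if a' = e then n x else if x = a' then 1 else 0)"
      if "x \<in> B" for x
      using r[OF that, of a'] aa n by auto
    show ?thesis
    proof (cases "a = e")
      case True
      then have "(\<Sum>c\<in>B0. T' a c * w c a') = (\<Sum>c\<in>B0. T b c * w c a') / n b"
        by (simp add: T'_def sum_divide_distrib)
      then show ?thesis using s[OF b] True aa nz by auto
    next
      case False
      then have a: "a \<in> B" "a \<noteq> b" using aa by auto
      have "(\<Sum>c\<in>B0. T' a c * w c a') = (\<Sum>c\<in>B0. T a c * w c a') - n a / n b * (\<Sum>c\<in>B0. T b c * w c a')"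
        using False by (simp add: T'_def left_diff_distrib sum_subtractf sum_distrib_left mult.assoc)
      then show ?thesis using s[OF b] s[OF a(1)] False a aa nz by auto
    qed
  qed
  show ?thesis using 1 2 by (auto simp: matrix_inverse_def)
qed

locale std_matrix =
  fixes E B0 :: "'a set" and w :: "'a \<Rightarrow> 'a \<Rightarrow> 'k::field"
  assumes finE: "finite E" and B0_sub: "B0 \<subseteq> E"
    and w_unit: "\<And>b c. \<lbrakk>b \<in> B0; c \<in> B0\<rbrakk> \<Longrightarrow> w b c = (if b = c then 1 else 0)"
begin

lemma finB0: "finite B0" using B0_sub finE finite_subset by blast

lemma B0_inverse: "matrix_inverse w B0 B0 (\<lambda>b c. if b = c then 1 else 0)"
  unfolding matrix_inverse_def using finB0 w_unit
  by (auto simp: mult_if_one if_one_mult)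

lemma coords_B0: "b \<in> B0 \<Longrightarrow> matrix_coords B0 w B0 b e = w b e"
  using finB0 by (simp add: matrix_coords_eq[OF finB0 finB0 B0_inverse] if_one_mult)

text \<open>New coordinates enter here: the gluing of two signings and a given representation both
  only have to supply the columns of \<open>w\<close> outside \<open>B0\<close>.\<close>

sublocale coordinatization E "matrix_bases E B0 w" "matrix_coords B0 w"
proof
  let ?Bs = "matrix_bases E B0 w" and ?N = "matrix_coords B0 w"
  have fin: "\<And>B. B \<in> ?Bs \<Longrightarrow> finite B" using finE finite_subset by (auto simp: matrix_bases_def)
  show "finite E" by (rule finE)
  show "?Bs \<noteq> {}" using B0_inverse B0_sub by (auto simp: matrix_bases_def)
  show "B \<subseteq> E" if "B \<in> ?Bs" for B using that by (simp add: matrix_bases_def)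
  show base: "?N B b e = (if e = b then 1 else 0)" if B: "B \<in> ?Bs" "b \<in> B" "e \<in> B" for B b e
  proof -
    obtain T where T: "matrix_inverse w B0 B T" using B by (auto simp: matrix_bases_def)
    then show ?thesis using matrix_coords_eq[OF fin[OF B(1)] finB0 T B(2)] B
      by (auto simp: matrix_inverse_def)
  qed
  show cocycle: "?N B b e = (\<Sum>b'\<in>B'. ?N B b b' * ?N B' b' e)"
    if B: "B \<in> ?Bs" "B' \<in> ?Bs" "b \<in> B" for B B' b e
  proof -
    obtain T T' where T: "matrix_inverse w B0 B T" and T': "matrix_inverse w B0 B' T'"
      using B by (auto simp: matrix_bases_def)
    have "(\<Sum>b'\<in>B'. ?N B b b' * ?N B' b' e)
        = (\<Sum>b'\<in>B'. (\<Sum>c\<in>B0. T b c * w c b') * (\<Sum>d\<in>B0. T' b' d * w d e))"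
      using matrix_coords_eq[OF fin[OF B(1)] finB0 T B(3)] matrix_coords_eq[OF fin[OF B(2)] finB0 T']
      by simp
    also have "\<dots> = (\<Sum>b'\<in>B'. \<Sum>d\<in>B0. \<Sum>c\<in>B0. T b c * (w c b' * T' b' d) * w d e)"
      by (simp add: sum_distrib_left sum_distrib_right mult.assoc)
    also have "\<dots> = (\<Sum>d\<in>B0. \<Sum>b'\<in>B'. \<Sum>c\<in>B0. T b c * (w c b' * T' b' d) * w d e)"
      by (rule sum.swap)
    also have "\<dots> = (\<Sum>d\<in>B0. \<Sum>c\<in>B0. \<Sum>b'\<in>B'. T b c * (w c b' * T' b' d) * w d e)"
      by (rule sum.cong[OF refl], rule sum.swap)
    also have "\<dots> = (\<Sum>d\<in>B0. \<Sum>c\<in>B0. T b c * (\<Sum>b'\<in>B'. w c b' * T' b' d) * w d e)"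
      by (simp add: sum_distrib_left sum_distrib_right mult.assoc)
    also have "\<dots> = (\<Sum>d\<in>B0. \<Sum>c\<in>B0. if c = d then T b c * w d e else 0)"
      using T' by (intro sum.cong) (auto simp: matrix_inverse_def)
    also have "\<dots> = (\<Sum>d\<in>B0. T b d * w d e)" using finB0 by simp
    finally show ?thesis using matrix_coords_eq[OF fin[OF B(1)] finB0 T B(3)] by simp
  qed
  show "?N B b e \<noteq> 0 \<longleftrightarrow> insert e (B - {b}) \<in> ?Bs" if B: "B \<in> ?Bs" "b \<in> B" "e \<in> E" for B b e
  proof
    assume nz: "?N B b e \<noteq> 0"
    show "insert e (B - {b}) \<in> ?Bs"
    proof (cases "e \<in> B")
      case True
      then have "e = b" using base[OF B(1,2), of e] nz by (auto split: if_splits)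
      then show ?thesis using B by (simp add: insert_absorb)
    next
      case False
      obtain T where T: "matrix_inverse w B0 B T" using B by (auto simp: matrix_bases_def)
      have "?N B b e = (\<Sum>c\<in>B0. T b c * w c e)"
        using matrix_coords_eq[OF fin[OF B(1)] finB0 T B(2)] .
      then have "(\<Sum>c\<in>B0. T b c * w c e) \<noteq> 0" using nz by simp
      from matrix_inverse_pivot[OF fin[OF B(1)] finB0 T B(2) False refl this]
      show ?thesis using B by (auto simp: matrix_bases_def)
    qed
  next
    assume B': "insert e (B - {b}) \<in> ?Bs" (is "?B \<in> _")
    show "?N B b e \<noteq> 0"
    proof (cases "e \<in> B")
      case True
      show ?thesis
      proof (cases "e = b")
        case False
        have "?N B b b = (\<Sum>b'\<in>?B. ?N B b b' * ?N ?B b' b)" by (rule cocycle[OF B(1) B' B(2)])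
        also have "\<dots> = 0" by (rule sum.neutral) (use base[OF B(1,2)] True False in auto)
        finally show ?thesis using base[OF B(1,2,2)] by simp
      qed (use base[OF B(1,2,2)] in simp)
    next
      case False
      \<comment> \<open>\<open>e\<close> is a unit vector over the new basis. Expanded through
        \<open>B\<close>, its coordinate one has the factor \<open>?N B b e\<close>, which is
        therefore nonzero.\<close>
      have "?N ?B e e = (\<Sum>b'\<in>B. ?N ?B e b' * ?N B b' e)" by (rule cocycle[OF B' B(1)]) simp
      also have "\<dots> = (\<Sum>b'\<in>B. if b' = b then ?N ?B e b * ?N B b e else 0)"
        by (rule sum.cong) (use base[OF B', of e] False in auto)
      also have "\<dots> = ?N ?B e b * ?N B b e" using B fin by simp
      finally show ?thesis using base[OF B', of e e] by auto
    qed
  qed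
qed

end

section \<open>Unimodular coordinates\<close>

text \<open>Small entries over every basis replace the condition on all minors over a single one,
  since pivots turn minors into entries; \<open>minor\<close> recovers that condition.\<close>

locale unimodular = coordinatization E Bs N
  for E :: "'a set" and Bs and N :: "'a set \<Rightarrow> 'a \<Rightarrow> 'a \<Rightarrow> real" +
  assumes entries: "\<lbrakk>B \<in> Bs; b \<in> B; e \<in> E\<rbrakk> \<Longrightarrow> N B b e \<in> {-1, 0, 1}"
begin

lemma entry_square: "\<lbrakk>B \<in> Bs; b \<in> B; e \<in> E; N B b e \<noteq> 0\<rbrakk> \<Longrightarrow> N B b e * N B b e = 1"
  using entries[of B b e] by auto

lemma entry_cases:
  "\<lbrakk>B \<in> Bs; b \<in> B; e \<in> E\<rbrakk> \<Longrightarrow> N B b e = -1 \<or> N B b e = 0 \<or> N B b e = 1"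
  using entries[of B b e] by auto

text \<open>A full block of signs has to be singular: otherwise a pivot on one of its entries
  produces an entry of absolute value two.\<close>

lemma two_by_two:
  assumes "B \<in> Bs" "a \<in> B" "b \<in> B" "a \<noteq> b" "c \<in> E" "d \<in> E" "d \<notin> B"
    "N B a c \<noteq> 0" "N B b c \<noteq> 0" "N B a d \<noteq> 0" "N B b d \<noteq> 0"
  shows "N B a c * N B b c = N B a d * N B b d"
proof -
  have B': "insert d (B - {b}) \<in> Bs" using N_exchange assms by blast
  have "N (insert d (B - {b})) a c = N B a c - N B a d * N B b c / N B b d"
    by (rule pivot) (use assms B' in auto)
  moreover have "N (insert d (B - {b})) a c \<in> {-1, 0, 1}"
    by (rule entries) (use assms B' in auto)
  ultimately show ?thesis
    using entry_cases[of B a c] entry_cases[of B b c] entry_cases[of B a d] entry_cases[of B b d] assms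
    by auto
qed

text \<open>If \<open>w\<close> meets \<open>r1\<close>, the rows split into two full blocks whose
  signs multiply. If not, \<open>w\<close> closes the path to a chordless hexagon. A pivot on
  \<open>r1\<close>, \<open>c1\<close> turns it into a full block on \<open>r0\<close> and
  \<open>r2\<close>; the minus sign is that of the pivot correction at \<open>r0\<close>,
  \<open>c2\<close>.\<close>

lemma three_path_sign:
  assumes B: "B \<in> Bs" and r: "r0 \<in> B" "r1 \<in> B" "r2 \<in> B" "r0 \<noteq> r1" "r0 \<noteq> r2" "r1 \<noteq> r2"
    and c: "c1 \<in> E" "c1 \<notin> B" "c2 \<in> E" "c2 \<notin> B" and w: "w \<in> E" "w \<notin> B"
    and path: "N B r0 c1 \<noteq> 0" "N B r1 c1 \<noteq> 0" "N B r2 c1 = 0"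
      "N B r0 c2 = 0" "N B r1 c2 \<noteq> 0" "N B r2 c2 \<noteq> 0"
    and ends: "N B r0 w \<noteq> 0" "N B r2 w \<noteq> 0"
  shows "N B r0 w * N B r2 w =
    (if N B r1 w = 0 then -1 else 1) * (N B r0 c1 * N B r1 c1 * (N B r1 c2 * N B r2 c2))"
proof (cases "N B r1 w = 0")
  case False
  have "N B r0 w * N B r1 w = N B r0 c1 * N B r1 c1"
    by (rule two_by_two) (use assms False in auto)
  moreover have "N B r1 w * N B r2 w = N B r1 c2 * N B r2 c2"
    by (rule two_by_two) (use assms False in auto)
  moreover have "N B r1 w * N B r1 w = 1" by (rule entry_square) (use assms False in auto)
  ultimately show ?thesis using False
    by (smt (verit, ccfv_SIG) mult.assoc mult.left_commute mult_cancel_left1)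
next
  case True
  let ?B = "insert c1 (B - {r1})"
  have B': "?B \<in> Bs" using N_exchange[OF B r(2) c(1)] path by blast
  have p: "N ?B a g = N B a g - N B a c1 * N B r1 g / N B r1 c1" if "a \<in> B" "a \<noteq> r1" "g \<in> E" for a g
    by (rule pivot) (use that assms B' in auto)
  have "N ?B r0 w * N ?B r2 w = N ?B r0 c2 * N ?B r2 c2"
    by (rule two_by_two)
      (use assms B' True in \<open>auto simp: p\<close>)
  then show ?thesis
    using assms True entry_cases[OF B r(2) c(1)] by (auto simp: p)
qed

end

text \<open>No signs occur any more, only supports, so the pattern can be read over the bits. For
  one and the same column it is contradictory, which gives uniqueness of signings; for two columns
  of one binary matroid it is a Fano minor.\<close>

definition sign_conflict where
  "sign_conflict E1 Bs1 (N1 :: 'a set \<Rightarrow> 'a \<Rightarrow> 'a \<Rightarrow> real) w1 E2 Bs2 (N2 :: 'a set \<Rightarrow> 'a \<Rightarrow> 'a \<Rightarrow> real) w2 \<longleftrightarrow>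
    (\<exists>B r0 r1 r2 c1 c2. B \<in> Bs1 \<and> B \<in> Bs2 \<and> {r0, r1, r2} \<subseteq> B \<and> r0 \<noteq> r1 \<and> r0 \<noteq> r2 \<and> r1 \<noteq> r2
      \<and> {c1, c2} \<subseteq> E1 \<inter> E2 - B \<and> w1 \<notin> B \<and> w2 \<notin> B
      \<and> N1 B r0 c1 \<noteq> 0 \<and> N1 B r1 c1 \<noteq> 0 \<and> N1 B r2 c1 = 0
      \<and> N1 B r0 c2 = 0 \<and> N1 B r1 c2 \<noteq> 0 \<and> N1 B r2 c2 \<noteq> 0
      \<and> N1 B r0 w1 \<noteq> 0 \<and> N1 B r2 w1 \<noteq> 0 \<and> N2 B r0 w2 \<noteq> 0 \<and> N2 B r2 w2 \<noteq> 0
      \<and> (N1 B r1 w1 = 0) \<noteq> (N2 B r1 w2 = 0))"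

text \<open>The signs along an induced path \<open>r 0, c 1, r 1, ..., c k, r k\<close> of the fundamental graph determine the
  product of the end entries of a further column, up to the number of its nonzero entries on the
  path. A pivot on \<open>(r 1, c 2)\<close> merges \<open>r 1\<close> and \<open>r 2\<close> and reduces a conflict between the columns
  \<open>w1\<close> and \<open>w2\<close> to a path with \<open>k = 2\<close>, where it is visible in the supports.\<close>

lemma path_sign:
  assumes 1: "unimodular E1 Bs1 N1" and 2: "unimodular E2 Bs2 N2"
    and "1 \<le> k" "B \<in> Bs1" "B \<in> Bs2"
    and "\<And>m. m \<le> k \<Longrightarrow> r m \<in> B" "inj_on r {..k}"
    and "\<And>l. 1 \<le> l \<Longrightarrow> l \<le> k \<Longrightarrow> c l \<in> E1 \<and> c l \<in> E2 \<and> c l \<notin> B"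
    and "\<And>m l. \<lbrakk>m \<le> k; 1 \<le> l; l \<le> k\<rbrakk> \<Longrightarrow> N1 B (r m) (c l) = N2 B (r m) (c l)"
    and "\<And>m l. \<lbrakk>m \<le> k; 1 \<le> l; l \<le> k\<rbrakk> \<Longrightarrow> N1 B (r m) (c l) \<noteq> 0 \<longleftrightarrow> l = m \<or> l = Suc m"
    and "w1 \<in> E1" "w1 \<notin> B" "w2 \<in> E2" "w2 \<notin> B"
    and "N1 B (r 0) w1 \<noteq> 0" "N1 B (r k) w1 \<noteq> 0" "N2 B (r 0) w2 \<noteq> 0" "N2 B (r k) w2 \<noteq> 0"
    and "N1 B (r 0) w1 * N1 B (r k) w1 \<noteq> N2 B (r 0) w2 * N2 B (r k) w2"
  shows "sign_conflict E1 Bs1 N1 w1 E2 Bs2 N2 w2"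
  using assms(3-)
proof (induction k arbitrary: B r c rule: less_induct)
  case (less k)
  interpret N1: unimodular E1 Bs1 N1 by fact
  interpret N2: unimodular E2 Bs2 N2 by fact
  note B = less.prems(2,3) and r = less.prems(4) and inj = less.prems(5) and c = less.prems(6)
    and eq = less.prems(7) and adj = less.prems(8) and w = less.prems(9-12) and ends = less.prems(13-16)
    and bad = less.prems(17)
  have rne: "r m \<noteq> r m'" if "m \<le> k" "m' \<le> k" "m \<noteq> m'" for m m'
    using inj that by (auto dest: inj_onD)
  consider "k = 1" | "k = 2" | "k \<ge> 3" using less.prems(1) by linarith
  then show ?case
  proof cases
    case 1
    have adj': "N1 B (r 0) (c 1) \<noteq> 0" "N1 B (r 1) (c 1) \<noteq> 0"
      using adj[of 0 1] adj[of 1 1] 1 by auto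
    have "N1 B (r 0) w1 * N1 B (r 1) w1 = N1 B (r 0) (c 1) * N1 B (r 1) (c 1)"
      by (rule N1.two_by_two) (use 1 B r[of 0] r[of 1] rne[of 0 1] c[of 1] w ends adj' in auto)
    moreover have "N2 B (r 0) w2 * N2 B (r 1) w2 = N2 B (r 0) (c 1) * N2 B (r 1) (c 1)"
      by (rule N2.two_by_two)
        (use 1 B r[of 0] r[of 1] rne[of 0 1] c[of 1] w ends adj' eq[of 0 1] eq[of 1 1] in auto)
    ultimately show ?thesis using bad eq[of 0 1] eq[of 1 1] 1 by simp
  next
    case 2
    have a: "N1 B (r 0) (c 1) \<noteq> 0" "N1 B (r 1) (c 1) \<noteq> 0" "N1 B (r 2) (c 1) = 0"
      "N1 B (r 0) (c 2) = 0" "N1 B (r 1) (c 2) \<noteq> 0" "N1 B (r 2) (c 2) \<noteq> 0"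
      using adj[of 0 1] adj[of 1 1] adj[of 2 1] adj[of 0 2] adj[of 1 2] adj[of 2 2] 2 by auto
    have e: "N2 B (r 0) (c 1) = N1 B (r 0) (c 1)" "N2 B (r 1) (c 1) = N1 B (r 1) (c 1)"
      "N2 B (r 2) (c 1) = N1 B (r 2) (c 1)" "N2 B (r 0) (c 2) = N1 B (r 0) (c 2)"
      "N2 B (r 1) (c 2) = N1 B (r 1) (c 2)" "N2 B (r 2) (c 2) = N1 B (r 2) (c 2)"
      using eq[of 0 1] eq[of 1 1] eq[of 2 1] eq[of 0 2] eq[of 1 2] eq[of 2 2] 2 by auto
    have r': "r 0 \<in> B" "r 1 \<in> B" "r 2 \<in> B" "r 0 \<noteq> r 1" "r 0 \<noteq> r 2" "r 1 \<noteq> r 2"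
      "c 1 \<in> E1" "c 1 \<in> E2" "c 1 \<notin> B" "c 2 \<in> E1" "c 2 \<in> E2" "c 2 \<notin> B"
      using r[of 0] r[of 1] r[of 2] rne[of 0 1] rne[of 0 2] rne[of 1 2] c[of 1] c[of 2] 2 by auto
    note ends' = ends[unfolded 2]
    have "N1 B (r 0) w1 * N1 B (r 2) w1 = (if N1 B (r 1) w1 = 0 then -1 else 1) *
        (N1 B (r 0) (c 1) * N1 B (r 1) (c 1) * (N1 B (r 1) (c 2) * N1 B (r 2) (c 2)))"
      by (rule N1.three_path_sign) (use B r' w ends' a in auto)
    moreover have "N2 B (r 0) w2 * N2 B (r 2) w2 = (if N2 B (r 1) w2 = 0 then -1 else 1) *
        (N2 B (r 0) (c 1) * N2 B (r 1) (c 1) * (N2 B (r 1) (c 2) * N2 B (r 2) (c 2)))"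
      by (rule N2.three_path_sign) (use B r' w ends' a e in auto)
    ultimately have prod: "(N1 B (r 1) w1 = 0) = (N2 B (r 1) w2 = 0) \<Longrightarrow>
        N1 B (r 0) w1 * N1 B (r 2) w1 = N2 B (r 0) w2 * N2 B (r 2) w2"
      by (simp only: e)
    have ne: "(N1 B (r 1) w1 = 0) \<noteq> (N2 B (r 1) w2 = 0)"
      by (rule contrapos_nn[OF bad[unfolded 2]]) (rule prod)
    show ?thesis
      unfolding sign_conflict_def
      by (rule exI[of _ B], rule exI[of _ "r 0"], rule exI[of _ "r 1"], rule exI[of _ "r 2"],
          rule exI[of _ "c 1"], rule exI[of _ "c 2"])
        (intro conjI ne; use B r' w ends' a in simp)
  next
    case 3
    let ?B = "insert (c 2) (B - {r 1})"
    \<comment> \<open>The shortened path is \<open>r 0\<close>, \<open>c 1\<close>,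
      \<open>r 2\<close>, \<open>c 3\<close>, \<open>r 3\<close> and so on: \<open>r 1\<close>
      leaves the basis, \<open>c 2\<close> enters it, and the pivot makes \<open>r 2\<close>
      adjacent to \<open>c 1\<close>.\<close>
    define r' where "r' m = (if m = 0 then r 0 else r (Suc m))" for m
    define c' where "c' l = (if l = 1 then c 1 else c (Suc l))" for l
    have c2: "c 2 \<in> E1" "c 2 \<in> E2" "c 2 \<notin> B" using c[of 2] 3 by auto
    have r1: "r 1 \<in> B" using r 3 by simp
    have n1: "N1 B (r 1) (c 2) \<noteq> 0" using adj[of 1 2] 3 by simp
    then have n2: "N2 B (r 1) (c 2) \<noteq> 0" using eq[of 1 2] 3 by simp
    have B1: "?B \<in> Bs1" using N1.N_exchange[OF B(1) r1 c2(1)] n1 by simp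
    have B2: "?B \<in> Bs2" using N2.N_exchange[OF B(2) r1 c2(2)] n2 by simp
    have p1: "N1 ?B a g = N1 B a g - N1 B a (c 2) * N1 B (r 1) g / N1 B (r 1) (c 2)"
      if "a \<in> B" "a \<noteq> r 1" "g \<in> E1" for a g
      by (rule N1.pivot) (use that B B1 c2 r1 in auto)
    have p2: "N2 ?B a g = N2 B a g - N2 B a (c 2) * N2 B (r 1) g / N2 B (r 1) (c 2)"
      if "a \<in> B" "a \<noteq> r 1" "g \<in> E2" for a g
      by (rule N2.pivot) (use that B B2 c2 r1 in auto)
    have r'B: "r' m \<in> B \<and> r' m \<noteq> r 1" if "m \<le> k - 1" for m
      using that 3 r[of 0] r[of "Suc m"] rne[of 0 1] rne[of "Suc m" 1] by (auto simp: r'_def)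
    have c'E: "c' l \<in> E1 \<and> c' l \<in> E2 \<and> c' l \<notin> B \<and> c' l \<noteq> c 2" if "1 \<le> l" "l \<le> k - 1" for l
    proof -
      have "c 1 \<noteq> c 2" using adj[of 0 1] adj[of 0 2] 3 by auto
      moreover have "c (Suc l) \<noteq> c 2" if "l \<noteq> 1" "Suc l \<le> k"
        using adj[of 1 "Suc l"] adj[of 1 2] 3 that \<open>1 \<le> l\<close> by auto
      ultimately show ?thesis using that 3 c[of 1] c[of "Suc l"] by (auto simp: c'_def)
    qed
    \<comment> \<open>From \<open>k = 3\<close> on, neither end of the path meets
      \<open>c 2\<close>, so the pivot keeps the end entries of \<open>w1\<close> and
      \<open>w2\<close>. At \<open>k = 2\<close> it would change them, which makes that length a
      base case.\<close>
    have ends1: "N1 B (r 0) (c 2) = 0" "N1 B (r k) (c 2) = 0" using adj[of 0 2] adj[of k 2] 3 by auto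
    then have ends2: "N2 B (r 0) (c 2) = 0" "N2 B (r k) (c 2) = 0" using eq[of 0 2] eq[of k 2] 3 by auto
    have k: "r' (k - 1) = r k" "r' 0 = r 0" using 3 by (auto simp: r'_def)
    have r0k: "r 0 \<in> B" "r 0 \<noteq> r 1" "r k \<in> B" "r k \<noteq> r 1" using r rne[of 0 1] rne[of k 1] 3 by auto
    have w1E: "N1 ?B (r 0) w1 = N1 B (r 0) w1" "N1 ?B (r k) w1 = N1 B (r k) w1"
      using p1[of "r 0" w1] p1[of "r k" w1] r0k w ends1 by auto
    have w2E: "N2 ?B (r 0) w2 = N2 B (r 0) w2" "N2 ?B (r k) w2 = N2 B (r k) w2"
      using p2[of "r 0" w2] p2[of "r k" w2] r0k w ends2 by auto
    show ?thesis
    proof (rule less.IH[of "k - 1" ?B r' c'])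
      show "k - 1 < k" "1 \<le> k - 1" using 3 by auto
      show "r' m \<in> ?B" if "m \<le> k - 1" for m using r'B[OF that] by simp
      show "inj_on r' {..k - 1}"
      proof (rule inj_onI)
        fix m m' assume "m \<in> {..k - 1}" "m' \<in> {..k - 1}" "r' m = r' m'"
        moreover from this have "Suc m \<le> k" "Suc m' \<le> k" using 3 by auto
        ultimately show "m = m'"
          using 3 rne[of 0 "Suc m"] rne[of 0 "Suc m'"] rne[of "Suc m" "Suc m'"]
          by (auto simp: r'_def split: if_splits)
      qed
      show "c' l \<in> E1 \<and> c' l \<in> E2 \<and> c' l \<notin> ?B" if "1 \<le> l" "l \<le> k - 1" for l
        using c'E[OF that] by auto
      have e: "N1 B (r m) (c l) = N2 B (r m) (c l)" if "m \<le> k" "l \<in> {1..k}" for m l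
        using eq that by auto
      show "N1 ?B (r' m) (c' l) = N2 ?B (r' m) (c' l)" if ml: "m \<le> k - 1" "1 \<le> l" "l \<le> k - 1" for m l
      proof -
        obtain m0 where m0: "r' m = r m0" "m0 \<le> k"
        proof
          show "r' m = r (if m = 0 then 0 else Suc m)" by (simp add: r'_def)
        qed (use ml 3 in auto)
        obtain l0 where l0: "c' l = c l0" "l0 \<in> {1..k}"
        proof
          show "c' l = c (if l = 1 then 1 else Suc l)" by (simp add: c'_def)
        qed (use ml 3 in auto)
        show ?thesis
          using p1[of "r' m" "c' l"] p2[of "r' m" "c' l"] r'B[OF ml(1)] c'E[OF ml(2,3)]
            e[of m0 l0] e[of m0 2] e[of 1 l0] e[of 1 2] m0 l0 3 by auto
      qed
      show "N1 ?B (r' m) (c' l) \<noteq> 0 \<longleftrightarrow> l = m \<or> l = Suc m" if ml: "m \<le> k - 1" "1 \<le> l" "l \<le> k - 1" for m l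
      proof -
        have P: "N1 ?B (r' m) (c' l) = N1 B (r' m) (c' l) - N1 B (r' m) (c 2) * N1 B (r 1) (c' l) / N1 B (r 1) (c 2)"
          using p1[of "r' m" "c' l"] r'B[OF ml(1)] c'E[OF ml(2,3)] by auto
        have Suc: "Suc m \<le> k" "Suc l \<le> k" using ml 3 by auto
        have 1: "N1 B (r 1) (c' l) \<noteq> 0 \<longleftrightarrow> l = 1"
          using adj[of 1 1] adj[of 1 "Suc l"] ml Suc 3 by (auto simp: c'_def)
        have 2: "N1 B (r' m) (c 2) \<noteq> 0 \<longleftrightarrow> m = 1"
          using adj[of 0 2] adj[of "Suc m" 2] ml Suc 3 by (auto simp: r'_def)
        have 0: "N1 B (r' m) (c' l) \<noteq> 0 \<longleftrightarrow> (if l = 1 then m = 0 else l = m \<or> l = Suc m)"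
          using adj[of 0 1] adj[of 0 "Suc l"] adj[of "Suc m" 1] adj[of "Suc m" "Suc l"] ml Suc 3
          by (auto simp: r'_def c'_def)
        \<comment> \<open>The correction is nonzero only at \<open>r 2\<close>, \<open>c 1\<close>,
          the one edge that the shortened path lacked.\<close>
        show ?thesis
        proof (cases "l = 1 \<and> m = 1")
          case True
          then show ?thesis using P 0 1 2 n1 by simp
        next
          case False
          then have "N1 ?B (r' m) (c' l) = N1 B (r' m) (c' l)" using P 1 2 by auto
          then show ?thesis using 0 False ml by auto
        qed
      qed
      show "w1 \<notin> ?B" "w2 \<notin> ?B" using w ends ends1 ends2 by auto
      show "N1 ?B (r' 0) w1 * N1 ?B (r' (k - 1)) w1 \<noteq> N2 ?B (r' 0) w2 * N2 ?B (r' (k - 1)) w2"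
        using bad unfolding k w1E w2E .
      show "N1 ?B (r' 0) w1 \<noteq> 0" "N1 ?B (r' (k - 1)) w1 \<noteq> 0"
        "N2 ?B (r' 0) w2 \<noteq> 0" "N2 ?B (r' (k - 1)) w2 \<noteq> 0"
        unfolding k w1E w2E by (rule ends)+
    qed (rule B1 B2 w)+
  qed
qed

section \<open>Deletion, duality, and extension by loops and parallel elements\<close>

definition deletion :: "'a set set \<Rightarrow> 'a \<Rightarrow> 'a set set" where
  "deletion Bs x = {B \<in> Bs. x \<notin> B}"

definition dual_bases :: "'a set \<Rightarrow> 'a set set \<Rightarrow> 'a set set" where
  "dual_bases E Bs = (\<lambda>B. E - B) ` Bs"

text \<open>The matrix [-A^T | I] dual to [I | A], where A holds the coordinates over the
  complementary basis. The sign makes its rows orthogonal to those of [I | A].\<close>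

definition dual_coords ::
  "'a set \<Rightarrow> ('a set \<Rightarrow> 'a \<Rightarrow> 'a \<Rightarrow> 'k::field) \<Rightarrow> 'a set \<Rightarrow> 'a \<Rightarrow> 'a \<Rightarrow> 'k" where
  "dual_coords E N C e b = (if b \<in> C then if b = e then 1 else 0 else - N (E - C) b e)"

context coordinatization begin

text \<open>If \<open>x\<close> lay in every basis, the family \<open>deletion Bs x\<close> would be
  empty; the basis \<open>B\<close> excludes this.\<close>

lemma deletion_coords:
  assumes "B \<in> Bs" "x \<notin> B" shows "coordinatization (E - {x}) (deletion Bs x) N"
  by (rule restrict_frames) (use assms base_sub in \<open>auto simp: deletion_def\<close>)

lemma mem_dual: "C \<in> dual_bases E Bs \<longleftrightarrow> C \<subseteq> E \<and> E - C \<in> Bs"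
  using base_sub by (auto simp: dual_bases_def double_diff intro!: image_eqI[of _ _ "E - C"])

lemma dual_dual: "dual_bases E (dual_bases E Bs) = Bs"
  using base_sub by (auto simp: dual_bases_def double_diff image_iff)

lemma dual_exchange_iff:
  assumes "C \<subseteq> E" "e \<in> C" "b \<in> E" "b \<notin> C"
  shows "insert b (C - {e}) \<in> dual_bases E Bs \<longleftrightarrow> insert e (E - C - {b}) \<in> Bs"
proof -
  have "E - insert b (C - {e}) = insert e (E - C - {b})" using assms by auto
  then show ?thesis using assms by (auto simp: mem_dual)
qed

text \<open>For the cocycle, a dual row is orthogonal to every row over \<open>E - C'\<close>. This
  is proved by splitting \<open>E\<close> along \<open>C\<close>, where the row is known, and
  applied by splitting \<open>E\<close> along \<open>C'\<close>, where it yields the wanted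
  expansion.\<close>

lemma dual_coordinatization: "coordinatization E (dual_bases E Bs) (dual_coords E N)"
proof
  show "finite E" by (rule finite_E)
  show "dual_bases E Bs \<noteq> {}" using nonempty by (simp add: dual_bases_def)
  show "B \<subseteq> E" if "B \<in> dual_bases E Bs" for B using that by (simp add: mem_dual)
  show "dual_coords E N C e b = (if b = e then 1 else 0)" if "b \<in> C" for C e b
    using that by (simp add: dual_coords_def)
  show "dual_coords E N C e b \<noteq> 0 \<longleftrightarrow> insert b (C - {e}) \<in> dual_bases E Bs"
    if C: "C \<in> dual_bases E Bs" "e \<in> C" "b \<in> E" for C e b
  proof (cases "b \<in> C")
    case True
    have "C - {e} \<notin> dual_bases E Bs"
    proof
      assume "C - {e} \<in> dual_bases E Bs"
      then have "E - (C - {e}) \<in> Bs" "E - C \<in> Bs" using C by (auto simp: mem_dual)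
      then have "E - C = E - (C - {e})" by (intro antichain) auto
      then show False using C by (auto simp: mem_dual)
    qed
    then show ?thesis using True C by (auto simp: dual_coords_def insert_absorb)
  next
    case False
    then show ?thesis
      using C N_exchange[of "E - C" b e] dual_exchange_iff[of C e b]
      by (auto simp: dual_coords_def mem_dual)
  qed
  show "dual_coords E N C e g = (\<Sum>e'\<in>C'. dual_coords E N C e e' * dual_coords E N C' e' g)"
    if C: "C \<in> dual_bases E Bs" "C' \<in> dual_bases E Bs" "e \<in> C" "g \<in> E" for C C' e g
  proof -
    let ?z = "dual_coords E N C e"
    have B: "C \<subseteq> E" "E - C \<in> Bs" "C' \<subseteq> E" "E - C' \<in> Bs" using C by (auto simp: mem_dual)
    have fin: "finite C'" using B finite_E finite_subset by blast
    show ?thesis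
    proof (cases "g \<in> C'")
      case True
      have "(\<Sum>e'\<in>C'. ?z e' * dual_coords E N C' e' g) = (\<Sum>e'\<in>C'. if e' = g then ?z g else 0)"
        using True by (intro sum.cong) (auto simp: dual_coords_def)
      then show ?thesis using True fin by simp
    next
      case False
      let ?B = "E - C" and ?B' = "E - C'"
      have g: "g \<in> ?B'" using False C by simp
      have kernel: "(\<Sum>h\<in>E. N ?B' g h * ?z h) = 0"
      proof -
        have "(\<Sum>h\<in>E. N ?B' g h * ?z h) = (\<Sum>h\<in>C. N ?B' g h * ?z h) + (\<Sum>h\<in>?B. N ?B' g h * ?z h)"
          using sum.subset_diff[OF B(1) finite_E] by (simp add: add.commute)
        also have "(\<Sum>h\<in>C. N ?B' g h * ?z h) = (\<Sum>h\<in>C. if h = e then N ?B' g e else 0)"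
          by (intro sum.cong) (auto simp: dual_coords_def)
        also have "\<dots> = N ?B' g e" using C B finite_E finite_subset[of C E] by simp
        also have "(\<Sum>h\<in>?B. N ?B' g h * ?z h) = - (\<Sum>h\<in>?B. N ?B' g h * N ?B h e)"
          by (simp add: dual_coords_def sum_negf)
        also have "(\<Sum>h\<in>?B. N ?B' g h * N ?B h e) = N ?B' g e"
          using N_cocycle[OF B(4,2) g, of e] C B by auto
        finally show ?thesis by simp
      qed
      have "(\<Sum>h\<in>E. N ?B' g h * ?z h) = (\<Sum>h\<in>C'. N ?B' g h * ?z h) + (\<Sum>h\<in>?B'. N ?B' g h * ?z h)"
        using sum.subset_diff[OF B(3) finite_E] by (simp add: add.commute)
      also have "(\<Sum>h\<in>?B'. N ?B' g h * ?z h) = (\<Sum>h\<in>?B'. if h = g then ?z g else 0)"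
        using N_base[OF B(4) g] by (intro sum.cong) auto
      also have "\<dots> = ?z g" using g finite_E by simp
      finally have "?z g = - (\<Sum>h\<in>C'. N ?B' g h * ?z h)" using kernel by (simp add: add_eq_0_iff2)
      also have "\<dots> = (\<Sum>h\<in>C'. ?z h * dual_coords E N C' h g)"
        using False by (simp add: dual_coords_def sum_negf mult.commute)
      finally show ?thesis .
    qed
  qed
qed

lemma loop_extension_coords:
  assumes "x \<notin> E" shows "coordinatization (insert x E) Bs (\<lambda>B b e. if e = x then 0 else N B b e)"
proof
  fix B b e assume B: "B \<in> Bs" "b \<in> B" "e \<in> insert x E"
  have "x \<notin> C" if "C \<in> Bs" for C using assms base_sub that by blast
  then show "(if e = x then 0 else N B b e) \<noteq> 0 \<longleftrightarrow> insert e (B - {b}) \<in> Bs"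
    using B N_exchange[of B b e] by auto
next
  fix B B' b e assume "B \<in> Bs" "B' \<in> Bs" "b \<in> B" "e \<in> insert x E"
  moreover from this have "x \<notin> B'" using assms base_sub by blast
  then have "(\<Sum>b'\<in>B'. (if b' = x then 0 else N B b b') * (if e = x then 0 else N B' b' e)) =
     (if e = x then 0 else \<Sum>b'\<in>B'. N B b b' * N B' b' e)"
    by (auto intro!: sum.cong sum.neutral)
  ultimately show "(if e = x then 0 else N B b e) =
     (\<Sum>b'\<in>B'. (if b' = x then 0 else N B b b') * (if e = x then 0 else N B' b' e))"
    using N_cocycle[of B B' b e] by auto
qed (use assms finite_E nonempty base_sub N_base in auto)

text \<open>No basis contains both \<open>x\<close> and its copy \<open>p\<close>, so
  \<open>\<phi>\<close> is injective on every basis and maps it to a basis of the deletion; the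
  coordinates are pulled back along \<open>\<phi>\<close>. \<open>N\<close> serves to recognize
  bases, while \<open>M\<close> may live over another field: bits for the former, reals for the
  latter.\<close>

lemma parallel_extension_coords:
  assumes x: "x \<in> E" "p \<in> E" "x \<noteq> p"
    and par: "\<And>B b. \<lbrakk>B \<in> Bs; b \<in> B\<rbrakk> \<Longrightarrow> N B b x = N B b p"
    and M: "coordinatization (E - {x}) (deletion Bs x) M"
  defines "\<phi> \<equiv> \<lambda>e. if e = x then p else e"
  shows "coordinatization E Bs (\<lambda>B b e. M (\<phi> ` B) (\<phi> b) (\<phi> e))"
    and "\<And>B. B \<in> Bs \<Longrightarrow> \<phi> ` B \<in> deletion Bs x"
proof -
  interpret M: coordinatization "E - {x}" "deletion Bs x" M by fact
  have px: "p \<notin> B" if "B \<in> Bs" "x \<in> B" for B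
    using par[OF that] N_base[OF that, of x] N_base[OF that, of p] that x by auto
  have im: "\<phi> ` B = insert p (B - {x})" if "x \<in> B" for B using that by (auto simp: \<phi>_def)
  have im': "\<phi> ` B = B" if "x \<notin> B" for B using that by (auto simp: \<phi>_def)
  have swap: "insert p (B - {x}) \<in> Bs" if "B \<in> Bs" "x \<in> B" for B
    using par[OF that] N_base[OF that, of x] N_exchange[OF that, of p] that x by auto
  show mem: "\<phi> ` B \<in> deletion Bs x" if "B \<in> Bs" for B
    using that swap x by (cases "x \<in> B") (auto simp: im im' deletion_def)
  have inj: "inj_on \<phi> B" if "B \<in> Bs" for B
    using px[OF that] by (auto simp: \<phi>_def inj_on_def)
  have \<phi>E: "\<phi> e \<in> E - {x}" if "e \<in> E" for e using that x by (auto simp: \<phi>_def)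
  \<comment> \<open>Replacing \<open>x\<close> by \<open>p\<close> in a basis is a pivot with entry
    one, and the column \<open>p\<close> is zero in the remaining rows, so no correction
    arises.\<close>
  have shift: "N B b e = N (\<phi> ` B) (\<phi> b) (\<phi> e)" if B: "B \<in> Bs" "b \<in> B" "e \<in> E" for B b e
  proof -
    have e: "N B b e = N B b (\<phi> e)" using par B by (auto simp: \<phi>_def)
    show ?thesis
    proof (cases "x \<in> B")
      case False
      moreover from this have "\<phi> b = b" using B by (auto simp: \<phi>_def)
      ultimately show ?thesis using e by (simp add: im')
    next
      case True
      have xx: "N B x p = 1" using par[OF B(1) True] N_base[OF B(1) True True] by simp
      have \<phi>e: "\<phi> e \<in> E" using \<phi>E B by blast
      note B' = swap[OF B(1) True]
      show ?thesis
      proof (cases "b = x")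
        case b: True
        then show ?thesis
          using pivot_row[OF B(1) True x(2) px[OF B(1) True] B' \<phi>e] e xx True
          by (simp add: im) (simp add: \<phi>_def)
      next
        case b: False
        have "N B b p = 0" using par[OF B(1,2)] N_base[OF B(1,2) True] b by simp
        moreover have "\<phi> b = b" using b by (simp add: \<phi>_def)
        ultimately show ?thesis
          using pivot[OF B(1) True x(2) px[OF B(1) True] B' \<phi>e B(2) b] e True
          by (simp add: im)
      qed
    qed
  qed
  show "coordinatization E Bs (\<lambda>B b e. M (\<phi> ` B) (\<phi> b) (\<phi> e))"
  proof
    fix B b e assume B: "B \<in> Bs" "b \<in> B" "e \<in> B"
    have "M (\<phi> ` B) (\<phi> b) (\<phi> e) = (if \<phi> e = \<phi> b then 1 else 0)"
      by (rule M.N_base) (use B mem in auto)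
    then show "M (\<phi> ` B) (\<phi> b) (\<phi> e) = (if e = b then 1 else 0)"
      using inj[OF B(1)] B by (auto dest: inj_onD)
  next
    fix B b e assume B: "B \<in> Bs" "b \<in> B" "e \<in> E"
    have "M (\<phi> ` B) (\<phi> b) (\<phi> e) \<noteq> 0 \<longleftrightarrow> insert (\<phi> e) (\<phi> ` B - {\<phi> b}) \<in> deletion Bs x"
      by (rule M.N_exchange) (use B mem \<phi>E in auto)
    also have "\<dots> \<longleftrightarrow> insert (\<phi> e) (\<phi> ` B - {\<phi> b}) \<in> Bs"
      using mem[OF B(1)] \<phi>E[OF B(3)] by (auto simp: deletion_def)
    also have "\<dots> \<longleftrightarrow> N (\<phi> ` B) (\<phi> b) (\<phi> e) \<noteq> 0"
      using N_exchange[of "\<phi> ` B" "\<phi> b" "\<phi> e"] mem[OF B(1)] \<phi>E[OF B(3)] B by (auto simp: deletion_def)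
    also have "\<dots> \<longleftrightarrow> insert e (B - {b}) \<in> Bs" using shift[OF B] N_exchange[OF B] by simp
    finally show "M (\<phi> ` B) (\<phi> b) (\<phi> e) \<noteq> 0 \<longleftrightarrow> insert e (B - {b}) \<in> Bs" .
  next
    fix B B' b e assume B: "B \<in> Bs" "B' \<in> Bs" "b \<in> B" "e \<in> E"
    have "M (\<phi> ` B) (\<phi> b) (\<phi> e) = (\<Sum>b'\<in>\<phi> ` B'. M (\<phi> ` B) (\<phi> b) b' * M (\<phi> ` B') b' (\<phi> e))"
      by (rule M.N_cocycle) (use B mem \<phi>E in auto)
    then show "M (\<phi> ` B) (\<phi> b) (\<phi> e) =
        (\<Sum>b'\<in>B'. M (\<phi> ` B) (\<phi> b) (\<phi> b') * M (\<phi> ` B') (\<phi> b') (\<phi> e))"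
      using sum.reindex[OF inj[OF B(2)]] by (simp add: o_def)
  qed (use finite_E nonempty base_sub in auto)
qed

lemma no_neighbours_loop:
  assumes "B \<in> Bs" "x \<in> E" "\<And>b. b \<in> B \<Longrightarrow> N B b x = 0" "C \<in> Bs"
  shows "x \<notin> C"
proof
  assume x: "x \<in> C"
  have "N C x x = (\<Sum>b\<in>B. N C x b * N B b x)" by (rule N_cocycle) (use assms x in auto)
  also have "\<dots> = 0" by (rule sum.neutral) (use assms in auto)
  finally show False using N_base[OF assms(4) x x] by simp
qed

lemma one_neighbour_parallel:
  assumes "B \<in> Bs" "x \<in> E" "p \<in> B" "N B p x = 1" "\<And>b. \<lbrakk>b \<in> B; b \<noteq> p\<rbrakk> \<Longrightarrow> N B b x = 0"
    "C \<in> Bs" "c \<in> C"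
  shows "N C c x = N C c p"
proof -
  have "N C c x = (\<Sum>b\<in>B. N C c b * N B b x)" by (rule N_cocycle) (use assms in auto)
  also have "\<dots> = (\<Sum>b\<in>B. if b = p then N C c p else 0)"
    by (rule sum.cong) (use assms in auto)
  also have "\<dots> = N C c p" using assms finite_base by simp
  finally show ?thesis .
qed

lemma rescale_coords:
  assumes "\<And>e. \<sigma> e * \<sigma> e = 1"
  shows "coordinatization E Bs (\<lambda>B b e. \<sigma> b * \<sigma> e * N B b e)"
proof
  have nz: "\<sigma> e \<noteq> 0" for e using assms[of e] by auto
  fix B b e assume "B \<in> Bs" "b \<in> B" "e \<in> E"
  then show "\<sigma> b * \<sigma> e * N B b e \<noteq> 0 \<longleftrightarrow> insert e (B - {b}) \<in> Bs"
    using N_exchange[of B b e] nz by simp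
next
  fix B B' b e assume B: "B \<in> Bs" "B' \<in> Bs" "b \<in> B" "e \<in> E"
  have "(\<Sum>b'\<in>B'. \<sigma> b * \<sigma> b' * N B b b' * (\<sigma> b' * \<sigma> e * N B' b' e)) =
      (\<Sum>b'\<in>B'. \<sigma> b * \<sigma> e * (N B b b' * N B' b' e))"
  proof (rule sum.cong)
    fix b'
    have "\<sigma> b * \<sigma> b' * N B b b' * (\<sigma> b' * \<sigma> e * N B' b' e) =
        (\<sigma> b' * \<sigma> b') * (\<sigma> b * \<sigma> e * (N B b b' * N B' b' e))" by (simp add: ac_simps)
    then show "\<sigma> b * \<sigma> b' * N B b b' * (\<sigma> b' * \<sigma> e * N B' b' e) =
        \<sigma> b * \<sigma> e * (N B b b' * N B' b' e)" by (simp add: assms)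
  qed simp
  also have "\<dots> = \<sigma> b * \<sigma> e * N B b e" using N_cocycle[OF B] by (simp add: sum_distrib_left)
  finally show "\<sigma> b * \<sigma> e * N B b e =
      (\<Sum>b'\<in>B'. \<sigma> b * \<sigma> b' * N B b b' * (\<sigma> b' * \<sigma> e * N B' b' e))" by simp
qed (use finite_E nonempty base_sub N_base assms in auto)

end

text \<open>Regularity without matrices, orderings or labels, as the inductions require;
  \<open>signable_of_totally_unimodular\<close> and \<open>regular\<close> translate.\<close>

definition signable :: "'a set \<Rightarrow> 'a set set \<Rightarrow> bool" where
  "signable E Bs \<longleftrightarrow> (\<exists>N. unimodular E Bs N)"

lemma unimodularI:
  assumes "coordinatization E Bs N" "\<And>B b e. \<lbrakk>B \<in> Bs; b \<in> B; e \<in> E\<rbrakk> \<Longrightarrow> N B b e \<in> {-1, 0, 1}"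
  shows "unimodular E Bs N"
  using assms by (simp add: unimodular_def unimodular_axioms_def)

lemma (in unimodular) deletion_unimodular:
  assumes "B \<in> Bs" "x \<notin> B" shows "unimodular (E - {x}) (deletion Bs x) N"
  by (rule unimodularI[OF deletion_coords[OF assms]]) (use entries in \<open>auto simp: deletion_def\<close>)

lemma (in unimodular) rescale_unimodular:
  assumes "\<And>e. \<sigma> e = 1 \<or> \<sigma> e = -1"
  shows "unimodular E Bs (\<lambda>B b e. \<sigma> b * \<sigma> e * N B b e)"
proof (rule unimodularI)
  show "coordinatization E Bs (\<lambda>B b e. \<sigma> b * \<sigma> e * N B b e)"
  proof (rule rescale_coords)
    show "\<sigma> e * \<sigma> e = 1" for e using assms[of e] by auto
  qed
  fix B b e assume "B \<in> Bs" "b \<in> B" "e \<in> E"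
  then show "\<sigma> b * \<sigma> e * N B b e \<in> {-1, 0, 1}"
    using entries[of B b e] assms[of b] assms[of e] by auto
qed

lemma signable_dual:
  assumes "coordinatization E Bs N" "signable E (dual_bases E Bs)" shows "signable E Bs"
proof -
  interpret N: coordinatization E Bs N by fact
  obtain M where "unimodular E (dual_bases E Bs) M" using assms by (auto simp: signable_def)
  then interpret M: unimodular E "dual_bases E Bs" M .
  have "unimodular E (dual_bases E (dual_bases E Bs)) (dual_coords E M)"
  proof (rule unimodularI[OF M.dual_coordinatization])
    fix C e b assume C: "C \<in> dual_bases E (dual_bases E Bs)" "e \<in> C" "b \<in> E"
    then show "dual_coords E M C e b \<in> {-1, 0, 1}"
      using M.entries[of "E - C" b e] by (auto simp: dual_coords_def M.mem_dual)
  qed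
  then show ?thesis by (auto simp: signable_def N.dual_dual)
qed

lemma signable_loop:
  assumes "coordinatization E Bs n" "B \<in> Bs" "x \<in> E" "\<And>b. b \<in> B \<Longrightarrow> n B b x = 0"
    "signable (E - {x}) (deletion Bs x)"
  shows "signable E Bs"
proof -
  interpret n: coordinatization E Bs n by fact
  have "deletion Bs x = Bs"
    using n.no_neighbours_loop[OF assms(2,3,4)] by (auto simp: deletion_def)
  then obtain M where "unimodular (E - {x}) Bs M" using assms by (auto simp: signable_def)
  then interpret M: unimodular "E - {x}" Bs M .
  have "insert x (E - {x}) = E" using assms by auto
  then have "unimodular E Bs (\<lambda>B b e. if e = x then 0 else M B b e)"
    using M.loop_extension_coords[of x] M.entries by (intro unimodularI) auto
  then show ?thesis by (auto simp: signable_def)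
qed

lemma signable_parallel:
  assumes "coordinatization E Bs n" "x \<in> E" "p \<in> E" "x \<noteq> p"
    "\<And>B b. \<lbrakk>B \<in> Bs; b \<in> B\<rbrakk> \<Longrightarrow> n B b x = n B b p"
    "signable (E - {x}) (deletion Bs x)"
  shows "signable E Bs"
proof -
  interpret n: coordinatization E Bs n by fact
  obtain M where "unimodular (E - {x}) (deletion Bs x) M" using assms by (auto simp: signable_def)
  then interpret M: unimodular "E - {x}" "deletion Bs x" M .
  let ?\<phi> = "\<lambda>e. if e = x then p else e"
  note ext = n.parallel_extension_coords[OF assms(2-4) _ M.coordinatization_axioms]
  have "unimodular E Bs (\<lambda>B b e. M (?\<phi> ` B) (?\<phi> b) (?\<phi> e))"
  proof (rule unimodularI)
    show "coordinatization E Bs (\<lambda>B b e. M (?\<phi> ` B) (?\<phi> b) (?\<phi> e))"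
      by (rule ext(1)) (rule assms(5))
    fix B b e assume B: "B \<in> Bs" "b \<in> B" "e \<in> E"
    have "?\<phi> e \<in> E - {x}" using B assms by auto
    moreover have "?\<phi> ` B \<in> deletion Bs x" by (rule ext(2)) (use assms(5) B(1) in auto)
    ultimately show "M (?\<phi> ` B) (?\<phi> b) (?\<phi> e) \<in> {-1, 0, 1}"
      using B(2) by (intro M.entries) auto
  qed
  then show ?thesis by (auto simp: signable_def)
qed

section \<open>Uniqueness and gluing of signings\<close>

text \<open>The fundamental graph of \<open>B\<close>, bipartite between \<open>B\<close> and its
  complement. It is defined from the bases alone and so is common to bit and real
  coordinates.\<close>

definition fund_adj :: "'a set set \<Rightarrow> 'a set \<Rightarrow> 'a \<Rightarrow> 'a \<Rightarrow> bool" where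
  "fund_adj Bs B u v \<longleftrightarrow>
    (u \<in> B \<and> v \<notin> B \<and> insert v (B - {u}) \<in> Bs) \<or> (v \<in> B \<and> u \<notin> B \<and> insert u (B - {v}) \<in> Bs)"

lemma fund_adj_sym: "fund_adj Bs B u v \<longleftrightarrow> fund_adj Bs B v u"
  by (auto simp: fund_adj_def)

text \<open>A repeated vertex or a forward chord could be cut out of a path of least length.\<close>

lemma shortest_path:
  assumes "(i, j) \<in> R\<^sup>*"
  obtains n p where "p 0 = i" "p n = j" "\<forall>m<n. (p m, p (Suc m)) \<in> R"
    "\<forall>b\<le>n. \<forall>a<b. p a \<noteq> p b \<and> ((p a, p b) \<in> R \<longrightarrow> b = Suc a)"
proof -
  define n where "n = (LEAST n. (i, j) \<in> R ^^ n)"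
  have "\<exists>n. (i, j) \<in> R ^^ n" using assms rtrancl_imp_relpow by blast
  then have "(i, j) \<in> R ^^ n" unfolding n_def by (rule LeastI_ex)
  then obtain p where p: "p 0 = i" "p n = j" "\<And>m. m < n \<Longrightarrow> (p m, p (Suc m)) \<in> R"
    unfolding relpow_fun_conv by blast
  have least: "n \<le> m" if "(i, j) \<in> R ^^ m" for m unfolding n_def using that by (rule Least_le)
  have init: "(i, p a) \<in> R ^^ a" if "a \<le> n" for a
    unfolding relpow_fun_conv using p that by (intro exI[of _ p]) auto
  have final: "(p b, j) \<in> R ^^ (n - b)" if "b \<le> n" for b
    unfolding relpow_fun_conv using p that by (intro exI[of _ "\<lambda>m. p (b + m)"]) auto
  have induced: "p a \<noteq> p b \<and> ((p a, p b) \<in> R \<longrightarrow> b = Suc a)" if ab: "a < b" "b \<le> n" for a b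
  proof (intro conjI impI)
    { assume "(p a, p b) \<in> R"
      then have "(i, j) \<in> R ^^ (Suc a + (n - b))"
        using init[of a] final[of b] ab unfolding relpow_add by auto
      then show "b = Suc a" using least ab by fastforce }
    show "p a \<noteq> p b"
    proof
      assume "p a = p b"
      then have "(i, j) \<in> R ^^ (a + (n - b))"
        using init[of a] final[of b] ab unfolding relpow_add by auto
      then show False using least ab by fastforce
    qed
  qed
  show thesis by (rule that[of p n]) (use p induced in auto)
qed

lemma induced_bipartite_path:
  assumes "(i, j) \<in> {(u, v). u \<in> B \<union> C \<and> v \<in> B \<union> C \<and> fund_adj Bs B u v}\<^sup>*"
    and "i \<in> B" "j \<in> B" "i \<noteq> j" "C \<inter> B = {}"
  obtains k r c where "1 \<le> k" "r 0 = i" "r k = j" "r ` {..k} \<subseteq> B" "inj_on r {..k}" "c ` {1..k} \<subseteq> C"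
    "\<forall>m\<le>k. \<forall>l\<in>{1..k}. insert (c l) (B - {r m}) \<in> Bs \<longleftrightarrow> l = m \<or> l = Suc m"
proof -
  let ?R = "{(u, v). u \<in> B \<union> C \<and> v \<in> B \<union> C \<and> fund_adj Bs B u v}"
  obtain n p where "p 0 = i" "p n = j" "\<forall>m<n. (p m, p (Suc m)) \<in> ?R"
    "\<forall>b\<le>n. \<forall>a<b. p a \<noteq> p b \<and> ((p a, p b) \<in> ?R \<longrightarrow> b = Suc a)"
    by (rule shortest_path[OF assms(1)])
  then have p: "p 0 = i" "p n = j" "\<And>m. m < n \<Longrightarrow> (p m, p (Suc m)) \<in> ?R"
    "\<And>a b. \<lbrakk>a < b; b \<le> n; (p a, p b) \<in> ?R\<rbrakk> \<Longrightarrow> b = Suc a" "\<And>a b. \<lbrakk>a < b; b \<le> n\<rbrakk> \<Longrightarrow> p a \<noteq> p b"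
    by auto
  have alt: "p m \<in> B \<longleftrightarrow> even m" if "m \<le> n" for m
    using that
  proof (induction m)
    case (Suc m)
    then show ?case using p(3)[of m] by (auto simp: fund_adj_def)
  qed (use p assms in auto)
  have V: "p m \<in> B \<union> C" if "m \<le> n" for m
  proof (cases m)
    case (Suc m')
    then show ?thesis using p(3)[of m'] that by auto
  qed (use p assms in auto)
  \<comment> \<open>The path alternates between \<open>B\<close> and its complement and both ends
    lie in \<open>B\<close>, so its length is even.\<close>
  obtain k where k: "n = 2 * k" using alt[of n] p assms by (auto elim: evenE)
  have odd: "odd (2 * l - 1)" "2 * l - 1 \<le> n" if "l \<in> {1..k}" for l
    using that k by auto
  have cB: "p (2 * l - 1) \<notin> B" if "l \<in> {1..k}" for l
    using alt odd[OF that] by blast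
  have c: "p (2 * l - 1) \<in> C" if "l \<in> {1..k}" for l
    using V[OF odd(2)[OF that]] cB[OF that] by auto
  have rB: "p (2 * m) \<in> B" if "m \<le> k" for m using alt[of "2 * m"] that k by auto
  show thesis
  \<comment> \<open>The column \<open>c l\<close> stands between \<open>r (l - 1)\<close> and
    \<open>r l\<close>, which is why columns are numbered from one.\<close>
  proof (rule that[of k "\<lambda>m. p (2 * m)" "\<lambda>l. p (2 * l - 1)"])
    show "1 \<le> k" using p assms k by (cases k) auto
    show "p (2 * 0) = i" "p (2 * k) = j" using p k by auto
    show "(\<lambda>m. p (2 * m)) ` {..k} \<subseteq> B" using rB by auto
    show "(\<lambda>l. p (2 * l - 1)) ` {1..k} \<subseteq> C" using c by blast
    show "inj_on (\<lambda>m. p (2 * m)) {..k}"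
    proof (rule linorder_inj_onI')
      fix a b assume "a \<in> {..k}" "b \<in> {..k}" "a < b"
      then show "p (2 * a) \<noteq> p (2 * b)" using p(5)[of "2 * a" "2 * b"] k by auto
    qed
    show "\<forall>m\<le>k. \<forall>l\<in>{1..k}. insert (p (2 * l - 1)) (B - {p (2 * m)}) \<in> Bs \<longleftrightarrow> l = m \<or> l = Suc m"
    proof (intro allI impI ballI)
    fix m l assume m: "m \<le> k" and l': "l \<in> {1..k}"
    then have l: "1 \<le> l" "l \<le> k" by auto
    have "insert (p (2 * l - 1)) (B - {p (2 * m)}) \<in> Bs \<longleftrightarrow> (p (2 * m), p (2 * l - 1)) \<in> ?R"
      using rB[OF m] cB[OF l'] c[OF l'] by (auto simp: fund_adj_def)
    also have "\<dots> \<longleftrightarrow> l = m \<or> l = Suc m"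
    proof
      assume R: "(p (2 * m), p (2 * l - 1)) \<in> ?R"
      then have R': "(p (2 * l - 1), p (2 * m)) \<in> ?R" by (auto simp: fund_adj_sym)
      have "2 * m \<noteq> 2 * l - 1" using l by presburger
      then consider "2 * m < 2 * l - 1" | "2 * l - 1 < 2 * m" by linarith
      then show "l = m \<or> l = Suc m"
      proof cases
        case 1
        then show ?thesis using p(4)[OF 1 odd(2)[OF l'] R] by linarith
      next
        case 2
        then show ?thesis using p(4)[OF 2 _ R'] m k by linarith
      qed
    next
      assume "l = m \<or> l = Suc m"
      then show "(p (2 * m), p (2 * l - 1)) \<in> ?R"
      proof
        assume "l = m"
        then show ?thesis using p(3)[of "2 * l - 1"] l k by (auto simp: fund_adj_sym)
      next
        assume "l = Suc m"
        then show ?thesis using p(3)[of "2 * m"] l k by auto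
      qed
    qed
    finally show "insert (p (2 * l - 1)) (B - {p (2 * m)}) \<in> Bs \<longleftrightarrow> l = m \<or> l = Suc m" .
    qed
  qed
qed

text \<open>Columns are added one at a time. After scaling to agreement on \<open>C\<close>, the
  ratio of the two signings in the new column \<open>w\<close> is constant on each component of the
  fundamental graph on \<open>B \<union> C\<close>: by \<open>path_sign\<close>, with
  \<open>w\<close> on both sides, a deviation would force two different supports of the same
  column.\<close>

lemma signing_unique:
  assumes 1: "unimodular E Bs N1" and 2: "unimodular E Bs N2" and B: "B \<in> Bs"
  obtains \<sigma> where "\<And>e. \<sigma> e = 1 \<or> \<sigma> e = -1"
    "\<And>b e. \<lbrakk>b \<in> B; e \<in> E\<rbrakk> \<Longrightarrow> N2 B b e = \<sigma> b * \<sigma> e * N1 B b e"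
proof -
  interpret N1: unimodular E Bs N1 by fact
  interpret N2: unimodular E Bs N2 by fact
  have supp: "N1 B b e = 0 \<longleftrightarrow> N2 B b e = 0" if "B \<in> Bs" "b \<in> B" "e \<in> E" for B b e
    using N1.N_exchange[OF that] N2.N_exchange[OF that] by blast
  have "\<exists>\<sigma>. (\<forall>e. \<sigma> e = 1 \<or> \<sigma> e = -1) \<and> (\<forall>b\<in>B. \<forall>e\<in>C. N2 B b e = \<sigma> b * \<sigma> e * N1 B b e)"
    if "finite C" "C \<subseteq> E - B" for C
    using that
  proof (induction C rule: finite_induct)
    case empty
    show ?case by (rule exI[of _ "\<lambda>_. 1"]) simp
  next
    case (insert w C)
    then obtain \<sigma> where s: "\<And>e. \<sigma> e = 1 \<or> \<sigma> e = -1"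
      and \<sigma>: "\<And>b e. \<lbrakk>b \<in> B; e \<in> C\<rbrakk> \<Longrightarrow> N2 B b e = \<sigma> b * \<sigma> e * N1 B b e" by blast
    have w: "w \<in> E" "w \<notin> B" using insert.prems by auto
    define N1' where "N1' = (\<lambda>B b e. \<sigma> b * \<sigma> e * N1 B b e)"
    have N1': "unimodular E Bs N1'" unfolding N1'_def by (rule N1.rescale_unimodular[OF s])
    interpret N1': unimodular E Bs N1' by (rule N1')
    have supp': "N1' B b e = 0 \<longleftrightarrow> N2 B b e = 0" if "B \<in> Bs" "b \<in> B" "e \<in> E" for B b e
      using N1'.N_exchange[OF that] N2.N_exchange[OF that] by blast
    define R where "R = {(u, v). u \<in> B \<union> C \<and> v \<in> B \<union> C \<and> fund_adj Bs B u v}"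
    have symR: "sym R" by (auto simp: R_def sym_def fund_adj_sym)
    have key: "N1' B b w * N2 B b w = N1' B b' w * N2 B b' w"
      if b: "b \<in> B" "b' \<in> B" "N2 B b w \<noteq> 0" "N2 B b' w \<noteq> 0" "(b, b') \<in> R\<^sup>*" for b b'
    proof (cases "b = b'")
      case False
      have "C \<inter> B = {}" using insert.prems by auto
      then obtain k r c where p: "1 \<le> k" "r 0 = b" "r k = b'" "r ` {..k} \<subseteq> B" "inj_on r {..k}" "c ` {1..k} \<subseteq> C"
        "\<forall>m\<le>k. \<forall>l\<in>{1..k}. insert (c l) (B - {r m}) \<in> Bs \<longleftrightarrow> l = m \<or> l = Suc m"
        by (rule induced_bipartite_path[OF b(5)[unfolded R_def] b(1,2) False])
      have rB: "r m \<in> B" if "m \<le> k" for m using p(4) that by auto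
      have "N1' B (r 0) w * N1' B (r k) w = N2 B (r 0) w * N2 B (r k) w"
      proof (rule ccontr)
        assume bad: "N1' B (r 0) w * N1' B (r k) w \<noteq> N2 B (r 0) w * N2 B (r k) w"
        have "sign_conflict E Bs N1' w E Bs N2 w"
        proof (rule path_sign[OF N1' 2 p(1) B B rB p(5) _ _ _ w w _ _ _ _ bad])
          fix l assume l: "1 \<le> l" "l \<le> k"
          then have c: "c l \<in> C" using p(6) by auto
          then show "c l \<in> E \<and> c l \<in> E \<and> c l \<notin> B" using insert.prems by auto
          fix m assume m: "m \<le> k"
          then show "N1' B (r m) (c l) = N2 B (r m) (c l)" using \<sigma>[OF rB[OF m] c] by (simp add: N1'_def)
          show "N1' B (r m) (c l) \<noteq> 0 \<longleftrightarrow> l = m \<or> l = Suc m"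
            using p(7) m l N1'.N_exchange[OF B rB[OF m], of "c l"] c insert.prems by auto
        qed (use supp'[OF B _ w(1)] p b in auto)
        then show False using supp' w unfolding sign_conflict_def by blast
      qed
      then show ?thesis
        using N1'.entry_cases[OF B b(1) w(1)] N1'.entry_cases[OF B b(2) w(1)]
          N2.entry_cases[OF B b(1) w(1)] N2.entry_cases[OF B b(2) w(1)]
          supp'[OF B b(1) w(1)] supp'[OF B b(2) w(1)] b p by auto
    qed simp
    define S where "S v = {b \<in> B. N2 B b w \<noteq> 0 \<and> (v, b) \<in> R\<^sup>*}" for v
    \<comment> \<open>The common ratio on the component of \<open>v\<close>, and one on components
      that \<open>w\<close> does not meet.\<close>
    define t where "t v = (if S v = {} then 1 else N1' B (SOME b. b \<in> S v) w * N2 B (SOME b. b \<in> S v) w)" for v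
    have tR: "t u = t v" if "(u, v) \<in> R" for u v
    proof -
      have "(v, u) \<in> R" using symR that by (auto dest: symD)
      then have "S u = S v" using that by (auto simp: S_def intro: converse_rtrancl_into_rtrancl)
      then show ?thesis by (simp add: t_def)
    qed
    have some: "(SOME b. b \<in> S v) \<in> S v" if "S v \<noteq> {}" for v
      using that by (simp add: some_in_eq)
    have t1: "t v = 1 \<or> t v = -1" for v
    proof (cases "S v = {}")
      case False
      define b where "b = (SOME b. b \<in> S v)"
      have b: "b \<in> B" "N2 B b w \<noteq> 0" using some[OF False] unfolding b_def S_def by auto
      have "t v = N1' B b w * N2 B b w" using False by (simp add: t_def b_def)
      then show ?thesis
        using b N1'.entry_cases[OF B b(1) w(1)] N2.entry_cases[OF B b(1) w(1)] supp'[OF B b(1) w(1)] by auto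
    qed (simp add: t_def)
    have tw: "N2 B b w = t b * N1' B b w" if b: "b \<in> B" for b
    proof (cases "N2 B b w = 0")
      case True
      then show ?thesis using supp'[OF B b w(1)] by simp
    next
      case False
      then have "b \<in> S b" using b by (auto simp: S_def)
      then have S: "S b \<noteq> {}" by auto
      have "t b = N1' B b w * N2 B b w"
        using key[OF b _ False, of "SOME b'. b' \<in> S b"] some[OF S] S by (auto simp: S_def t_def)
      then show ?thesis
        using False supp'[OF B b w(1)] N1'.entry_cases[OF B b w(1)] by auto
    qed
    \<comment> \<open>On an entry in a column of \<open>C\<close> the factor \<open>t\<close> occurs
      twice with the same value, because \<open>t\<close> is constant along edges, and cancels; in
      column \<open>w\<close> it occurs once and corrects the sign.\<close>
    define \<sigma>' where "\<sigma>' v = (if v = w then \<sigma> w else \<sigma> v * t v)" for v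
    have "\<sigma>' e = 1 \<or> \<sigma>' e = -1" for e using s[of e] t1[of e] by (auto simp: \<sigma>'_def)
    moreover have "N2 B b e = \<sigma>' b * \<sigma>' e * N1 B b e" if be: "b \<in> B" "e \<in> insert w C" for b e
    proof (cases "e = w")
      case True
      moreover have "b \<noteq> w" using be w by auto
      ultimately show ?thesis using tw[OF be(1)] by (simp add: \<sigma>'_def N1'_def)
    next
      case False
      then have e: "e \<in> C" "e \<in> E" "e \<notin> B" "b \<noteq> w" using be insert.prems w by auto
      show ?thesis
      proof (cases "N1 B b e = 0")
        case True
        then show ?thesis using \<sigma>[OF be(1) e(1)] by simp
      next
        case nz: False
        then have "(b, e) \<in> R"
          using e be N1.N_exchange[OF B be(1) e(2)] by (auto simp: R_def fund_adj_def)
        then have "t b = t e" by (rule tR)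
        then show ?thesis using \<sigma>[OF be(1) e(1)] False e t1[of e] by (auto simp: \<sigma>'_def)
      qed
    qed
    ultimately show ?case by blast
  qed
  from this[of "E - B"] obtain \<sigma> where s: "\<And>e. \<sigma> e = 1 \<or> \<sigma> e = -1"
    and \<sigma>: "\<And>b e. \<lbrakk>b \<in> B; e \<in> E - B\<rbrakk> \<Longrightarrow> N2 B b e = \<sigma> b * \<sigma> e * N1 B b e"
    using N1.finite_E by blast
  show thesis
  proof (rule that[of \<sigma>, OF s])
    fix b e assume be: "b \<in> B" "e \<in> E"
    show "N2 B b e = \<sigma> b * \<sigma> e * N1 B b e"
    proof (cases "e \<in> B")
      case True
      then show ?thesis using N1.N_base[OF B be(1) True] N2.N_base[OF B be(1) True] s[of b] by auto
    qed (use \<sigma> be in auto)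
  qed
qed

text \<open>The cocycle of \<open>M\<close> says that \<open>M B\<close> is the inverse required by
  \<open>matrix_inverse\<close>. So \<open>w\<close> keeps the coordinates of the part from which
  its columns on \<open>E'\<close> are taken, and by \<open>closure_exchange\<close> no further
  basis arises inside \<open>E'\<close>.\<close>

lemma matrix_bases_restrict:
  assumes "std_matrix E B0 w" "coordinatization E' Bs' M" "E' \<subseteq> E" "B0 \<in> Bs'"
    and w: "\<And>b e. \<lbrakk>b \<in> B0; e \<in> E'\<rbrakk> \<Longrightarrow> w b e = M B0 b e"
  shows "B \<in> Bs' \<Longrightarrow> B \<in> matrix_bases E B0 w"
    and "\<lbrakk>B \<in> Bs'; b \<in> B; e \<in> E'\<rbrakk> \<Longrightarrow> matrix_coords B0 w B b e = M B b e"
    and "\<lbrakk>B \<in> matrix_bases E B0 w; B \<subseteq> E'\<rbrakk> \<Longrightarrow> B \<in> Bs'"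
proof -
  interpret W: std_matrix E B0 w by fact
  interpret M: coordinatization E' Bs' M by fact
  have B0E: "B0 \<subseteq> E'" using M.base_sub assms by blast
  have inv: "matrix_inverse w B0 B (M B)" if B: "B \<in> Bs'" for B
  proof -
    have BE: "B \<subseteq> E'" by (rule M.base_sub[OF B])
    have "(\<Sum>b\<in>B. w c b * M B b d) = (if c = d then 1 else 0)" if "c \<in> B0" "d \<in> B0" for c d
    proof -
      have "(\<Sum>b\<in>B. w c b * M B b d) = (\<Sum>b\<in>B. M B0 c b * M B b d)"
        by (rule sum.cong) (use w that BE in auto)
      then show ?thesis
        using M.N_cocycle[OF assms(4) B that(1), of d] M.N_base[OF assms(4) that] B0E that by auto
    qed
    moreover have "(\<Sum>c\<in>B0. M B a c * w c b) = (if a = b then 1 else 0)" if "a \<in> B" "b \<in> B" for a b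
    proof -
      have "(\<Sum>c\<in>B0. M B a c * w c b) = (\<Sum>c\<in>B0. M B a c * M B0 c b)"
        by (rule sum.cong) (use w that BE in auto)
      then show ?thesis
        using M.N_cocycle[OF B assms(4) that(1), of b] M.N_base[OF B that] BE that by auto
    qed
    ultimately show ?thesis by (simp add: matrix_inverse_def)
  qed
  show mem: "B \<in> matrix_bases E B0 w" if "B \<in> Bs'" for B
    using inv[OF that] M.base_sub[OF that] assms(3) by (auto simp: matrix_bases_def)
  show eq: "matrix_coords B0 w B b e = M B b e" if B: "B \<in> Bs'" "b \<in> B" "e \<in> E'" for B b e
  proof -
    have "matrix_coords B0 w B b e = (\<Sum>c\<in>B0. M B b c * w c e)"
      by (rule matrix_coords_eq[OF M.finite_base[OF B(1)] W.finB0 inv[OF B(1)] B(2)])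
    also have "\<dots> = (\<Sum>c\<in>B0. M B b c * M B0 c e)" by (rule sum.cong) (use w B in auto)
    also have "\<dots> = M B b e" using M.N_cocycle[OF B(1) assms(4) B(2,3)] by simp
    finally show ?thesis .
  qed
  assume B: "B \<in> matrix_bases E B0 w" "B \<subseteq> E'"
  show "B \<in> Bs'"
  proof (rule W.closure_exchange[of Bs' B E'])
    fix C b e assume C: "C \<in> Bs'" "b \<in> C" "e \<in> E'" "insert e (C - {b}) \<in> matrix_bases E B0 w"
    then have "matrix_coords B0 w C b e \<noteq> 0" using W.N_exchange[OF mem[OF C(1)] C(2)] assms(3) by blast
    then have "M C b e \<noteq> 0" using eq[OF C(1-3)] by simp
    then show "insert e (C - {b}) \<in> Bs'" using M.N_exchange[OF C(1-3)] by simp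
  qed (use mem assms B in auto)
qed

text \<open>If all four entries are nonzero, the assumed relation makes the difference cancel, as it
  does over the bits. Together with \<open>pivot_entry_bit\<close> this keeps real and bit supports
  equal under a pivot.\<close>

lemma pivot_entry:
  fixes p q s t :: real
  assumes "p \<in> {-1, 0, 1}" "q \<in> {-1, 0, 1}" "s \<in> {-1, 0, 1}" "t \<in> {-1, 0, 1}" "t \<noteq> 0"
    and "\<lbrakk>p \<noteq> 0; q \<noteq> 0; s \<noteq> 0\<rbrakk> \<Longrightarrow> t * q = s * p"
  shows "p - q * s / t \<in> {-1, 0, 1}" "p - q * s / t \<noteq> 0 \<longleftrightarrow> (p \<noteq> 0) \<noteq> (q \<noteq> 0 \<and> s \<noteq> 0)"
  using assms by auto

lemma pivot_entry_bit:
  fixes p q s t :: bit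
  assumes "t \<noteq> 0" shows "p - q * s / t \<noteq> 0 \<longleftrightarrow> (p \<noteq> 0) \<noteq> (q \<noteq> 0 \<and> s \<noteq> 0)"
  using assms by (cases p; cases q; cases s; cases t) auto

text \<open>A basis containing both \<open>x\<close> and \<open>y\<close> arises from one avoiding both by exchanging two elements
  \<open>i\<close>, \<open>j\<close>. Hence it is governed by a two-by-two minor, which can go wrong only if all its
  entries are nonzero.\<close>

lemma signable_glue:
  fixes n :: "'a set \<Rightarrow> 'a \<Rightarrow> 'a \<Rightarrow> bit"
  assumes n: "coordinatization E Bs n" and B0: "B0 \<in> Bs"
    and xy: "x \<in> E - B0" "y \<in> E - B0" "x \<noteq> y"
    and N1: "unimodular (E - {y}) (deletion Bs y) N1" and N2: "unimodular (E - {x}) (deletion Bs x) N2"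
    and agree: "\<And>b e. \<lbrakk>b \<in> B0; e \<in> E - {x, y}\<rbrakk> \<Longrightarrow> N1 B0 b e = N2 B0 b e"
    and good: "\<And>B i j. \<lbrakk>B \<in> Bs; x \<notin> B; y \<notin> B; i \<in> B; j \<in> B; i \<noteq> j;
      N1 B i x \<noteq> 0; N1 B j x \<noteq> 0; N2 B i y \<noteq> 0; N2 B j y \<noteq> 0\<rbrakk>
      \<Longrightarrow> N1 B i x * N1 B j x = N2 B i y * N2 B j y"
  shows "signable E Bs"
proof -
  interpret n: coordinatization E Bs n by fact
  interpret N1: unimodular "E - {y}" "deletion Bs y" N1 by fact
  interpret N2: unimodular "E - {x}" "deletion Bs x" N2 by fact
  \<comment> \<open>Only column \<open>y\<close> has to come from \<open>N2\<close>. As the signings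
    agree over \<open>B0\<close>, \<open>w\<close> restricts to both of them.\<close>
  define w where "w b e = (if e = y then N2 B0 b y else N1 B0 b e)" for b e
  define Bs' where "Bs' = matrix_bases E B0 w"
  define N where "N = matrix_coords B0 w"
  have B0': "B0 \<in> deletion Bs y" "B0 \<in> deletion Bs x" "B0 \<subseteq> E" "finite B0"
    using B0 xy n.base_sub n.finite_base by (auto simp: deletion_def)
  have std: "std_matrix E B0 w"
  proof
    fix b c assume "b \<in> B0" "c \<in> B0"
    then show "w b c = (if b = c then 1 else 0)"
      using N1.N_base[OF B0'(1), of b c] xy by (auto simp: w_def)
  qed (use n.finite_E B0' in auto)
  interpret S: std_matrix E B0 w by (rule std)
  interpret W: coordinatization E Bs' N
    unfolding Bs'_def N_def by (rule S.coordinatization_axioms)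
  have w1: "w b e = N1 B0 b e" if "b \<in> B0" "e \<in> E - {y}" for b e using that by (simp add: w_def)
  have w2: "w b e = N2 B0 b e" if "b \<in> B0" "e \<in> E - {x}" for b e
    using that agree[of b e] by (auto simp: w_def)
  note r1 = matrix_bases_restrict[OF std N1.coordinatization_axioms _ B0'(1) w1, folded Bs'_def N_def]
  note r2 = matrix_bases_restrict[OF std N2.coordinatization_axioms _ B0'(2) w2, folded Bs'_def N_def]
  have m1: "B \<in> Bs'" "\<And>b e. \<lbrakk>b \<in> B; e \<in> E; e \<noteq> y\<rbrakk> \<Longrightarrow> N B b e = N1 B b e" if "B \<in> Bs" "y \<notin> B" for B
    using r1(1)[of B] r1(2)[of B] that by (auto simp: deletion_def)
  have m2: "B \<in> Bs'" "\<And>b e. \<lbrakk>b \<in> B; e \<in> E; e \<noteq> x\<rbrakk> \<Longrightarrow> N B b e = N2 B b e" if "B \<in> Bs" "x \<notin> B" for B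
    using r2(1)[of B] r2(2)[of B] that by (auto simp: deletion_def)
  have m3: "B \<in> Bs" if "B \<in> Bs'" "x \<notin> B \<or> y \<notin> B" for B
    using r1(3)[of B] r2(3)[of B] that W.base_sub[OF that(1)] by (auto simp: deletion_def)
  have e1: "N B b e \<in> {-1, 0, 1}" if "B \<in> Bs" "y \<notin> B" "b \<in> B" "e \<in> E" "e \<noteq> y" for B b e
    using m1(2)[OF that(1,2)] N1.entries[of B b e] that by (auto simp: deletion_def)
  have e2: "N B b e \<in> {-1, 0, 1}" if "B \<in> Bs" "x \<notin> B" "b \<in> B" "e \<in> E" "e \<noteq> x" for B b e
    using m2(2)[OF that(1,2)] N2.entries[of B b e] that by (auto simp: deletion_def)
  have supp1: "N B b e \<noteq> 0 \<longleftrightarrow> insert e (B - {b}) \<in> Bs" if "B \<in> Bs" "y \<notin> B" "b \<in> B" "e \<in> E" "e \<noteq> y" for B b e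
    using m1(2)[OF that(1,2)] N1.N_exchange[of B b e] that by (auto simp: deletion_def)
  have supp2: "N B b e \<noteq> 0 \<longleftrightarrow> insert e (B - {b}) \<in> Bs" if "B \<in> Bs" "x \<notin> B" "b \<in> B" "e \<in> E" "e \<noteq> x" for B b e
    using m2(2)[OF that(1,2)] N2.N_exchange[of B b e] that by (auto simp: deletion_def)
  have free: "N B b e \<in> {-1, 0, 1} \<and> (N B b e \<noteq> 0 \<longleftrightarrow> n B b e \<noteq> 0)"
    if "B \<in> Bs" "x \<notin> B" "y \<notin> B" "b \<in> B" "e \<in> E" for B b e
  proof (cases "e = y")
    case True
    then show ?thesis using e2[of B b e] supp2[of B b e] n.N_exchange[of B b e] that xy by auto
  next
    case False
    then show ?thesis using e1[of B b e] supp1[of B b e] n.N_exchange[of B b e] that by auto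
  qed
  have good': "N B i x * N B j x = N B i y * N B j y"
    if "B \<in> Bs" "x \<notin> B" "y \<notin> B" "i \<in> B" "j \<in> B" "i \<noteq> j"
      "N B i x \<noteq> 0" "N B j x \<noteq> 0" "N B i y \<noteq> 0" "N B j y \<noteq> 0" for B i j
    using good[OF that(1-6)] m1(2)[OF that(1,3)] m2(2)[OF that(1,2)] that xy by auto
  \<comment> \<open>A basis with \<open>u\<close> but not \<open>v\<close> survives in only one of
    the two deletions, and that one lacks the column \<open>v\<close>. Its entries are reached by
    one pivot from a basis \<open>C\<close> avoiding both elements, where \<open>good\<close> makes
    the full blocks cancel.\<close>
  have half: "N B b v \<in> {-1, 0, 1} \<and> (N B b v \<noteq> 0 \<longleftrightarrow> n B b v \<noteq> 0)"
    if uv: "(u, v) = (x, y) \<or> (u, v) = (y, x)" and B: "B \<in> Bs" "u \<in> B" "v \<notin> B" "b \<in> B" for u v B b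
  proof -
    have u: "u \<in> E" "v \<in> E" "u \<notin> B0" "v \<notin> B0" "u \<noteq> v" using uv xy by auto
    obtain i where i: "i \<in> B0" "i \<notin> B" "insert i (B - {u}) \<in> Bs"
      by (rule n.symmetric_exchange[OF B(1) B0 B(2) u(3)])
    define C where "C = insert i (B - {u})"
    have C: "C \<in> Bs" "u \<notin> C" "v \<notin> C" "i \<in> C" "i \<in> E"
      using i u B B0'(3) by (auto simp: C_def)
    then have Cxy: "x \<notin> C" "y \<notin> C" using uv by auto
    have "insert u (C - {i}) = B" using i B by (auto simp: C_def)
    then have BC: "insert u (C - {i}) = B" "insert u (C - {i}) \<in> Bs" using B by auto
    have BC': "insert u (C - {i}) \<in> Bs'" using BC m1(1)[of B] m2(1)[of B] B uv by auto
    have CBs': "C \<in> Bs'" using m1(1)[OF C(1) Cxy(2)] .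
    have f: "N C a e \<in> {-1, 0, 1} \<and> (N C a e \<noteq> 0 \<longleftrightarrow> n C a e \<noteq> 0)" if "a \<in> C" "e \<in> E" for a e
      using free[OF C(1) Cxy that] .
    have nz: "n C i u \<noteq> 0" using n.N_exchange[OF C(1,4) u(1)] BC(2) by blast
    then have Nz: "N C i u \<noteq> 0" using f[OF C(4) u(1)] by blast
    show ?thesis
    proof (cases "b = u")
      case True
      have "N B u v = N C i v / N C i u"
        using W.pivot_row[OF CBs' C(4) u(1) C(2) BC' u(2)] BC(1) by simp
      moreover have "n B u v = n C i v / n C i u"
        using n.pivot_row[OF C(1,4) u(1) C(2) BC(2) u(2)] BC(1) by simp
      ultimately show ?thesis using f[OF C(4) u(1)] f[OF C(4) u(2)] nz Nz True by auto
    next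
      case False
      then have b: "b \<in> C" "b \<noteq> i" using B i by (auto simp: C_def)
      have 1: "N B b v = N C b v - N C b u * N C i v / N C i u"
        using W.pivot[OF CBs' C(4) u(1) C(2) BC' u(2) b] BC(1) by simp
      have 2: "n B b v = n C b v - n C b u * n C i v / n C i u"
        using n.pivot[OF C(1,4) u(1) C(2) BC(2) u(2) b] BC(1) by simp
      have rel: "N C i u * N C b u = N C i v * N C b v"
        if "N C b v \<noteq> 0" "N C b u \<noteq> 0" "N C i v \<noteq> 0"
        using good'[OF C(1) Cxy C(4) b(1)] that Nz uv b by auto
      have 3: "N B b v \<in> {-1, 0, 1}"
        unfolding 1 by (rule pivot_entry(1)) (use f b C u Nz rel in auto)
      have 4: "N B b v \<noteq> 0 \<longleftrightarrow> (N C b v \<noteq> 0) \<noteq> (N C b u \<noteq> 0 \<and> N C i v \<noteq> 0)"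
        unfolding 1 by (rule pivot_entry(2)) (use f b C u Nz rel in auto)
      have 5: "n B b v \<noteq> 0 \<longleftrightarrow> (n C b v \<noteq> 0) \<noteq> (n C b u \<noteq> 0 \<and> n C i v \<noteq> 0)"
        unfolding 2 by (rule pivot_entry_bit[OF nz])
      show ?thesis using 3 4 5 f[OF b(1) u(2)] f[OF b(1) u(1)] f[OF C(4) u(2)] by simp
    qed
  qed
  have half': "N B b e \<in> {-1, 0, 1}" if B: "B \<in> Bs" "x \<notin> B \<or> y \<notin> B" "b \<in> B" "e \<in> E" for B b e
  proof -
    consider "x \<notin> B" "y \<notin> B" | "x \<in> B" "y \<notin> B" "e = y" | "x \<in> B" "y \<notin> B" "e \<noteq> y"
      | "x \<notin> B" "y \<in> B" "e = x" | "x \<notin> B" "y \<in> B" "e \<noteq> x" using B by blast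
    then show ?thesis
    proof cases
      case 1 then show ?thesis using free B by blast
    next
      case 2 then show ?thesis using half[of x y B b] B by blast
    next
      case 3 then show ?thesis using e1 B by blast
    next
      case 4 then show ?thesis using half[of y x B b] B by blast
    next
      case 5 then show ?thesis using e2 B by blast
    qed
  qed
  \<comment> \<open>A set containing both \<open>x\<close> and \<open>y\<close> is recognized by an
    entry in column \<open>y\<close> over a basis with \<open>x\<close> only, where
    \<open>half\<close> has matched the real and the bit support.\<close>
  have "Bs' = Bs"
  proof (intro Set.set_eqI iffI)
    fix B assume B: "B \<in> Bs'"
    show "B \<in> Bs"
    proof (cases "x \<in> B \<and> y \<in> B")
      case True
      have B0W: "B0 \<in> Bs'" using m1(1)[OF B0] xy by simp
      obtain i where i: "i \<in> B0" "i \<notin> B" "insert i (B - {y}) \<in> Bs'"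
        by (rule W.symmetric_exchange[OF B B0W, of y]) (use True xy in auto)
      define C where "C = insert i (B - {y})"
      have C: "C \<in> Bs'" "y \<notin> C" "x \<in> C" "i \<in> C" "insert y (C - {i}) = B"
        using i xy True by (auto simp: C_def)
      have CB: "C \<in> Bs" using m3[OF C(1)] C by simp
      have "N C i y \<noteq> 0" using W.N_exchange[OF C(1,4), of y] C(5) B xy by auto
      then have "n C i y \<noteq> 0" using half[of x y C i] CB C by blast
      then show ?thesis using n.N_exchange[OF CB C(4), of y] C(5) xy by auto
    qed (use m3 B in blast)
  next
    fix B assume B: "B \<in> Bs"
    show "B \<in> Bs'"
    proof (cases "x \<in> B \<and> y \<in> B")
      case True
      obtain i where i: "i \<in> B0" "i \<notin> B" "insert i (B - {y}) \<in> Bs"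
        by (rule n.symmetric_exchange[OF B B0, of y]) (use True xy in auto)
      define C where "C = insert i (B - {y})"
      have C: "C \<in> Bs" "y \<notin> C" "x \<in> C" "i \<in> C" "insert y (C - {i}) = B"
        using i xy True by (auto simp: C_def)
      have CB: "C \<in> Bs'" using m1[OF C(1,2)] by simp
      have "n C i y \<noteq> 0" using n.N_exchange[OF C(1,4), of y] C(5) B xy by auto
      then have "N C i y \<noteq> 0" using half[of x y C i] C by blast
      then show ?thesis using W.N_exchange[OF CB C(4), of y] C(5) xy by auto
    qed (use m1 m2 B in blast)
  qed
  then interpret W: coordinatization E Bs N using W.coordinatization_axioms by simp
  have "N B b e \<in> {-1, 0, 1}" if B: "B \<in> Bs" "b \<in> B" "e \<in> E" for B b e
  proof (cases "(x \<notin> B \<or> y \<notin> B) \<or> e \<in> B \<or> N B b e = 0")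
    case True
    then show ?thesis using half' B W.N_base[OF B(1,2)] by (cases "e \<in> B") auto
  next
    case False
    then have xyB: "x \<in> B" "y \<in> B" "e \<notin> B" and nz: "N B b e \<noteq> 0" by auto
    have B': "insert e (B - {b}) \<in> Bs" using W.N_exchange[OF B] nz by blast
    show ?thesis
    proof (cases "b = x \<or> b = y")
      case True
      \<comment> \<open>The reverse exchange starts from a basis that lacks \<open>b\<close>, where
        \<open>half'\<close> bounds the reciprocal entry.\<close>
      have "N (insert e (B - {b})) e b = N B b b / N B b e"
        by (rule W.pivot_row) (use B B' xyB W.base_sub in auto)
      also have "\<dots> = 1 / N B b e" using W.N_base[OF B(1,2,2)] by simp
      finally have "1 / N B b e \<in> {-1, 0, 1}"
        using half'[OF B', of e b] True xyB B W.base_sub[OF B(1)] by auto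
      then show ?thesis using nz by (auto simp: field_simps)
    next
      case bxy: False
      obtain i where i: "i \<in> B0" "i \<notin> B" "insert i (B - {y}) \<in> Bs"
        by (rule n.symmetric_exchange[OF B(1) B0, of y]) (use xyB xy in auto)
      define C where "C = insert i (B - {y})"
      have C: "C \<in> Bs" "y \<notin> C" "x \<in> C" "i \<in> C" "insert y (C - {i}) = B" "b \<in> C" "b \<noteq> i"
        using i xy xyB B bxy by (auto simp: C_def)
      have yE: "y \<in> E" using xy by simp
      have f: "N C a g \<in> {-1, 0, 1}" if "a \<in> C" "g \<in> E" for a g
        using half'[OF C(1)] C that by blast
      have iy: "N C i y \<noteq> 0" using W.N_exchange[OF C(1,4) yE] C(5) B by simp
      have N: "N B b e = N C b e - N C b y * N C i e / N C i y"
        using W.pivot[OF C(1,4) yE C(2) _ B(3) C(6,7)] C(5) B by simp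
      show ?thesis
      proof (rule ccontr)
        assume bad: "N B b e \<notin> {-1, 0, 1}"
        have nzs: "N C b e \<noteq> 0" "N C b y \<noteq> 0" "N C i e \<noteq> 0" and rel: "N C b e = - (N C b y * N C i e * N C i y)"
          using bad f[OF C(6) B(3)] f[OF C(6) yE] f[OF C(4) B(3)] f[OF C(4) yE] iy unfolding N by auto
        have eC: "e \<notin> C"
        proof
          assume "e \<in> C"
          then show False using W.N_base[OF C(1,4)] W.N_base[OF C(1,6)] nzs C by (auto split: if_splits)
        qed
        \<comment> \<open>Pivoting the same block on \<open>e\<close> instead of \<open>y\<close>
          leads to a basis avoiding \<open>y\<close>, where \<open>half'\<close> holds; a
          nonsingular block would give an entry of absolute value two there too.\<close>
        define D where "D = insert e (C - {i})"
        have D: "D \<in> Bs" using W.N_exchange[OF C(1,4) B(3)] nzs by (simp add: D_def)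
        have "e \<noteq> y" using xyB by auto
        then have yD: "y \<notin> D" using C by (auto simp: D_def)
        have "N D b y = N C b y - N C b e * N C i y / N C i e"
          unfolding D_def by (rule W.pivot) (use C B eC D yE in \<open>auto simp: D_def\<close>)
        moreover have "N D b y \<in> {-1, 0, 1}"
          using half'[OF D, of b y] yD C eC yE by (auto simp: D_def)
        ultimately show False
          using rel nzs iy f[OF C(6) yE] f[OF C(4) B(3)] f[OF C(4) yE] by auto
      qed
    qed
  qed
  then have "unimodular E Bs N" by (intro unimodularI W.coordinatization_axioms)
  then show ?thesis by (auto simp: signable_def)
qed

section \<open>Minors of strongly Rayleigh matroids and the Fano matroid\<close>

lemma (in coordinatization) finite_Bs: "finite Bs"
  using finite_subset[of Bs "Pow E"] base_sub finite_E by auto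

lemma basis_poly_deletion:
  assumes "finite Bs" "\<And>B. B \<in> Bs \<Longrightarrow> finite B" "x \<notin> I"
  shows "basis_poly (deletion Bs x) I J y = basis_poly Bs I J (y(x := 0))"
proof -
  have "basis_poly (deletion Bs x) I J y =
      (\<Sum>B \<in> {B \<in> deletion Bs x. I \<subseteq> B \<and> B \<inter> J = {}}. \<Prod>c \<in> B - I. (y(x := 0)) c)"
    unfolding basis_poly_def
    by (intro sum.cong prod.cong) (auto simp: deletion_def)
  also have "\<dots> = basis_poly Bs I J (y(x := 0))"
    unfolding basis_poly_def
  proof (rule sum.mono_neutral_left)
    show "\<forall>B \<in> {B \<in> Bs. I \<subseteq> B \<and> B \<inter> J = {}} - {B \<in> deletion Bs x. I \<subseteq> B \<and> B \<inter> J = {}}.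
        (\<Prod>c \<in> B - I. (y(x := 0)) c) = 0"
    proof
      fix B assume "B \<in> {B \<in> Bs. I \<subseteq> B \<and> B \<inter> J = {}} - {B \<in> deletion Bs x. I \<subseteq> B \<and> B \<inter> J = {}}"
      then have "x \<in> B - I" "finite (B - I)" using assms by (auto simp: deletion_def)
      then show "(\<Prod>c \<in> B - I. (y(x := 0)) c) = 0" by (intro prod_zero) auto
    qed
  qed (use assms in \<open>auto simp: deletion_def\<close>)
  finally show ?thesis .
qed

text \<open>Zero is an admissible value of the variable of \<open>x\<close>, and it erases exactly
  the monomials of bases through \<open>x\<close>.\<close>

lemma strongly_rayleigh_deletion:
  assumes "coordinatization E Bs N" "strongly_rayleigh E Bs"
  shows "strongly_rayleigh (E - {x}) (deletion Bs x)"
proof -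
  interpret N: coordinatization E Bs N by fact
  have "rayleigh_difference (deletion Bs x) e f y = rayleigh_difference Bs e f (y(x := 0))"
    if "e \<noteq> x" "f \<noteq> x" for e f y
    unfolding rayleigh_difference_def
    using that by (simp add: basis_poly_deletion N.finite_Bs N.finite_base)
  then show ?thesis using assms(2) by (auto simp: strongly_rayleigh_def)
qed

text \<open>The monomial of a complement is the product of all variables divided by the monomial of
  the basis, hence the inverted variables.\<close>

lemma (in coordinatization) basis_poly_dual:
  assumes "I \<subseteq> E" "J \<subseteq> E" "I \<inter> J = {}" "\<And>c. c \<in> E \<Longrightarrow> y c \<noteq> 0"
  shows "basis_poly (dual_bases E Bs) I J y =
    (\<Prod>c \<in> E - I - J. y c) * basis_poly Bs J I (\<lambda>c. inverse (y c))"
proof -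
  have eq: "{C \<in> dual_bases E Bs. I \<subseteq> C \<and> C \<inter> J = {}} = (\<lambda>B. E - B) ` {B \<in> Bs. J \<subseteq> B \<and> B \<inter> I = {}}"
  proof (intro Set.set_eqI iffI)
    fix C assume "C \<in> {C \<in> dual_bases E Bs. I \<subseteq> C \<and> C \<inter> J = {}}"
    then obtain B where B: "B \<in> Bs" "C = E - B" "I \<subseteq> C" "C \<inter> J = {}" by (auto simp: dual_bases_def)
    then have "J \<subseteq> B" "B \<inter> I = {}" using assms(2) by auto
    with B show "C \<in> (\<lambda>B. E - B) ` {B \<in> Bs. J \<subseteq> B \<and> B \<inter> I = {}}" by simp
  next
    fix C assume "C \<in> (\<lambda>B. E - B) ` {B \<in> Bs. J \<subseteq> B \<and> B \<inter> I = {}}"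
    then obtain B where B: "B \<in> Bs" "C = E - B" "J \<subseteq> B" "B \<inter> I = {}" by auto
    then have "I \<subseteq> C" "C \<inter> J = {}" using assms(1) by auto
    with B show "C \<in> {C \<in> dual_bases E Bs. I \<subseteq> C \<and> C \<inter> J = {}}" by (simp add: dual_bases_def)
  qed
  have inj: "inj_on (\<lambda>B. E - B) {B \<in> Bs. J \<subseteq> B \<and> B \<inter> I = {}}"
  proof (rule inj_onI)
    fix A B assume A: "A \<in> {B \<in> Bs. J \<subseteq> B \<and> B \<inter> I = {}}"
      and B: "B \<in> {B \<in> Bs. J \<subseteq> B \<and> B \<inter> I = {}}" and eq: "E - A = E - B"
    have "A \<subseteq> E" "B \<subseteq> E" using A B base_sub by auto
    then have "A = E - (E - A)" "B = E - (E - B)" by auto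
    then show "A = B" using eq by argo
  qed
  have "basis_poly (dual_bases E Bs) I J y =
      (\<Sum>B \<in> {B \<in> Bs. J \<subseteq> B \<and> B \<inter> I = {}}. \<Prod>c \<in> E - B - I. y c)"
    unfolding basis_poly_def eq using inj by (simp add: sum.reindex o_def)
  also have "\<dots> = (\<Sum>B \<in> {B \<in> Bs. J \<subseteq> B \<and> B \<inter> I = {}}.
      (\<Prod>c \<in> E - I - J. y c) * (\<Prod>c \<in> B - J. inverse (y c)))"
  proof (rule sum.cong)
    fix B assume "B \<in> {B \<in> Bs. J \<subseteq> B \<and> B \<inter> I = {}}"
    then have B: "B \<subseteq> E" "J \<subseteq> B" "B \<inter> I = {}" using base_sub by auto
    have "E - I - J = (E - B - I) \<union> (B - J)" "(E - B - I) \<inter> (B - J) = {}" using B by auto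
    then have "(\<Prod>c \<in> E - I - J. y c) = (\<Prod>c \<in> E - B - I. y c) * (\<Prod>c \<in> B - J. y c)"
      using finite_E B by (simp add: prod.union_disjoint finite_subset)
    moreover have "(\<Prod>c \<in> B - J. y c) * (\<Prod>c \<in> B - J. inverse (y c)) = 1"
      using B assms(4) by (subst prod.distrib[symmetric], intro prod.neutral) auto
    ultimately show "(\<Prod>c \<in> E - B - I. y c) =
        (\<Prod>c \<in> E - I - J. y c) * (\<Prod>c \<in> B - J. inverse (y c))" by (simp add: mult.assoc)
  qed simp
  finally show ?thesis by (simp add: basis_poly_def sum_distrib_left)
qed

text \<open>Away from zeros of \<open>y\<close>, the dual difference is the primal one at the
  inverted variables times a square. Points with zero coordinates are limits of such points,
  approached by shifting all variables by a small positive \<open>t\<close>.\<close>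

lemma strongly_rayleigh_dual:
  assumes "coordinatization E Bs N" "strongly_rayleigh E Bs"
  shows "strongly_rayleigh E (dual_bases E Bs)"
  unfolding strongly_rayleigh_def
proof (intro ballI impI allI)
  interpret N: coordinatization E Bs N by fact
  fix e f y assume ef: "e \<in> E" "f \<in> E" "e \<noteq> f"
  let ?D = "\<lambda>y. rayleigh_difference (dual_bases E Bs) e f y"
  have nonzero: "0 \<le> ?D z" if z: "\<And>c. c \<in> E \<Longrightarrow> z c \<noteq> 0" for z
  proof -
    let ?P = "\<Prod>c \<in> E - {e, f}. z c" and ?z = "\<lambda>c. inverse (z c)"
    have sets: "E - {e} - {f} = E - {e, f}" "E - {f} - {e} = E - {e, f}" by auto
    have "?D z = ?P * ?P * rayleigh_difference Bs e f ?z"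
      using ef z N.basis_poly_dual[of "{e}" "{f}" z] N.basis_poly_dual[of "{f}" "{e}" z]
        N.basis_poly_dual[of "{e, f}" "{}" z] N.basis_poly_dual[of "{}" "{e, f}" z]
      by (simp add: rayleigh_difference_def sets algebra_simps)
    moreover have "0 \<le> rayleigh_difference Bs e f ?z"
      using assms(2) ef by (simp add: strongly_rayleigh_def)
    ultimately show ?thesis by simp
  qed
  have "((\<lambda>t. ?D (\<lambda>c. y c + t)) \<longlongrightarrow> ?D (\<lambda>c. y c + 0)) (at_right 0)"
    unfolding rayleigh_difference_def basis_poly_def by (intro tendsto_intros)
  moreover have "eventually (\<lambda>t. \<forall>c\<in>E. y c + t \<noteq> 0) (at_right 0)"
  proof (rule eventually_ball_finite[OF N.finite_E], rule ballI)
    fix c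
    \<comment> \<open>For positive \<open>t\<close> the sum can vanish only at
      \<open>t = - y c\<close>, and only if \<open>y c\<close> is negative.\<close>
    show "eventually (\<lambda>t. y c + t \<noteq> 0) (at_right 0)"
      unfolding eventually_at_right_field
      by (rule exI[of _ "if y c < 0 then - y c else 1"]) auto
  qed
  then have "eventually (\<lambda>t. 0 \<le> ?D (\<lambda>c. y c + t)) (at_right 0)"
    by (rule eventually_mono) (use nonzero in auto)
  ultimately have "0 \<le> ?D (\<lambda>c. y c + 0)" by (rule tendsto_lowerbound) simp
  then show "0 \<le> ?D y" by simp
qed

text \<open>Defined through the dual, so that coordinates and the strong Rayleigh property are
  inherited from deletion without a separate limit in the variable of \<open>x\<close>.\<close>

definition contraction :: "'a set \<Rightarrow> 'a set set \<Rightarrow> 'a \<Rightarrow> 'a set set" where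
  "contraction E Bs x = dual_bases (E - {x}) (deletion (dual_bases E Bs) x)"

context coordinatization begin

lemma mem_contraction:
  assumes "x \<in> E" shows "C \<in> contraction E Bs x \<longleftrightarrow> x \<notin> C \<and> insert x C \<in> Bs"
proof
  assume "C \<in> contraction E Bs x"
  then obtain B where B: "B \<in> Bs" "x \<notin> E - B" "C = E - {x} - (E - B)"
    by (auto simp: contraction_def deletion_def dual_bases_def)
  then have "insert x C = B" using base_sub[OF B(1)] assms by auto
  then show "x \<notin> C \<and> insert x C \<in> Bs" using B by auto
next
  assume C: "x \<notin> C \<and> insert x C \<in> Bs"
  then have "C = E - {x} - (E - insert x C)" using base_sub by auto
  moreover have "E - insert x C \<in> deletion (dual_bases E Bs) x"
    using C by (auto simp: deletion_def dual_bases_def)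
  ultimately show "C \<in> contraction E Bs x" unfolding contraction_def dual_bases_def[of "E - {x}"] by blast
qed

lemma contraction_minor:
  assumes x: "x \<in> E" "B \<in> Bs" "x \<in> B" and SR: "strongly_rayleigh E Bs"
  shows "\<exists>M :: 'a set \<Rightarrow> 'a \<Rightarrow> 'a \<Rightarrow> 'k. coordinatization (E - {x}) (contraction E Bs x) M"
    and "strongly_rayleigh (E - {x}) (contraction E Bs x)"
proof -
  interpret D: coordinatization E "dual_bases E Bs" "dual_coords E N" by (rule dual_coordinatization)
  have "E - B \<in> dual_bases E Bs" using x by (auto simp: dual_bases_def)
  then interpret D': coordinatization "E - {x}" "deletion (dual_bases E Bs) x" "dual_coords E N"
    by (rule D.deletion_coords) (use x in auto)
  show "\<exists>M :: 'a set \<Rightarrow> 'a \<Rightarrow> 'a \<Rightarrow> 'k. coordinatization (E - {x}) (contraction E Bs x) M"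
    unfolding contraction_def using D'.dual_coordinatization by blast
  show "strongly_rayleigh (E - {x}) (contraction E Bs x)"
    unfolding contraction_def
    by (rule strongly_rayleigh_dual[OF D'.coordinatization_axioms])
      (rule strongly_rayleigh_deletion[OF D.coordinatization_axioms],
        rule strongly_rayleigh_dual[OF coordinatization_axioms SR])
qed

end

section \<open>The Fano matroid\<close>

definition det3 :: "('i \<Rightarrow> 'j \<Rightarrow> 'k::comm_ring_1) \<Rightarrow> 'i \<Rightarrow> 'i \<Rightarrow> 'i \<Rightarrow> 'j \<Rightarrow> 'j \<Rightarrow> 'j \<Rightarrow> 'k" where
  "det3 A a b c p q s =
     A a p * (A b q * A c s - A b s * A c q)
   - A a q * (A b p * A c s - A b s * A c p)
   + A a s * (A b p * A c q - A b q * A c p)"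

lemma det3_mult:
  "det3 (\<lambda>i j. A i p * T p j + A i q * T q j + A i s * T s j) a b c d e f
    = det3 A a b c p q s * det3 T p q s d e f"
  unfolding det3_def by (simp add: algebra_simps)

text \<open>With three rows the change of basis can be inverted explicitly. One direction is
  multiplicativity of \<open>det3\<close>; the other writes down the inverse and reads membership
  off \<open>matrix_bases_restrict\<close>.\<close>

lemma (in coordinatization) three_set_mem:
  assumes B: "{a, b, c} \<in> Bs" "a \<noteq> b" "a \<noteq> c" "b \<noteq> c"
    and Z: "p \<in> E" "q \<in> E" "s \<in> E" "p \<noteq> q" "p \<noteq> s" "q \<noteq> s"
  shows "{p, q, s} \<in> Bs \<longleftrightarrow> det3 (N {a, b, c}) a b c p q s \<noteq> 0"
proof
  assume Z': "{p, q, s} \<in> Bs"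
  let ?A = "N {a, b, c}" and ?T = "N {p, q, s}"
  have AT: "?A i p * ?T p j + ?A i q * ?T q j + ?A i s * ?T s j = (if j = i then 1 else 0)"
    if "i \<in> {a, b, c}" "j \<in> {a, b, c}" for i j
  proof -
    have "j \<in> E" using base_sub[OF B(1)] that by blast
    then show ?thesis
      using N_cocycle[OF B(1) Z' that(1), of j] N_base[OF B(1) that] Z by (simp add: add.assoc)
  qed
  have "det3 (\<lambda>i j. ?A i p * ?T p j + ?A i q * ?T q j + ?A i s * ?T s j) a b c a b c = 1"
    unfolding det3_def using AT[of a a] AT[of a b] AT[of a c] AT[of b a] AT[of b b] AT[of b c]
      AT[of c a] AT[of c b] AT[of c c] B by simp
  then show "det3 ?A a b c p q s \<noteq> 0" unfolding det3_mult by auto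
next
  let ?A = "N {a, b, c}" and ?Z = "{p, q, s}"
  define D where "D = det3 ?A a b c p q s"
  assume D: "det3 ?A a b c p q s \<noteq> 0"
  then have D0: "D \<noteq> 0" by (simp add: D_def)
  note [simp] = B(2-4) B(2-4)[symmetric] Z(4-6) Z(4-6)[symmetric]
  \<comment> \<open>Cramer's rule: the adjugate divided by the determinant.\<close>
  define T where "T i j =
     (if i = p then if j = a then ?A b q * ?A c s - ?A b s * ?A c q
        else if j = b then ?A a s * ?A c q - ?A a q * ?A c s else ?A a q * ?A b s - ?A a s * ?A b q
      else if i = q then if j = a then ?A b s * ?A c p - ?A b p * ?A c s
        else if j = b then ?A a p * ?A c s - ?A a s * ?A c p else ?A a s * ?A b p - ?A a p * ?A b s
      else if j = a then ?A b p * ?A c q - ?A b q * ?A c p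
        else if j = b then ?A a q * ?A c p - ?A a p * ?A c q else ?A a p * ?A b q - ?A a q * ?A b p) / D" for i j
  have T: "T p a * D = ?A b q * ?A c s - ?A b s * ?A c q" "T p b * D = ?A a s * ?A c q - ?A a q * ?A c s"
    "T p c * D = ?A a q * ?A b s - ?A a s * ?A b q"
    "T q a * D = ?A b s * ?A c p - ?A b p * ?A c s" "T q b * D = ?A a p * ?A c s - ?A a s * ?A c p"
    "T q c * D = ?A a s * ?A b p - ?A a p * ?A b s"
    "T s a * D = ?A b p * ?A c q - ?A b q * ?A c p" "T s b * D = ?A a q * ?A c p - ?A a p * ?A c q"
    "T s c * D = ?A a p * ?A b q - ?A a q * ?A b p"
    using D0 by (simp_all add: T_def)
  \<comment> \<open>Clearing the denominator leaves polynomial identities for the nine entries of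
    each of the two products.\<close>
  have cancel: "X = Y" if "X * D = Y * D" for X Y using that D0 by simp
  have right: "?A a p * T p a + ?A a q * T q a + ?A a s * T s a = 1"
    "?A a p * T p b + ?A a q * T q b + ?A a s * T s b = 0"
    "?A a p * T p c + ?A a q * T q c + ?A a s * T s c = 0"
    "?A b p * T p a + ?A b q * T q a + ?A b s * T s a = 0"
    "?A b p * T p b + ?A b q * T q b + ?A b s * T s b = 1"
    "?A b p * T p c + ?A b q * T q c + ?A b s * T s c = 0"
    "?A c p * T p a + ?A c q * T q a + ?A c s * T s a = 0"
    "?A c p * T p b + ?A c q * T q b + ?A c s * T s b = 0"
    "?A c p * T p c + ?A c q * T q c + ?A c s * T s c = 1"
    by (rule cancel, simp add: distrib_right mult.assoc T, simp add: D_def det3_def algebra_simps)+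
  have left: "?A a p * T p a + ?A b p * T p b + ?A c p * T p c = 1"
    "?A a q * T p a + ?A b q * T p b + ?A c q * T p c = 0"
    "?A a s * T p a + ?A b s * T p b + ?A c s * T p c = 0"
    "?A a p * T q a + ?A b p * T q b + ?A c p * T q c = 0"
    "?A a q * T q a + ?A b q * T q b + ?A c q * T q c = 1"
    "?A a s * T q a + ?A b s * T q b + ?A c s * T q c = 0"
    "?A a p * T s a + ?A b p * T s b + ?A c p * T s c = 0"
    "?A a q * T s a + ?A b q * T s b + ?A c q * T s c = 0"
    "?A a s * T s a + ?A b s * T s b + ?A c s * T s c = 1"
    by (rule cancel, simp add: distrib_right mult.assoc T, simp add: D_def det3_def algebra_simps)+
  have "matrix_inverse ?A {a, b, c} ?Z T"
    unfolding matrix_inverse_def using right left by (simp add: add.assoc mult.commute[of "T _ _"])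
  then have mem: "?Z \<in> matrix_bases E {a, b, c} ?A" using Z by (auto simp: matrix_bases_def)
  have std: "std_matrix E {a, b, c} ?A"
    by unfold_locales (use finite_E base_sub[OF B(1)] N_base[OF B(1)] in auto)
  show "?Z \<in> Bs"
    by (rule matrix_bases_restrict(3)[OF std coordinatization_axioms _ B(1) _ mem]) (use Z in auto)
qed

text \<open>The 28 triples of points that are not one of the seven lines, as increasing lists so
  that the basis polynomials evaluate by rewriting.\<close>

definition fano_bases :: "nat list list" where
  "fano_bases = [[0,1,2], [0,1,4], [0,1,5], [0,1,6], [0,2,3], [0,2,4], [0,2,6], [0,3,4], [0,3,5],
    [0,3,6], [0,4,5], [0,5,6], [1,2,3], [1,2,5], [1,2,6], [1,3,4], [1,3,5], [1,3,6],
    [1,4,5], [1,4,6], [2,3,4], [2,3,5], [2,4,5], [2,4,6], [2,5,6], [3,4,6], [3,5,6],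
    [4,5,6]]"

text \<open>The column order is that of \<open>[r0, r1, r2, c1, c2, x, y]\<close> in
  \<open>no_fano_minor\<close>: unit vectors, the two columns of the path, the column missing
  \<open>r1\<close>, the full column.\<close>

definition fano_matrix :: "nat \<Rightarrow> nat \<Rightarrow> bit" where
  "fano_matrix i j = [[1, 0, 0, 1, 0, 1, 1], [0, 1, 0, 1, 1, 0, 1], [0, 0, 1, 0, 1, 1, 1]] ! i ! j"

lemma fano_bases_det:
  "\<forall>l \<in> set (filter (\<lambda>l. length l = 3) (subseqs [0..<7])).
     l \<in> set fano_bases \<longleftrightarrow> det3 fano_matrix 0 1 2 (l ! 0) (l ! 1) (l ! 2) \<noteq> 0"
  by (simp add: fano_bases_def fano_matrix_def det3_def upt_rec Let_def numeral_nat)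

lemma fano_bases_subseqs: "set fano_bases \<subseteq> set (filter (\<lambda>l. length l = 3) (subseqs [0..<7]))"
  by (simp add: fano_bases_def upt_rec Let_def numeral_nat)

lemma fano_bases_sorted: "\<forall>l \<in> set fano_bases. sorted_wrt (<) l"
  by (simp add: fano_bases_def)

lemma (in coordinatization) card_bases:
  assumes "B \<in> Bs" "B' \<in> Bs" shows "card B = card B'"
proof -
  have "B' \<in> {C \<in> Bs. card C = card B}"
  proof (rule closure_exchange[where F = E])
    fix C b e assume C: "C \<in> {C \<in> Bs. card C = card B}" "b \<in> C" "insert e (C - {b}) \<in> Bs"
    then have "finite C" using finite_base by blast
    then have "card (insert e (C - {b})) = card C"
      using C insert_mem_iff[of C b e] card_Suc_Diff1[of C b]
      by (cases "e \<in> C") (auto simp: insert_absorb)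
    then show "insert e (C - {b}) \<in> {C \<in> Bs. card C = card B}" using C by simp
  qed (use assms base_sub in auto)
  then show ?thesis by simp
qed

text \<open>All bases have three elements, and each triple is decided by a minor of
  \<open>fano_matrix\<close>. So \<open>h\<close> transports the matroid to lists of numbers, where
  one evaluation of the difference, 8 * 8 - 8 * 16, is negative.\<close>

lemma fano_not_rayleigh:
  fixes n :: "'a set \<Rightarrow> 'a \<Rightarrow> 'a \<Rightarrow> bit"
  assumes n: "coordinatization E Bs n" and h: "inj_on h {0..<7}" and E: "E = h ` {0..<7}"
    and B: "{h 0, h 1, h 2} \<in> Bs"
    and col: "\<And>i j. \<lbrakk>i < 3; j < 7\<rbrakk> \<Longrightarrow> n {h 0, h 1, h 2} (h i) (h j) = fano_matrix i j"
  shows "\<not> strongly_rayleigh E Bs"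
proof
  interpret n: coordinatization E Bs n by fact
  assume SR: "strongly_rayleigh E Bs"
  have hne: "h i \<noteq> h j" if "i < 7" "j < 7" "i \<noteq> j" for i j
    using h that by (auto dest: inj_onD)
  have hE: "h i \<in> E" if "i < 7" for i using that E by auto
  have col': "n {h 0, h 1, h 2} (h 0) (h j) = fano_matrix 0 j"
    "n {h 0, h 1, h 2} (h 1) (h j) = fano_matrix 1 j"
    "n {h 0, h 1, h 2} (h 2) (h j) = fano_matrix 2 j" if "j < 7" for j
    by (rule col; use that in simp)+
  have mem: "h ` set l \<in> Bs \<longleftrightarrow> l \<in> set fano_bases"
    if l: "l \<in> set (subseqs [0..<7])" "length l = 3" for l
  proof -
    obtain p q s where l': "l = [p, q, s]" using l(2) by (auto simp: numeral_3_eq_3 length_Suc_conv)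
    have d: "distinct [p, q, s]" using subseqs_distinctD[OF l(1)] l' by simp
    have "set l \<in> Pow (set [0..<7])" using l(1) subseqs_powset[of "[0..<7]"] by blast
    then have lt: "p < 7" "q < 7" "s < 7" using l' by auto
    have "{h p, h q, h s} \<in> Bs \<longleftrightarrow> det3 (n {h 0, h 1, h 2}) (h 0) (h 1) (h 2) (h p) (h q) (h s) \<noteq> 0"
      by (rule n.three_set_mem[OF B]) (use lt d hne hE in auto)
    also have "det3 (n {h 0, h 1, h 2}) (h 0) (h 1) (h 2) (h p) (h q) (h s) = det3 fano_matrix 0 1 2 p q s"
      unfolding det3_def col'[OF lt(1)] col'[OF lt(2)] col'[OF lt(3)] ..
    also have "\<dots> \<noteq> 0 \<longleftrightarrow> l \<in> set fano_bases"
      using fano_bases_det l l' by auto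
    finally show ?thesis using l' by simp
  qed
  have Bs: "Bs = (\<lambda>l. h ` set l) ` set fano_bases"
  proof (intro Set.set_eqI iffI)
    fix C assume C: "C \<in> Bs"
    define S where "S = {i \<in> {0..<7}. h i \<in> C}"
    have S7: "S \<subseteq> {0..<7}" by (auto simp: S_def)
    have CS: "C = h ` S" using n.base_sub[OF C] E by (auto simp: S_def)
    have "card {h 0, h 1, h 2} = 3" using hne[of 0 1] hne[of 0 2] hne[of 1 2] by simp
    then have "card C = 3" using n.card_bases[OF C B] by simp
    then have cS: "card S = 3"
      using CS card_image[OF inj_on_subset[OF h, of S]] S7 by simp
    have "S \<in> set ` set (subseqs [0..<7])" unfolding subseqs_powset using S7 by auto
    then obtain l where l: "l \<in> set (subseqs [0..<7])" "S = set l" by blast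
    then have "length l = 3" using cS subseqs_distinctD[OF l(1)] distinct_card[of l] by simp
    then show "C \<in> (\<lambda>l. h ` set l) ` set fano_bases" using mem[OF l(1)] C CS l(2) by blast
  next
    fix C assume "C \<in> (\<lambda>l. h ` set l) ` set fano_bases"
    then show "C \<in> Bs" using mem fano_bases_subseqs by auto
  qed
  \<comment> \<open>\<open>3\<close> is the third point of the line through \<open>0\<close> and \<open>1\<close>. With \<open>\<Sigma>\<close> the sum of the variables
    off this line, the difference is a quadratic in \<open>y\<^sub>3 \<Sigma>\<close>, and it is minimal for this choice.\<close>
  define z :: "nat \<Rightarrow> real" where "z i = (if i = 3 then -1 else 2)" for i
  define y where "y v = (if v = h 3 then -1 else 2 :: real)" for v
  have yz: "y (h i) = z i" if "i < 7" for i using hne[of i 3] that by (auto simp: y_def z_def)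
  have lt: "set l \<subseteq> {0..<7}" if "l \<in> set fano_bases" for l
  proof -
    have "l \<in> set (subseqs [0..<7])" using that fano_bases_subseqs by auto
    then have "set l \<in> Pow (set [0..<7])" using subseqs_powset[of "[0..<7]"] by blast
    then show ?thesis by auto
  qed
  have poly: "basis_poly Bs (h ` I) (h ` J) y =
      (\<Sum>l \<in> set (filter (\<lambda>l. I \<subseteq> set l \<and> set l \<inter> J = {}) fano_bases). \<Prod>c \<in> set l - I. z c)"
    if IJ: "I \<subseteq> {0..<7}" "J \<subseteq> {0..<7}" for I J
  proof -
    let ?F = "set (filter (\<lambda>l. I \<subseteq> set l \<and> set l \<inter> J = {}) fano_bases)"
    have sub: "h ` I \<subseteq> h ` set l \<longleftrightarrow> I \<subseteq> set l" if "l \<in> set fano_bases" for l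
      unfolding image_subset_iff using inj_on_image_mem_iff[OF h _ lt[OF that]] IJ(1) by blast
    have int: "h ` set l \<inter> h ` J = {} \<longleftrightarrow> set l \<inter> J = {}" if "l \<in> set fano_bases" for l
      using inj_on_image_Int[OF h lt[OF that] IJ(2)] by (metis image_is_empty)
    have eq: "{B \<in> Bs. h ` I \<subseteq> B \<and> B \<inter> h ` J = {}} = (\<lambda>l. h ` set l) ` ?F"
      unfolding Bs Compr_image_eq set_filter
    proof (intro image_cong Collect_cong conj_cong refl)
      fix l assume "l \<in> set fano_bases"
      then show "h ` I \<subseteq> h ` set l \<longleftrightarrow> I \<subseteq> set l" "h ` set l \<inter> h ` J = {} \<longleftrightarrow> set l \<inter> J = {}"
        by (rule sub int)+
    qed
    have inj: "inj_on (\<lambda>l. h ` set l) ?F"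
    proof (rule inj_onI)
      fix l l' assume l: "l \<in> ?F" "l' \<in> ?F" "h ` set l = h ` set l'"
      then have "set l = set l'" using inj_on_image_eq_iff[OF h lt lt] by auto
      moreover have "sorted_wrt (<) l" "sorted_wrt (<) l'" using l fano_bases_sorted by auto
      ultimately show "l = l'" using strict_sorted_equal by blast
    qed
    have "basis_poly Bs (h ` I) (h ` J) y = (\<Sum>l \<in> ?F. \<Prod>c \<in> h ` set l - h ` I. y c)"
      unfolding basis_poly_def eq by (rule sum.reindex_cong[OF inj]) auto
    also have "\<dots> = (\<Sum>l \<in> ?F. \<Prod>c \<in> set l - I. z c)"
    proof (rule sum.cong)
      fix l assume "l \<in> ?F"
      then have l: "set l \<subseteq> {0..<7}" using lt by auto
      have eq: "h ` set l - h ` I = h ` (set l - I)" using inj_on_image_set_diff[OF h _ IJ(1)] l by auto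
      have sub: "set l - I \<subseteq> {0..<7}" using l by auto
      have "(\<Prod>c \<in> h ` set l - h ` I. y c) = (\<Prod>c \<in> set l - I. y (h c))"
        using eq prod.reindex[OF inj_on_subset[OF h sub], of y] by simp
      also have "\<dots> = (\<Prod>c \<in> set l - I. z c)" using sub by (intro prod.cong yz) auto
      finally show "(\<Prod>c \<in> h ` set l - h ` I. y c) = (\<Prod>c \<in> set l - I. z c)" .
    qed simp
    finally show ?thesis .
  qed
  have "basis_poly Bs {h 0} {h 1} y = 8"
    using poly[of "{0}" "{1}"] by (simp add: fano_bases_def z_def)
  moreover have "basis_poly Bs {h 1} {h 0} y = 8"
    using poly[of "{1}" "{0}"] by (simp add: fano_bases_def z_def)
  moreover have "basis_poly Bs {h 0, h 1} {} y = 8"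
    using poly[of "{0, 1}" "{}"] by (simp add: fano_bases_def z_def)
  moreover have "basis_poly Bs {} {h 0, h 1} y = 16"
    using poly[of "{}" "{0, 1}"] by (simp add: fano_bases_def z_def)
  ultimately have "rayleigh_difference Bs (h 0) (h 1) y < 0"
    by (simp add: rayleigh_difference_def)
  moreover have "0 \<le> rayleigh_difference Bs (h 0) (h 1) y"
    using SR hE[of 0] hE[of 1] hne[of 0 1] by (simp add: strongly_rayleigh_def)
  ultimately show False by simp
qed

section \<open>Binary strongly Rayleigh matroids are regular\<close>

text \<open>Elements other than the seven named ones are deleted if they lie outside
  \<open>B\<close> and contracted if inside; both keep the exchanges among the seven. What remains
  is determined by its supports, since the entries are bits.\<close>

lemma no_fano_minor:
  fixes n :: "'a set \<Rightarrow> 'a \<Rightarrow> 'a \<Rightarrow> bit"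
  assumes "coordinatization E Bs n" "strongly_rayleigh E Bs" "B \<in> Bs"
    and "{r0, r1, r2} \<subseteq> B" "r0 \<noteq> r1" "r0 \<noteq> r2" "r1 \<noteq> r2" "{c1, c2, x, y} \<subseteq> E - B"
    and "insert c1 (B - {r0}) \<in> Bs" "insert c1 (B - {r1}) \<in> Bs" "insert c1 (B - {r2}) \<notin> Bs"
    and "insert c2 (B - {r0}) \<notin> Bs" "insert c2 (B - {r1}) \<in> Bs" "insert c2 (B - {r2}) \<in> Bs"
    and "insert x (B - {r0}) \<in> Bs" "insert x (B - {r1}) \<notin> Bs" "insert x (B - {r2}) \<in> Bs"
    and "insert y (B - {r0}) \<in> Bs" "insert y (B - {r1}) \<in> Bs" "insert y (B - {r2}) \<in> Bs"
  shows False
  using assms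
proof (induction "card E" arbitrary: E Bs n B rule: less_induct)
  case less
  note n = less.prems(1) and SR = less.prems(2) and B = less.prems(3) and r = less.prems(4)
    and rne = less.prems(5-7) and c = less.prems(8) and adj = less.prems(9-)
  interpret n: coordinatization E Bs n by fact
  let ?F = "{r0, r1, r2, c1, c2, x, y}"
  show False
  proof (cases "E \<subseteq> ?F")
    case False
    then obtain z where z: "z \<in> E" "z \<notin> ?F" by auto
    have cd: "card (E - {z}) < card E" by (rule card_Diff1_less[OF n.finite_E z(1)])
    show False
    proof (cases "z \<in> B")
      case False
      have mem: "C \<in> deletion Bs z \<longleftrightarrow> C \<in> Bs \<and> z \<notin> C" for C by (auto simp: deletion_def)
      show False
        by (rule less.hyps[OF cd n.deletion_coords[OF B False] strongly_rayleigh_deletion[OF n SR], of B])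
          (unfold mem, use z B False r rne c adj in auto)
    next
      case True
      have mem: "C \<in> contraction E Bs z \<longleftrightarrow> z \<notin> C \<and> insert z C \<in> Bs" for C
        by (rule n.mem_contraction[OF z(1)])
      obtain M :: "'a set \<Rightarrow> 'a \<Rightarrow> 'a \<Rightarrow> bit"
        where M: "coordinatization (E - {z}) (contraction E Bs z) M"
        using n.contraction_minor(1)[OF z(1) B True SR] by blast
      have ins: "insert z (insert e (B - {z} - {b})) = insert e (B - {b})" if "b \<noteq> z" for e b
        using True that by auto
      have ne: "z \<noteq> r0" "z \<noteq> r1" "z \<noteq> r2" "z \<noteq> c1" "z \<noteq> c2" "z \<noteq> x" "z \<noteq> y" using z by auto
      note ins' = ins[OF ne(1)[symmetric]] ins[OF ne(2)[symmetric]] ins[OF ne(3)[symmetric]]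
      show False
        by (rule less.hyps[OF cd M n.contraction_minor(2)[OF z(1) B True SR], of "B - {z}"])
          (unfold mem ins', use z B True r rne c adj ne in \<open>auto simp: insert_absorb\<close>)
    qed
  next
    case True
    then have E: "E = ?F" using c r n.base_sub[OF B] by blast
    have B': "B = {r0, r1, r2}" using E c r n.base_sub[OF B] by blast
    define h where "h = nth [r0, r1, r2, c1, c2, x, y]"
    have v: "n B b e = (if insert e (B - {b}) \<in> Bs then 1 else 0)" if "b \<in> B" "e \<in> E" for b e
      using n.N_exchange[OF B that] by (cases "n B b e") auto
    have rB: "r0 \<in> B" "r1 \<in> B" "r2 \<in> B" using r by auto
    have cE: "c1 \<in> E" "c2 \<in> E" "x \<in> E" "y \<in> E" "c1 \<notin> B" "c2 \<notin> B" "x \<notin> B" "y \<notin> B" using c by auto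
    have "distinct [r0, r1, r2, c1, c2, x, y]" using rne rB cE adj by auto
    then have inj: "inj_on h {0..<7}"
      unfolding h_def by (intro inj_on_nth) auto
    have "h ` {0..<7} = set [r0, r1, r2, c1, c2, x, y]"
      unfolding h_def using nth_image[of 7 "[r0, r1, r2, c1, c2, x, y]"] by simp
    then have hE: "E = h ` {0..<7}" using E by simp
    have hB: "{h 0, h 1, h 2} = B" using B' by (simp add: h_def numeral_2_eq_2)
    have base: "n B b e = (if e = b then 1 else 0)" if "b \<in> B" "e \<in> B" for b e
      by (rule n.N_base[OF B that])
    have hv:
      "h 0 = r0" "h 1 = r1" "h 2 = r2" "h 3 = c1" "h 4 = c2" "h 5 = x" "h 6 = y"
      by (simp_all add: h_def)
    have unit:
      "n B r0 r0 = 1" "n B r0 r1 = 0" "n B r0 r2 = 0" "n B r1 r0 = 0" "n B r1 r1 = 1"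
      "n B r1 r2 = 0" "n B r2 r0 = 0" "n B r2 r1 = 0" "n B r2 r2 = 1"
      by (simp_all add: base rB rne rne[symmetric])
    have entry:
      "n B r0 c1 = 1" "n B r0 c2 = 0" "n B r0 x = 1" "n B r0 y = 1" "n B r1 c1 = 1"
      "n B r1 c2 = 1" "n B r1 x = 0" "n B r1 y = 1" "n B r2 c1 = 0" "n B r2 c2 = 1"
      "n B r2 x = 1" "n B r2 y = 1"
      by (simp_all add: v rB cE adj)
    have fano:
      "fano_matrix 0 0 = 1" "fano_matrix 0 1 = 0" "fano_matrix 0 2 = 0" "fano_matrix 0 3 = 1"
      "fano_matrix 0 4 = 0" "fano_matrix 0 5 = 1" "fano_matrix 0 6 = 1" "fano_matrix 1 0 = 0"
      "fano_matrix 1 1 = 1" "fano_matrix 1 2 = 0" "fano_matrix 1 3 = 1" "fano_matrix 1 4 = 1"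
      "fano_matrix 1 5 = 0" "fano_matrix 1 6 = 1" "fano_matrix 2 0 = 0" "fano_matrix 2 1 = 0"
      "fano_matrix 2 2 = 1" "fano_matrix 2 3 = 0" "fano_matrix 2 4 = 1" "fano_matrix 2 5 = 1"
      "fano_matrix 2 6 = 1"
      by (simp_all add: fano_matrix_def)
    have "n {h 0, h 1, h 2} (h i) (h j) = fano_matrix i j" if ij: "i < 3" "j < 7" for i j
    proof -
      have "i = 0 \<or> i = 1 \<or> i = 2" "j = 0 \<or> j = 1 \<or> j = 2 \<or> j = 3 \<or> j = 4 \<or> j = 5 \<or> j = 6"
        using ij by linarith+
      then show ?thesis
        unfolding hB by (elim disjE) (simp_all only: hv unit entry fano)
    qed
    then show False using fano_not_rayleigh[OF n inj hE] hB B SR by simp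
  qed
qed

section \<open>Connectedness and leaves of a grown tree\<close>

text \<open>Connectedness by closed sets instead of paths: it will be applied to a component
  \<open>P\<close> that was formed over a different basis and is only known to be closed. The empty
  set counts as connected.\<close>

definition conn :: "('a \<Rightarrow> 'a \<Rightarrow> bool) \<Rightarrow> 'a set \<Rightarrow> bool" where
  "conn R S \<longleftrightarrow> (\<forall>P. P \<inter> S \<noteq> {} \<and> (\<forall>u\<in>P \<inter> S. \<forall>v\<in>S. R u v \<longrightarrow> v \<in> P) \<longrightarrow> S \<subseteq> P)"

lemma connI:
  assumes "\<And>P u. \<lbrakk>u \<in> P; u \<in> S; \<And>u v. \<lbrakk>u \<in> P; u \<in> S; v \<in> S; R u v\<rbrakk> \<Longrightarrow> v \<in> P\<rbrakk> \<Longrightarrow> S \<subseteq> P"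
  shows "conn R S"
  unfolding conn_def
proof (intro allI impI, elim conjE)
  fix P assume "P \<inter> S \<noteq> {}" and cl: "\<forall>u\<in>P \<inter> S. \<forall>v\<in>S. R u v \<longrightarrow> v \<in> P"
  then obtain u where u: "u \<in> P" "u \<in> S" by auto
  show "S \<subseteq> P" by (rule assms[OF u]) (use cl in simp)
qed

lemma connD:
  assumes "conn R S" "u \<in> P" "u \<in> S" "\<And>u v. \<lbrakk>u \<in> P; u \<in> S; v \<in> S; R u v\<rbrakk> \<Longrightarrow> v \<in> P"
  shows "S \<subseteq> P"
proof -
  have "P \<inter> S \<noteq> {} \<and> (\<forall>u\<in>P \<inter> S. \<forall>v\<in>S. R u v \<longrightarrow> v \<in> P)" using assms by auto
  then show ?thesis by (rule mp[OF spec[OF assms(1)[unfolded conn_def]]])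
qed

lemma conn_insert:
  assumes S: "conn R S" "p \<in> S" and w: "R p w" "R w p" shows "conn R (insert w S)"
proof (rule connI)
  fix P u assume u: "u \<in> P" "u \<in> insert w S"
    and cl: "\<And>u v. \<lbrakk>u \<in> P; u \<in> insert w S; v \<in> insert w S; R u v\<rbrakk> \<Longrightarrow> v \<in> P"
  have "\<exists>u'. u' \<in> P \<and> u' \<in> S"
  proof (cases "u = w")
    case True
    then have "p \<in> P" using cl[of w p] u S(2) w by simp
    then show ?thesis using S(2) by blast
  qed (use u in blast)
  then obtain u' where u': "u' \<in> P" "u' \<in> S" by blast
  have "S \<subseteq> P" by (rule connD[OF S(1) u']) (use cl in simp)
  moreover from this have "w \<in> P" using cl[of p w] S(2) w by auto
  ultimately show "insert w S \<subseteq> P" by simp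
qed

lemma conn_star:
  assumes "\<And>u. u \<in> U \<Longrightarrow> R v u" "\<And>u. u \<in> U \<Longrightarrow> R u v" shows "conn R (insert v U)"
proof (rule connI)
  fix P u assume u: "u \<in> P" "u \<in> insert v U"
    and cl: "\<And>u w. \<lbrakk>u \<in> P; u \<in> insert v U; w \<in> insert v U; R u w\<rbrakk> \<Longrightarrow> w \<in> P"
  have v: "v \<in> P" using u cl[of u v] assms(2)[of u] by auto
  show "insert v U \<subseteq> P"
  proof
    fix w assume "w \<in> insert v U"
    then show "w \<in> P" using v cl[of v w] assms(1)[of w] by auto
  qed
qed

text \<open>Growing a star into a component, as a tree does, keeps three leaves available.\<close>
lemma three_leaves:
  assumes fin: "finite V" and sym: "\<And>u v. R u v \<Longrightarrow> R v u"
    and star: "v \<in> V" "U \<subseteq> V" "card U = 3" "v \<notin> U" "\<And>u. u \<in> U \<Longrightarrow> R v u"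
  obtains W X where "W \<subseteq> V" "X \<subseteq> W" "card X = 3" "\<And>u z. \<lbrakk>u \<in> W; z \<in> V; R u z\<rbrakk> \<Longrightarrow> z \<in> W"
    "\<And>T. T \<subseteq> X \<Longrightarrow> conn R (W - T)"
proof -
  define star_like where "star_like W X \<longleftrightarrow> W \<subseteq> V \<and> X \<subseteq> W \<and> card X = 3 \<and> (\<forall>T\<subseteq>X. conn R (W - T))" for W X
  have "\<exists>W X. star_like W X \<and> (\<forall>u\<in>W. \<forall>z\<in>V. R u z \<longrightarrow> z \<in> W)" if "star_like W X" for W X
    using that
  proof (induction "card (V - W)" arbitrary: W X rule: less_induct)
    case less
    show ?case
    proof (cases "\<forall>u\<in>W. \<forall>z\<in>V. R u z \<longrightarrow> z \<in> W")
      case False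
      then obtain u z where z: "u \<in> W" "z \<in> V" "R u z" "z \<notin> W" by blast
      have I: "W \<subseteq> V" "X \<subseteq> W" "card X = 3" "\<And>T. T \<subseteq> X \<Longrightarrow> conn R (W - T)"
        using less.prems by (auto simp: star_like_def)
      have finX: "finite X" using I(3) card.infinite by fastforce
      have "V - insert z W \<subset> V - W" using z by auto
      then have cd: "card (V - insert z W) < card (V - W)" using fin by (intro psubset_card_mono) auto
      \<comment> \<open>If the new vertex \<open>z\<close> hangs on a leaf \<open>u\<close>, it
        takes over as leaf; otherwise the leaves stay. Hence a removed \<open>z\<close> may be
        dropped from \<open>T\<close>, and a kept \<open>z\<close> is attached to a kept
        \<open>u\<close>.\<close>
      define X' where "X' = (if u \<in> X then insert z (X - {u}) else X)"
      have "conn R (insert z W - T)" if T: "T \<subseteq> X'" for T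
      proof (cases "z \<in> T")
        case True
        then have "u \<in> X" using T z I(2) by (auto simp: X'_def split: if_splits)
        then have "T - {z} \<subseteq> X" using T by (auto simp: X'_def)
        moreover have "insert z W - T = W - (T - {z})" using True z by auto
        ultimately show ?thesis using I(4) by simp
      next
        case zT: False
        then have "T \<subseteq> X" "u \<notin> T" using T by (auto simp: X'_def split: if_splits)
        then have "conn R (insert z (W - T))" using z sym I(4) by (intro conn_insert[of R _ u]) auto
        moreover have "insert z W - T = insert z (W - T)" using zT by auto
        ultimately show ?thesis by simp
      qed
      moreover have "card X' = 3" using I z finX by (auto simp: X'_def card_insert_if card_Suc_Diff1)
      ultimately have "star_like (insert z W) X'" using I z by (auto simp: star_like_def X'_def)
      then show ?thesis using less.hyps[OF cd] by blast
    qed (use less.prems in blast)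
  qed
  moreover have "star_like (insert v U) U"
    unfolding star_like_def
  proof (intro conjI allI impI)
    fix T assume "T \<subseteq> U"
    then have "insert v U - T = insert v (U - T)" using star by auto
    then show "conn R (insert v U - T)" using star(5) sym \<open>T \<subseteq> U\<close> by (simp, intro conn_star) auto
  qed (use star in auto)
  ultimately obtain W X where "star_like W X" "\<forall>u\<in>W. \<forall>z\<in>V. R u z \<longrightarrow> z \<in> W" by blast
  then show thesis by (intro that[of W X]) (auto simp: star_like_def)
qed

text \<open>The failing block of \<open>signable_glue\<close> may occur over a basis
  \<open>B\<close> far from \<open>B0\<close>, whereas connectedness is known over \<open>B0\<close>
  only. Separations carry over between bases by \<open>separator_invariant\<close>, so the two rows
  of the block are still joined by a path that avoids \<open>x\<close> and \<open>y\<close>.\<close>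

lemma signable_two_columns:
  fixes n :: "'a set \<Rightarrow> 'a \<Rightarrow> 'a \<Rightarrow> bit"
  assumes n: "coordinatization E Bs n" and SR: "strongly_rayleigh E Bs" and B0: "B0 \<in> Bs"
    and xy: "x \<in> E - B0" "y \<in> E - B0" "x \<noteq> y" "x \<in> W" "y \<in> W"
    and W: "W \<subseteq> E" "\<And>u z. \<lbrakk>u \<in> W; z \<in> E; fund_adj Bs B0 u z\<rbrakk> \<Longrightarrow> z \<in> W"
    and C: "conn (fund_adj Bs B0) (W - {x, y})"
    and sx: "signable (E - {x}) (deletion Bs x)" and sy: "signable (E - {y}) (deletion Bs y)"
  shows "signable E Bs"
proof -
  interpret n: coordinatization E Bs n by fact
  obtain M1 where "unimodular (E - {y}) (deletion Bs y) M1" using sy by (auto simp: signable_def)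
  then interpret M1: unimodular "E - {y}" "deletion Bs y" M1 .
  obtain N2 where N2: "unimodular (E - {x}) (deletion Bs x) N2" using sx by (auto simp: signable_def)
  then interpret N2: unimodular "E - {x}" "deletion Bs x" N2 .
  define E' where "E' = E - {x, y}"
  define Bs' where "Bs' = {B \<in> Bs. x \<notin> B \<and> y \<notin> B}"
  have eqs: "E - {x} - {y} = E'" "E - {y} - {x} = E'" "deletion (deletion Bs x) y = Bs'"
    "deletion (deletion Bs y) x = Bs'" by (auto simp: E'_def Bs'_def deletion_def)
  have B0': "B0 \<in> Bs'" "B0 \<in> deletion Bs x" "B0 \<in> deletion Bs y"
    using B0 xy by (auto simp: Bs'_def deletion_def)
  interpret n': coordinatization E' Bs' n
    using coordinatization.deletion_coords[OF n.deletion_coords[OF B0, of x], of B0 y] B0' xy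
    by (simp add: eqs)
  have M1': "unimodular E' Bs' M1"
    using M1.deletion_unimodular[OF B0'(3), of x] xy by (simp add: eqs)
  have N2': "unimodular E' Bs' N2"
    using N2.deletion_unimodular[OF B0'(2), of y] xy by (simp add: eqs)
  obtain \<sigma> where s: "\<And>e. \<sigma> e = 1 \<or> \<sigma> e = -1"
    and \<sigma>: "\<And>b e. \<lbrakk>b \<in> B0; e \<in> E'\<rbrakk> \<Longrightarrow> N2 B0 b e = \<sigma> b * \<sigma> e * M1 B0 b e"
    using signing_unique[OF M1' N2' B0'(1)] by metis
  define N1 where "N1 = (\<lambda>B b e. \<sigma> b * \<sigma> e * M1 B b e)"
  have N1: "unimodular (E - {y}) (deletion Bs y) N1"
    unfolding N1_def by (rule M1.rescale_unimodular[OF s])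
  interpret N1: unimodular "E - {y}" "deletion Bs y" N1 by (rule N1)
  have N1': "unimodular E' Bs' N1"
    using N1.deletion_unimodular[OF B0'(3), of x] xy by (simp add: eqs)
  have agree0: "N1 B0 b e = N2 B0 b e" if "b \<in> B0" "e \<in> E'" for b e
    using \<sigma>[OF that] by (simp add: N1_def)
  have agree: "N1 B b e = N2 B b e" if "B \<in> Bs'" "b \<in> B" "e \<in> E'" for B b e
    by (rule coordinatization_agree[OF unimodular.axioms(1)[OF N1'] unimodular.axioms(1)[OF N2'] B0'(1) agree0 that])
  have sep_W: "n B0 b e = 0" if "b \<in> B0" "e \<in> E" "b \<in> W \<longleftrightarrow> e \<notin> W" for b e
  proof (rule ccontr)
    assume nz: "n B0 b e \<noteq> 0"
    then have "e \<notin> B0" using n.N_base[OF B0 that(1), of e] that by (auto split: if_splits)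
    then have "fund_adj Bs B0 b e" "fund_adj Bs B0 e b"
      using n.N_exchange[OF B0 that(1,2)] nz that by (auto simp: fund_adj_def)
    then show False using W n.base_sub[OF B0] that by blast
  qed
  show ?thesis
  proof (rule signable_glue[OF n B0 xy(1-3) N1 N2])
    show "N1 B0 b e = N2 B0 b e" if "b \<in> B0" "e \<in> E - {x, y}" for b e
      using agree0 that by (simp add: E'_def)
    fix B i j
    assume B: "B \<in> Bs" "x \<notin> B" "y \<notin> B" and ij: "i \<in> B" "j \<in> B" "i \<noteq> j"
      and nz: "N1 B i x \<noteq> 0" "N1 B j x \<noteq> 0" "N2 B i y \<noteq> 0" "N2 B j y \<noteq> 0"
    have BB: "B \<in> Bs'" "B \<in> deletion Bs x" "B \<in> deletion Bs y" using B by (auto simp: Bs'_def deletion_def)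
    have BE: "B \<subseteq> E'" using n.base_sub[OF B(1)] B by (auto simp: E'_def)
    have supp1: "N1 B b e \<noteq> 0 \<longleftrightarrow> insert e (B - {b}) \<in> Bs" if "B \<in> Bs" "y \<notin> B" "b \<in> B" "e \<in> E - {y}" for B b e
      using N1.N_exchange[of B b e] that by (auto simp: deletion_def)
    have supp2: "N2 B b e \<noteq> 0 \<longleftrightarrow> insert e (B - {b}) \<in> Bs" if "B \<in> Bs" "x \<notin> B" "b \<in> B" "e \<in> E - {x}" for B b e
      using N2.N_exchange[of B b e] that by (auto simp: deletion_def)
    show "N1 B i x * N1 B j x = N2 B i y * N2 B j y"
    proof (rule ccontr)
      assume bad: "N1 B i x * N1 B j x \<noteq> N2 B i y * N2 B j y"
      \<comment> \<open>\<open>W\<close> is a union of components over \<open>B0\<close>, hence a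
        separator over \<open>B\<close> as well, and \<open>x\<close> lies in it.\<close>
      have inW: "b \<in> W" if "b \<in> B" "N1 B b x \<noteq> 0" for b
      proof (rule ccontr)
        assume "b \<notin> W"
        then have "n B b x = 0"
          using n.separator_invariant[OF B0 B(1), of W b x] sep_W that xy by auto
        then show False using n.N_exchange[OF B(1) that(1), of x] supp1[OF B(1,3) that(1), of x] that xy by auto
      qed
      define R where "R = {(u, v). u \<in> B \<union> (E' - B) \<and> v \<in> B \<union> (E' - B) \<and> fund_adj Bs B u v}"
      \<comment> \<open>\<open>P\<close> is the component of \<open>i\<close> over \<open>B\<close>
        without \<open>x\<close> and \<open>y\<close>. It separates over \<open>B0\<close> too,
        where the connected set \<open>W - {x, y}\<close> must lie in it, so it contains
        \<open>j\<close>.\<close>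
      define P where "P = {v. (i, v) \<in> R\<^sup>*}"
      have symR: "(v, u) \<in> R" if "(u, v) \<in> R" for u v using that by (auto simp: R_def fund_adj_sym)
      have sepP: "n B b e = 0" if be: "b \<in> B" "e \<in> E'" "b \<in> P \<longleftrightarrow> e \<notin> P" for b e
      proof (rule ccontr)
        assume nz: "n B b e \<noteq> 0"
        then have "e \<notin> B" using n.N_base[OF B(1) be(1), of e] be by (auto split: if_splits)
        then have "(b, e) \<in> R"
          using n.N_exchange[OF B(1) be(1), of e] nz be BE by (auto simp: R_def fund_adj_def E'_def)
        then show False using symR[of b e] be by (auto simp: P_def intro: rtrancl_into_rtrancl)
      qed
      have sepP0: "n B0 b e = 0" if "b \<in> B0" "e \<in> E'" "b \<in> P \<longleftrightarrow> e \<notin> P" for b e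
        using n'.separator_invariant[OF BB(1) B0'(1), of P b e] sepP that by auto
      have WE: "W - {x, y} \<subseteq> E'" using W by (auto simp: E'_def)
      have closed: "v \<in> P" if "u \<in> P" "u \<in> W - {x, y}" "v \<in> W - {x, y}" "fund_adj Bs B0 u v" for u v
      proof (rule ccontr)
        assume "v \<notin> P"
        have "u \<in> E'" "v \<in> E'" "u \<in> E" "v \<in> E" using that WE W by auto
        then show False
          using that(4) sepP0[of u v] sepP0[of v u] n.N_exchange[OF B0, of u v] n.N_exchange[OF B0, of v u]
            \<open>v \<notin> P\<close> that(1) unfolding fund_adj_def by blast
      qed
      have iW: "i \<in> W - {x, y}" "j \<in> W - {x, y}" using inW ij nz B by auto
      have "i \<in> P" by (simp add: P_def)
      then have "W - {x, y} \<subseteq> P" by (rule connD[OF C _ iW(1)]) (rule closed)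
      then have path: "(i, j) \<in> R\<^sup>*" using iW by (auto simp: P_def)
      have disj: "(E' - B) \<inter> B = {}" by auto
      obtain k r c where p: "1 \<le> k" "r 0 = i" "r k = j" "r ` {..k} \<subseteq> B" "inj_on r {..k}" "c ` {1..k} \<subseteq> E' - B"
        "\<forall>m\<le>k. \<forall>l\<in>{1..k}. insert (c l) (B - {r m}) \<in> Bs \<longleftrightarrow> l = m \<or> l = Suc m"
        by (rule induced_bipartite_path[OF path[unfolded R_def] ij disj])
      have rB: "r m \<in> B" if "m \<le> k" for m using p(4) that by auto
      have cE: "c l \<in> E' \<and> c l \<notin> B" if "1 \<le> l" "l \<le> k" for l
        using p(6) that unfolding image_subset_iff by auto
      have "sign_conflict (E - {y}) (deletion Bs y) N1 x (E - {x}) (deletion Bs x) N2 y"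
      proof (rule path_sign[OF N1 N2 p(1) BB(3,2) rB p(5)])
        show "x \<in> E - {y}" "x \<notin> B" "y \<in> E - {x}" "y \<notin> B" using xy B by auto
        show "N1 B (r 0) x \<noteq> 0" "N1 B (r k) x \<noteq> 0" "N2 B (r 0) y \<noteq> 0" "N2 B (r k) y \<noteq> 0"
          using nz p by auto
        show "N1 B (r 0) x * N1 B (r k) x \<noteq> N2 B (r 0) y * N2 B (r k) y" using bad p by simp
        fix l assume l: "1 \<le> l" "l \<le> k"
        show "c l \<in> E - {y} \<and> c l \<in> E - {x} \<and> c l \<notin> B" using cE[OF l] by (auto simp: E'_def)
        fix m assume m: "m \<le> k"
        show "N1 B (r m) (c l) = N2 B (r m) (c l)" using agree[OF BB(1) rB[OF m]] cE[OF l] by auto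
        show "N1 B (r m) (c l) \<noteq> 0 \<longleftrightarrow> l = m \<or> l = Suc m"
          using p(7) m l supp1[OF B(1,3) rB[OF m], of "c l"] cE[OF l] by (auto simp: E'_def)
      qed
      then obtain D r0 r1 r2 c1 c2 where D': "D \<in> deletion Bs y" "D \<in> deletion Bs x"
        and r: "{r0, r1, r2} \<subseteq> D" "r0 \<noteq> r1" "r0 \<noteq> r2" "r1 \<noteq> r2"
        and c: "{c1, c2} \<subseteq> (E - {y}) \<inter> (E - {x}) - D"
        and N: "N1 D r0 c1 \<noteq> 0" "N1 D r1 c1 \<noteq> 0" "N1 D r2 c1 = 0"
          "N1 D r0 c2 = 0" "N1 D r1 c2 \<noteq> 0" "N1 D r2 c2 \<noteq> 0"
          "N1 D r0 x \<noteq> 0" "N1 D r2 x \<noteq> 0" "N2 D r0 y \<noteq> 0" "N2 D r2 y \<noteq> 0"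
          "(N1 D r1 x = 0) \<noteq> (N2 D r1 y = 0)"
        unfolding sign_conflict_def by (elim exE conjE) (rule that)
      have D: "D \<in> Bs" "x \<notin> D" "y \<notin> D" using D' by (auto simp: deletion_def)
      have S: "N1 D b e \<noteq> 0 \<longleftrightarrow> insert e (D - {b}) \<in> Bs" if "b \<in> {r0, r1, r2}" "e \<in> {c1, c2, x}" for b e
        by (rule supp1) (use D r c xy that in auto)
      have T: "N2 D b y \<noteq> 0 \<longleftrightarrow> insert y (D - {b}) \<in> Bs" if "b \<in> {r0, r1, r2}" for b
        by (rule supp2) (use D r c xy that in auto)
      have cols: "{c1, c2, x, y} \<subseteq> E - D" "{c1, c2, y, x} \<subseteq> E - D" using D c xy by auto
      have C1: "insert c1 (D - {r0}) \<in> Bs" "insert c1 (D - {r1}) \<in> Bs" "insert c1 (D - {r2}) \<notin> Bs"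
        "insert c2 (D - {r0}) \<notin> Bs" "insert c2 (D - {r1}) \<in> Bs" "insert c2 (D - {r2}) \<in> Bs"
        "insert x (D - {r0}) \<in> Bs" "insert x (D - {r2}) \<in> Bs" "insert y (D - {r0}) \<in> Bs" "insert y (D - {r2}) \<in> Bs"
        using N S T by auto
      have C2: "(insert x (D - {r1}) \<notin> Bs) \<noteq> (insert y (D - {r1}) \<notin> Bs)"
        using N(11) S[of r1 x] T[of r1] by auto
      \<comment> \<open>\<open>r1\<close> meets exactly one of \<open>x\<close> and
        \<open>y\<close>; that one becomes the full column \<open>y\<close> of
        \<open>no_fano_minor\<close>.\<close>
      show False
      proof (cases "insert x (D - {r1}) \<in> Bs")
        case True
        then show False using no_fano_minor[OF n SR D(1) r cols(2)] C1 C2 by simp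
      next
        case False
        then show False using no_fano_minor[OF n SR D(1) r cols(1)] C1 C2 by simp
      qed
    qed
  qed
qed

lemma (in coordinatization) fund_adj_dual:
  assumes "B \<in> Bs" "u \<in> E" "v \<in> E"
  shows "fund_adj (dual_bases E Bs) (E - B) u v \<longleftrightarrow> fund_adj Bs B u v"
proof -
  have BE: "E - (E - B) = B" using base_sub[OF assms(1)] by auto
  show ?thesis
    using dual_exchange_iff[of "E - B" u v] dual_exchange_iff[of "E - B" v u] assms
    unfolding BE fund_adj_def by auto
qed

text \<open>With fewer neighbours \<open>x\<close> would be a loop or parallel to its only
  neighbour, and a signing of the deletion would extend to it.\<close>

lemma two_neighbours_column:
  fixes n :: "'a set \<Rightarrow> 'a \<Rightarrow> 'a \<Rightarrow> bit"
  assumes n: "coordinatization E Bs n" and nonsign: "\<not> signable E Bs" and B: "B \<in> Bs"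
    and x: "x \<in> E" "x \<notin> B" and del: "signable (E - {x}) (deletion Bs x)"
  shows "\<exists>p q. p \<in> E \<and> q \<in> E \<and> p \<noteq> q \<and> fund_adj Bs B x p \<and> fund_adj Bs B x q"
proof -
  interpret n: coordinatization E Bs n by fact
  have adj: "p \<in> E \<and> fund_adj Bs B x p" if "p \<in> B" "n B p x \<noteq> 0" for p
    using n.N_exchange[OF B that(1) x(1)] that x n.base_sub[OF B] by (auto simp: fund_adj_def)
  obtain p where p: "p \<in> B" "n B p x \<noteq> 0"
    using signable_loop[OF n B x(1) _ del] nonsign by blast
  have "\<exists>q\<in>B. q \<noteq> p \<and> n B q x \<noteq> 0"
  proof (rule ccontr)
    assume "\<not> (\<exists>q\<in>B. q \<noteq> p \<and> n B q x \<noteq> 0)"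
    then have others: "\<And>b. \<lbrakk>b \<in> B; b \<noteq> p\<rbrakk> \<Longrightarrow> n B b x = 0" by auto
    have one: "n B p x = 1" using p by (cases "n B p x") auto
    have "signable E Bs"
    proof (rule signable_parallel[OF n x(1) _ _ _ del])
      show "p \<in> E" "x \<noteq> p" using p x n.base_sub[OF B] by auto
      show "n C c x = n C c p" if "C \<in> Bs" "c \<in> C" for C c
        by (rule n.one_neighbour_parallel[OF B x(1) p(1) one others that])
    qed
    then show False using nonsign by simp
  qed
  then show ?thesis using adj p by blast
qed

text \<open>The induction hypothesis is also applied to deletions of the dual, which have smaller
  ground sets too. They bound the degrees of basis elements from below and serve the case in which
  the two leaves lie in the basis.\<close>

theorem signable_of_strongly_rayleigh:
  fixes n :: "'a set \<Rightarrow> 'a \<Rightarrow> 'a \<Rightarrow> bit"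
  assumes "coordinatization E Bs n" "strongly_rayleigh E Bs"
  shows "signable E Bs"
  using assms
proof (induction "card E" arbitrary: E Bs n rule: less_induct)
  case less
  note n = less.prems(1) and SR = less.prems(2)
  interpret n: coordinatization E Bs n by fact
  interpret D: coordinatization E "dual_bases E Bs" "dual_coords E n" by (rule n.dual_coordinatization)
  note SRD = strongly_rayleigh_dual[OF n SR]
  have del: "signable (E - {x}) (deletion Bs x)" if "B \<in> Bs" "x \<in> E" "x \<notin> B" for B x
    by (rule less.hyps[OF card_Diff1_less[OF n.finite_E that(2)] n.deletion_coords[OF that(1,3)]
          strongly_rayleigh_deletion[OF n SR]])
  have delD: "signable (E - {x}) (deletion (dual_bases E Bs) x)"
    if "B \<in> dual_bases E Bs" "x \<in> E" "x \<notin> B" for B x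
    by (rule less.hyps[OF card_Diff1_less[OF n.finite_E that(2)] D.deletion_coords[OF that(1,3)]
          strongly_rayleigh_deletion[OF D.coordinatization_axioms SRD]])
  show ?case
  proof (rule ccontr)
    assume nonsign: "\<not> signable E Bs"
    have nonsignD: "\<not> signable E (dual_bases E Bs)" using signable_dual[OF n] nonsign by blast
    have two: "\<exists>p q. p \<in> E \<and> q \<in> E \<and> p \<noteq> q \<and> fund_adj Bs B v p \<and> fund_adj Bs B v q"
      if B: "B \<in> Bs" and v: "v \<in> E" for B v
    proof (cases "v \<in> B")
      case False
      show ?thesis by (rule two_neighbours_column[OF n nonsign B v False del[OF B v False]])
    next
      case True
      have C: "E - B \<in> dual_bases E Bs" using B by (simp add: dual_bases_def)
      have vC: "v \<notin> E - B" using True by simp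
      obtain p q where "p \<in> E" "q \<in> E" "p \<noteq> q" "fund_adj (dual_bases E Bs) (E - B) v p"
        "fund_adj (dual_bases E Bs) (E - B) v q"
        using two_neighbours_column[OF D.coordinatization_axioms nonsignD C v vC delD[OF C v vC]] by blast
      then show ?thesis using n.fund_adj_dual[OF B v] by blast
    qed
    have "E \<noteq> {}"
    proof
      assume "E = {}"
      then have "unimodular E Bs (\<lambda>_ _ _. 0)"
        using n.nonempty n.base_sub by unfold_locales auto
      then show False using nonsign by (auto simp: signable_def)
    qed
    \<comment> \<open>If all degrees are two, a pivot on the middle edge \<open>bc\<close> of a path \<open>abcd\<close> toggles the edge \<open>ad\<close>,
      so that the degree of \<open>a\<close> becomes one or three.\<close>
    have "\<exists>B v U. B \<in> Bs \<and> v \<in> E \<and> U \<subseteq> E \<and> card U = 3 \<and> (\<forall>u\<in>U. fund_adj Bs B v u)"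
    proof (rule ccontr)
      assume none: "\<not> ?thesis"
      have no3: False if "B \<in> Bs" "v \<in> E" "{u1, u2, u3} \<subseteq> E" "u1 \<noteq> u2" "u1 \<noteq> u3" "u2 \<noteq> u3"
        "fund_adj Bs B v u1" "fund_adj Bs B v u2" "fund_adj Bs B v u3" for B v u1 u2 u3
      proof -
        have "card {u1, u2, u3} = 3" using that by simp
        then show False using none that by blast
      qed
      obtain B v where B: "B \<in> Bs" and v: "v \<in> E" using n.nonempty \<open>E \<noteq> {}\<close> by blast
      obtain b where b: "b \<in> B"
      proof (cases "v \<in> B")
        case False
        then show ?thesis using two[OF B v] that by (auto simp: fund_adj_def)
      qed (rule that)
      have BE: "B \<subseteq> E" by (rule n.base_sub[OF B])
      have adj: "fund_adj Bs C u w \<longleftrightarrow> n C u w \<noteq> 0" "fund_adj Bs C w u \<longleftrightarrow> n C u w \<noteq> 0"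
        if "C \<in> Bs" "u \<in> C" "w \<in> E" "w \<notin> C" for C u w
        using n.N_exchange[OF that(1-3)] that by (auto simp: fund_adj_def)
      obtain a c where ac: "a \<in> E" "c \<in> E" "a \<noteq> c" "fund_adj Bs B b a" "fund_adj Bs B b c"
        using two[OF B, of b] b BE by blast
      have acB: "a \<notin> B" "c \<notin> B" using ac b by (auto simp: fund_adj_def)
      obtain d where d: "d \<in> E" "d \<noteq> b" "fund_adj Bs B c d" using two[OF B ac(2)] by metis
      have dB: "d \<in> B" using d acB by (auto simp: fund_adj_def)
      have nz: "n B b a = 1" "n B b c = 1" "n B d c = 1"
        using adj(1)[OF B b ac(1) acB(1)] adj(1)[OF B b ac(2) acB(2)] adj(2)[OF B dB ac(2) acB(2)] ac d
        by (auto simp: bit_not_zero_iff)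
      have bE: "b \<in> E" using b BE by blast
      have dE: "d \<in> E" using d by blast
      have c0: "n B g c = 0" if "g \<in> B" "g \<noteq> b" "g \<noteq> d" for g
      proof (rule ccontr)
        assume g: "n B g c \<noteq> 0"
        have gE: "g \<in> E" using that BE by blast
        show False
          by (rule no3[OF B ac(2), of b d g])
            (use adj(2)[OF B _ ac(2) acB(2)] that b dB nz g gE bE dE d in auto)
      qed
      have C: "insert c (B - {b}) \<in> Bs" using n.N_exchange[OF B b ac(2)] nz by simp
      let ?C = "insert c (B - {b})"
      have piv: "n ?C g a = n B g a - n B g c * n B b a / n B b c" if "g \<in> B" "g \<noteq> b" for g
        by (rule n.pivot) (use B b ac acB C that in auto)
      have cC: "n ?C c a = 1" using n.pivot_row[OF B b ac(2) acB(2) C ac(1)] nz by simp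
      have aC: "a \<notin> ?C" using ac acB by auto
      obtain p q where pq: "p \<in> E" "q \<in> E" "p \<noteq> q" "fund_adj Bs B a p" "fund_adj Bs B a q"
        using two[OF B ac(1)] by blast
      have pqB: "p \<in> B" "q \<in> B" using pq acB by (auto simp: fund_adj_def)
      show False
      proof (cases "n B d a = 0")
        case True
        obtain a' where a': "a' \<in> B" "a' \<noteq> b" "n B a' a \<noteq> 0"
          using pq pqB adj(2)[OF B _ ac(1) acB(1)] by metis
        then have "a' \<noteq> d" using True by auto
        then have "n ?C a' a \<noteq> 0" "n ?C d a \<noteq> 0"
          using piv[of a'] piv[of d] c0[of a'] a' nz True dB d by auto
        moreover have "a' \<in> E" using a' BE by blast
        ultimately show False
          by (intro no3[OF C ac(1), of c d a'])
            (use adj(2)[OF C _ ac(1) aC] cC a' \<open>a' \<noteq> d\<close> dB dE d acB ac in auto)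
      next
        case False
        then have da: "n B d a = 1" by (simp add: bit_not_zero_iff)
        have "n ?C g a = 0" if "g \<in> B" "g \<noteq> b" for g
        proof (cases "g = d")
          case True
          then show ?thesis using piv[OF that] da nz by simp
        next
          case False
          have "n B g a = 0"
          proof (rule ccontr)
            assume g: "n B g a \<noteq> 0"
            have gE: "g \<in> E" using that BE by blast
            show False
              by (rule no3[OF B ac(1), of b d g])
                (use adj(2)[OF B _ ac(1) acB(1)] that False b dB nz da g gE bE dE d in auto)
          qed
          then show ?thesis using piv[OF that] c0[OF that False] by simp
        qed
        then have only: "g = c" if "g \<in> ?C" "fund_adj Bs ?C a g" for g
          using adj(2)[OF C _ ac(1) aC] that by auto
        obtain p q where "p \<noteq> q" "fund_adj Bs ?C a p" "fund_adj Bs ?C a q"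
          using two[OF C ac(1)] by blast
        moreover from this have "p \<in> ?C" "q \<in> ?C" using aC unfolding fund_adj_def by blast+
        ultimately show False using only by metis
      qed
    qed
    then obtain B v U where B: "B \<in> Bs" and v: "v \<in> E" and U: "U \<subseteq> E" "card U = 3"
      and star: "\<And>u. u \<in> U \<Longrightarrow> fund_adj Bs B v u" by blast
    have "v \<notin> U" using star[of v] by (auto simp: fund_adj_def)
    obtain W X where W: "W \<subseteq> E" "X \<subseteq> W" "card X = 3"
      "\<And>u z. \<lbrakk>u \<in> W; z \<in> E; fund_adj Bs B u z\<rbrakk> \<Longrightarrow> z \<in> W"
      "\<And>T. T \<subseteq> X \<Longrightarrow> conn (fund_adj Bs B) (W - T)"
      by (rule three_leaves[of E "fund_adj Bs B" v U, OF n.finite_E _ v U \<open>v \<notin> U\<close> star])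
        (simp_all add: fund_adj_sym)
    obtain x1 x2 x3 where X: "X = {x1, x2, x3}" "x1 \<noteq> x2" "x1 \<noteq> x3" "x2 \<noteq> x3"
      using W(3) by (auto simp: card_3_iff)
    \<comment> \<open>Pigeonhole: three leaves, two colour classes.\<close>
    obtain x y where xy: "x \<in> X" "y \<in> X" "x \<noteq> y" "x \<in> B \<longleftrightarrow> y \<in> B" using X by blast
    have xyE: "x \<in> E" "y \<in> E" "x \<in> W" "y \<in> W" using xy W by auto
    have cxy: "conn (fund_adj Bs B) (W - {x, y})" using W(5)[of "{x, y}"] xy by simp
    show False
    proof (cases "x \<in> B")
      case False
      then have "x \<in> E - B" "y \<in> E - B" "x \<notin> B" "y \<notin> B" using xy xyE by auto
      note xyB = this
      have "signable E Bs"
      proof (rule signable_two_columns[OF n SR B xyB(1,2) xy(3) xyE(3,4) W(1) _ cxy])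
        show "z \<in> W" if "u \<in> W" "z \<in> E" "fund_adj Bs B u z" for u z by (rule W(4)[OF that])
      qed (rule del[OF B xyE(1) xyB(3)] del[OF B xyE(2) xyB(4)])+
      then show False using nonsign by simp
    next
      case True
      have C: "E - B \<in> dual_bases E Bs" using B by (simp add: dual_bases_def)
      have xyC: "x \<in> E - (E - B)" "y \<in> E - (E - B)" "x \<notin> E - B" "y \<notin> E - B" using True xy xyE by auto
      have closed: "z \<in> W" if "u \<in> W" "z \<in> E" "fund_adj (dual_bases E Bs) (E - B) u z" for u z
        using W(4)[OF that(1,2)] n.fund_adj_dual[OF B _ that(2), of u] that W(1) by blast
      have "conn (fund_adj (dual_bases E Bs) (E - B)) (W - {x, y})"
      proof (rule connI)
        fix P u assume u: "u \<in> P" "u \<in> W - {x, y}"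
          and cl: "\<And>u v. \<lbrakk>u \<in> P; u \<in> W - {x, y}; v \<in> W - {x, y};
            fund_adj (dual_bases E Bs) (E - B) u v\<rbrakk> \<Longrightarrow> v \<in> P"
        show "W - {x, y} \<subseteq> P"
        proof (rule connD[OF cxy u])
          fix a b assume ab: "a \<in> P" "a \<in> W - {x, y}" "b \<in> W - {x, y}" "fund_adj Bs B a b"
          have "a \<in> E" "b \<in> E" using ab W(1) by auto
          then show "b \<in> P" by (intro cl[OF ab(1-3)]) (simp add: n.fund_adj_dual[OF B] ab(4))
        qed
      qed
      note cxyD = this
      have "signable E (dual_bases E Bs)"
      proof (rule signable_two_columns[OF D.coordinatization_axioms SRD C xyC(1,2) xy(3) xyE(3,4) W(1) _ cxyD])
        show "z \<in> W" if "u \<in> W" "z \<in> E" "fund_adj (dual_bases E Bs) (E - B) u z" for u z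
          by (rule closed[OF that])
      qed (rule delD[OF C xyE(1) xyC(3)] delD[OF C xyE(2) xyC(4)])+
      then show False using nonsignD by simp
    qed
  qed
qed

section \<open>Regular matroids are strongly Rayleigh\<close>

lemma basis_poly_split:
  assumes "finite Bs" "\<And>B. B \<in> Bs \<Longrightarrow> finite B" "x \<notin> I" "x \<notin> J"
  shows "basis_poly Bs I J y = basis_poly Bs I (insert x J) y + y x * basis_poly Bs (insert x I) J y"
proof -
  let ?S = "{B \<in> Bs. I \<subseteq> B \<and> B \<inter> J = {}}"
  have split: "?S = {B \<in> Bs. I \<subseteq> B \<and> B \<inter> insert x J = {}} \<union> {B \<in> Bs. insert x I \<subseteq> B \<and> B \<inter> J = {}}"
    by auto
  have "(\<Sum>B \<in> {B \<in> Bs. insert x I \<subseteq> B \<and> B \<inter> J = {}}. \<Prod>c \<in> B - I. y c)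
      = (\<Sum>B \<in> {B \<in> Bs. insert x I \<subseteq> B \<and> B \<inter> J = {}}. y x * (\<Prod>c \<in> B - insert x I. y c))"
  proof (rule sum.cong)
    fix B assume B: "B \<in> {B \<in> Bs. insert x I \<subseteq> B \<and> B \<inter> J = {}}"
    then have "x \<in> B - I" "finite (B - I)" using assms by auto
    moreover have "B - I - {x} = B - insert x I" by auto
    ultimately show "(\<Prod>c \<in> B - I. y c) = y x * (\<Prod>c \<in> B - insert x I. y c)"
      using prod.remove[of "B - I" x y] by simp
  qed simp
  then show ?thesis
    unfolding basis_poly_def split
    by (subst sum.union_disjoint) (use assms in \<open>auto simp: sum_distrib_left\<close>)
qed

lemma basis_poly_upd:
  assumes "x \<in> I \<or> x \<in> J" shows "basis_poly Bs I J (y(x := t)) = basis_poly Bs I J y"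
  unfolding basis_poly_def by (intro sum.cong prod.cong) (use assms in auto)

context unimodular begin

text \<open>For a representation by vectors \<open>a\<^sub>e\<close> this is \<open>a\<^sub>e\<^sup>T adj(\<Sum>\<^sub>g y\<^sub>g a\<^sub>g a\<^sub>g\<^sup>T) a\<^sub>f\<close>, up to a factor
  independent of \<open>y\<close>.\<close>
definition cofactor_form :: "'a \<Rightarrow> 'a \<Rightarrow> ('a \<Rightarrow> real) \<Rightarrow> real" where
  "cofactor_form e f y = (\<Sum>B \<in> {B \<in> Bs. e \<in> B}. N B e f * (\<Prod>c \<in> B - {e}. y c))"

lemma cofactor_form_self: "cofactor_form e e y = basis_poly Bs {e} {} y"
  unfolding cofactor_form_def basis_poly_def by (intro sum.cong) (auto simp: N_base)

lemma cofactor_form_exchange: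
  assumes "e \<in> E" "f \<in> E" "e \<noteq> f"
  shows "cofactor_form e f y =
    (\<Sum>B \<in> {B \<in> Bs. e \<in> B \<and> f \<notin> B \<and> insert f (B - {e}) \<in> Bs}. N B e f * (\<Prod>c \<in> B - {e}. y c))"
  unfolding cofactor_form_def
proof (rule sum.mono_neutral_right)
  show "\<forall>B \<in> {B \<in> Bs. e \<in> B} - {B \<in> Bs. e \<in> B \<and> f \<notin> B \<and> insert f (B - {e}) \<in> Bs}.
      N B e f * (\<Prod>c \<in> B - {e}. y c) = 0"
    using N_exchange[OF _ _ assms(2)] N_base assms by auto
qed (use finite_Bs in auto)

text \<open>Exchanging \<open>e\<close> and \<open>f\<close> is a bijection between the contributing
  bases that keeps the monomial. The coefficients are reciprocal to each other, hence equal for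
  signs; this is where unimodularity enters.\<close>

lemma cofactor_form_sym:
  assumes ef: "e \<in> E" "f \<in> E" shows "cofactor_form e f y = cofactor_form f e y"
proof (cases "e = f")
  case False
  let ?S = "\<lambda>e f. {B \<in> Bs. e \<in> B \<and> f \<notin> B \<and> insert f (B - {e}) \<in> Bs}"
  show ?thesis
    unfolding cofactor_form_exchange[OF ef False] cofactor_form_exchange[OF ef(2,1) False[symmetric]]
  proof (rule sum.reindex_bij_witness[where i = "\<lambda>B. insert e (B - {f})" and j = "\<lambda>B. insert f (B - {e})"])
    fix B assume B: "B \<in> ?S e f"
    have undo: "insert e (insert f (B - {e}) - {f}) = B" using B False by auto
    show "insert e (insert f (B - {e}) - {f}) = B" by (rule undo)
    show "insert f (B - {e}) \<in> ?S f e" using B False undo by auto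
    have "N (insert f (B - {e})) f e = N B e e / N B e f" by (rule pivot_row) (use B ef in auto)
    then have "N (insert f (B - {e})) f e = N B e f"
      using B ef entries[of B e f] N_base[of B e e] N_exchange[of B e f] by auto
    moreover have "insert f (B - {e}) - {f} = B - {e}" using B by auto
    ultimately show "N (insert f (B - {e})) f e * (\<Prod>c \<in> insert f (B - {e}) - {f}. y c) =
        N B e f * (\<Prod>c \<in> B - {e}. y c)" by simp
  next
    fix B assume B: "B \<in> ?S f e"
    have undo: "insert f (insert e (B - {f}) - {e}) = B" using B False by auto
    show "insert f (insert e (B - {f}) - {e}) = B" by (rule undo)
    show "insert e (B - {f}) \<in> ?S e f" using B False undo by auto
  qed
qed simp

text \<open>\<open>\<rho>\<close> is in the row space. In matrix terms, \<open>A\<^sup>T adj(A Y A\<^sup>T) A Y\<close> acts on it as \<open>det(A Y A\<^sup>T)\<close>.\<close>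
lemma cofactor_form_row:
  assumes f: "f \<in> E" and \<rho>: "\<And>B. B \<in> Bs \<Longrightarrow> \<rho> f = (\<Sum>b\<in>B. \<rho> b * N B b f)"
  shows "(\<Sum>g\<in>E. cofactor_form g f y * y g * \<rho> g) = basis_poly Bs {} {} y * \<rho> f"
proof -
  have "(\<Sum>g\<in>E. cofactor_form g f y * y g * \<rho> g) =
      (\<Sum>g\<in>E. \<Sum>B \<in> {B \<in> Bs. g \<in> B}. N B g f * (\<Prod>c \<in> B - {g}. y c) * y g * \<rho> g)"
    by (simp add: cofactor_form_def sum_distrib_right)
  also have "\<dots> = (\<Sum>B \<in> Bs. \<Sum>g \<in> {g \<in> E. g \<in> B}. N B g f * (\<Prod>c \<in> B - {g}. y c) * y g * \<rho> g)"
    by (rule sum.swap_restrict[OF finite_E finite_Bs])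
  also have "\<dots> = (\<Sum>B \<in> Bs. (\<Prod>c \<in> B. y c) * \<rho> f)"
  proof (rule sum.cong)
    fix B assume B: "B \<in> Bs"
    have "{g \<in> E. g \<in> B} = B" using base_sub[OF B] by auto
    moreover have "N B g f * (\<Prod>c \<in> B - {g}. y c) * y g * \<rho> g = (\<Prod>c \<in> B. y c) * (\<rho> g * N B g f)"
      if "g \<in> B" for g
      unfolding prod.remove[OF finite_base[OF B] that, of y] by (simp add: ac_simps)
    ultimately have "(\<Sum>g \<in> {g \<in> E. g \<in> B}. N B g f * (\<Prod>c \<in> B - {g}. y c) * y g * \<rho> g) =
        (\<Sum>g \<in> B. (\<Prod>c \<in> B. y c) * (\<rho> g * N B g f))"
      by (simp only: cong: sum.cong)
    then show "(\<Sum>g \<in> {g \<in> E. g \<in> B}. N B g f * (\<Prod>c \<in> B - {g}. y c) * y g * \<rho> g) = (\<Prod>c \<in> B. y c) * \<rho> f"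
      using \<rho>[OF B] by (simp add: sum_distrib_left)
  qed simp
  finally show ?thesis by (simp add: basis_poly_def sum_distrib_right)
qed

text \<open>As a function of \<open>g\<close>, \<open>cofactor_form e g z\<close> lies in the row
  space by the cocycle, so \<open>cofactor_form_row\<close> applies to it once symmetry has moved
  \<open>g\<close> to the first place.\<close>

lemma cofactor_form_product:
  assumes e: "e \<in> E"
  shows "(\<Sum>g\<in>E. cofactor_form e g y * y g * cofactor_form e g z) =
    basis_poly Bs {} {} y * basis_poly Bs {e} {} z"
proof -
  have "(\<Sum>g\<in>E. cofactor_form e g y * y g * cofactor_form e g z) =
      (\<Sum>g\<in>E. cofactor_form g e y * y g * cofactor_form e g z)"
    using cofactor_form_sym[OF e] by simp
  also have "\<dots> = basis_poly Bs {} {} y * cofactor_form e e z"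
  proof (rule cofactor_form_row[OF e])
    fix B assume B: "B \<in> Bs"
    have "cofactor_form e e z =
        (\<Sum>C \<in> {C \<in> Bs. e \<in> C}. (\<Sum>b\<in>B. N C e b * N B b e) * (\<Prod>c \<in> C - {e}. z c))"
      unfolding cofactor_form_def using N_cocycle[OF _ B _ e] by (intro sum.cong) auto
    also have "\<dots> = (\<Sum>b\<in>B. cofactor_form e b z * N B b e)"
      by (simp add: cofactor_form_def sum_distrib_right sum_distrib_left ac_simps) (rule sum.swap)
    finally show "cofactor_form e e z = (\<Sum>b\<in>B. cofactor_form e b z * N B b e)" .
  qed
  finally show ?thesis by (simp add: cofactor_form_self)
qed

text \<open>Interchanging \<open>y\<close> and \<open>z\<close> in
  \<open>cofactor_form_product\<close> changes only the middle factor of each summand on the left.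
  If \<open>z\<close> is \<open>y\<close> with one added at \<open>f\<close>, the difference reduces
  to the summand at \<open>f\<close>, and this is a square because \<open>cofactor_form e f\<close>
  does not involve the variable of \<open>f\<close>.\<close>

theorem rayleigh_difference_square:
  assumes ef: "e \<in> E" "f \<in> E" "e \<noteq> f"
  shows "rayleigh_difference Bs e f y = (cofactor_form e f y)\<^sup>2"
proof -
  define z where "z = y(f := y f + 1)"
  let ?q = "\<lambda>g. cofactor_form e g y * cofactor_form e g z"
  have qz: "cofactor_form e f z = cofactor_form e f y"
    unfolding cofactor_form_exchange[OF ef] z_def by (intro sum.cong arg_cong2[where f = "(*)"] prod.cong) auto
  have "(\<Sum>g\<in>E. ?q g * (z g - y g)) = (\<Sum>g\<in>E. if g = f then ?q f else 0)"
    by (rule sum.cong) (auto simp: z_def)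
  then have "?q f = (\<Sum>g\<in>E. ?q g * (z g - y g))" using ef finite_E by simp
  also have "\<dots> = (\<Sum>g\<in>E. cofactor_form e g z * z g * cofactor_form e g y)
      - (\<Sum>g\<in>E. cofactor_form e g y * y g * cofactor_form e g z)"
    by (simp add: sum_subtractf[symmetric] algebra_simps)
  also have "\<dots> = basis_poly Bs {} {} z * basis_poly Bs {e} {} y - basis_poly Bs {} {} y * basis_poly Bs {e} {} z"
    by (simp add: cofactor_form_product[OF ef(1)])
  finally have sq: "(cofactor_form e f y)\<^sup>2 =
      basis_poly Bs {} {} z * basis_poly Bs {e} {} y - basis_poly Bs {} {} y * basis_poly Bs {e} {} z"
    by (simp add: qz power2_eq_square)
  note split = basis_poly_split[OF finite_Bs finite_base]
  have zf: "z f = y f + 1" by (simp add: z_def)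
  have upd: "basis_poly Bs I J z = basis_poly Bs I J y" if "f \<in> I \<or> f \<in> J" for I J
    unfolding z_def by (rule basis_poly_upd[OF that])
  \<comment> \<open>Expanded in the variables of \<open>e\<close> and \<open>f\<close>, the
    right-hand side of \<open>sq\<close> cancels down to the Rayleigh difference.\<close>
  have M: "basis_poly Bs {} {} x = basis_poly Bs {} {e, f} x + x e * basis_poly Bs {e} {f} x
      + x f * (basis_poly Bs {f} {e} x + x e * basis_poly Bs {e, f} {} x)" for x
    using split[of f "{}" "{}" x] split[of e "{}" "{f}" x] split[of e "{f}" "{}" x] ef
    by (simp add: insert_commute)
  have Me: "basis_poly Bs {e} {} x = basis_poly Bs {e} {f} x + x f * basis_poly Bs {e, f} {} x" for x
    using split[of f "{e}" "{}" x] ef by (simp add: insert_commute)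
  have ze: "z e = y e" using ef by (simp add: z_def)
  have M_upd: "basis_poly Bs {} {e, f} z = basis_poly Bs {} {e, f} y"
    "basis_poly Bs {e} {f} z = basis_poly Bs {e} {f} y" "basis_poly Bs {f} {e} z = basis_poly Bs {f} {e} y"
    "basis_poly Bs {e, f} {} z = basis_poly Bs {e, f} {} y" by (simp_all add: upd)
  show ?thesis
    unfolding rayleigh_difference_def sq M[of z] M[of y] Me[of z] Me[of y] M_upd zf ze
    by (simp add: algebra_simps)
qed

lemma strongly_rayleigh: "strongly_rayleigh E Bs"
  by (auto simp: strongly_rayleigh_def rayleigh_difference_square)

end

section \<open>Coordinates and matrix representations\<close>

text \<open>Independence of a family: equal columns are dependent without a separate clause, and the
  ground set itself may index the columns.\<close>

definition family_independent :: "nat \<Rightarrow> (nat \<Rightarrow> 'a \<Rightarrow> 'k::field) \<Rightarrow> 'a set \<Rightarrow> bool" where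
  "family_independent m a X \<longleftrightarrow>
    (\<forall>\<alpha>. (\<forall>i<m. (\<Sum>x\<in>X. \<alpha> x * a i x) = 0) \<longrightarrow> (\<forall>x\<in>X. \<alpha> x = 0))"

lemma family_independentD:
  assumes "family_independent m a X" "\<And>i. i < m \<Longrightarrow> (\<Sum>x\<in>X. \<alpha> x * a i x) = 0" "x \<in> X"
  shows "\<alpha> x = 0"
proof -
  have "\<forall>i<m. (\<Sum>x\<in>X. \<alpha> x * a i x) = 0" using assms(2) by simp
  then have "\<forall>x\<in>X. \<alpha> x = 0" by (rule mp[OF spec[OF assms(1)[unfolded family_independent_def]]])
  then show ?thesis using assms(3) by simp
qed

lemma family_independent_eq:
  assumes "family_independent m a X" "x \<in> X"
    and "\<And>i. i < m \<Longrightarrow> (\<Sum>x\<in>X. \<mu> x * a i x) = (\<Sum>x\<in>X. \<nu> x * a i x)"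
  shows "\<mu> x = \<nu> x"
proof -
  have "(\<lambda>x. \<mu> x - \<nu> x) x = 0"
    by (rule family_independentD[OF assms(1) _ assms(2)])
      (use assms(3) in \<open>simp add: left_diff_distrib sum_subtractf\<close>)
  then show ?thesis by simp
qed

text \<open>Equal columns collapse in a set of vectors, which \<open>lin_dep\<close> does not see.
  In the family they satisfy a relation with coefficients 1 and -1, from which the converse recovers
  injectivity.\<close>

lemma cols_lin_indpt_iff:
  fixes A :: "'k::field mat"
  assumes J: "J \<subseteq> {..<dim_col A}"
  shows "cols_lin_indpt A J \<longleftrightarrow> family_independent (dim_row A) (\<lambda>i j. A $$ (i, j)) J"
proof -
  define m where "m = dim_row A"
  interpret V: vec_space "TYPE('k)" m .
  have finJ: "finite J" using J finite_subset by blast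
  have car: "col A ` J \<subseteq> carrier_vec m" using J by (auto simp: m_def)
  have entry: "col A j $ i = A $$ (i, j)" if "j \<in> J" "i < m" for i j
    using that J by (auto simp: m_def)
  show ?thesis
  proof
    assume "cols_lin_indpt A J"
    then have inj: "inj_on (col A) J" and indep: "\<not> V.lin_dep (col A ` J)"
      by (auto simp: cols_lin_indpt_def m_def)
    show "family_independent (dim_row A) (\<lambda>i j. A $$ (i, j)) J"
      unfolding family_independent_def m_def[symmetric]
    proof (intro allI impI ballI)
      fix \<alpha> j assume 0: "\<forall>i<m. (\<Sum>x\<in>J. \<alpha> x * A $$ (i, x)) = 0" and j: "j \<in> J"
      define a where "a = \<alpha> \<circ> the_inv_into J (col A)"
      have a: "a (col A x) = \<alpha> x" if "x \<in> J" for x using the_inv_into_f_f[OF inj that] by (simp add: a_def)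
      have "V.lincomb a (col A ` J) = 0\<^sub>v m"
      proof
        show "dim_vec (V.lincomb a (col A ` J)) = dim_vec (0\<^sub>v m)"
          using V.lincomb_dim[OF finite_imageI[OF finJ] car] by simp
        fix i assume "i < dim_vec (0\<^sub>v m :: 'k vec)"
        then have i: "i < m" by simp
        have "V.lincomb a (col A ` J) $ i = (\<Sum>x\<in>J. a (col A x) * col A x $ i)"
          using V.lincomb_index[OF i car] sum.reindex[OF inj] by (simp add: o_def)
        also have "\<dots> = (\<Sum>x\<in>J. \<alpha> x * A $$ (i, x))" using a entry i by (intro sum.cong) auto
        finally show "V.lincomb a (col A ` J) $ i = 0\<^sub>v m $ i" using 0 i by simp
      qed
      then have "a (col A j) = 0"
        using indep finite_imageI[OF finJ, of "col A"] j unfolding V.lin_dep_def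
        by (auto simp: class_ring_simps)
      then show "\<alpha> j = 0" using a[OF j] by simp
    qed
  next
    assume "family_independent (dim_row A) (\<lambda>i j. A $$ (i, j)) J"
    then have F: "family_independent m (\<lambda>i j. A $$ (i, j)) J" by (simp add: m_def)
    have inj: "inj_on (col A) J"
    proof (rule inj_onI, rule ccontr)
      fix j j' assume jj: "j \<in> J" "j' \<in> J" "col A j = col A j'" "j \<noteq> j'"
      define \<mu> where "\<mu> x = (if x = j then 1 else 0 :: 'k)" for x
      define \<nu> where "\<nu> x = (if x = j' then 1 else 0 :: 'k)" for x
      have "\<mu> j = \<nu> j"
      proof (rule family_independent_eq[OF F jj(1)])
        fix i assume "i < m"
        then have "A $$ (i, j) = A $$ (i, j')" using entry jj by metis
        then show "(\<Sum>x\<in>J. \<mu> x * A $$ (i, x)) = (\<Sum>x\<in>J. \<nu> x * A $$ (i, x))"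
          using jj finJ by (simp add: \<mu>_def \<nu>_def if_one_mult)
      qed
      then show False using jj by (simp add: \<mu>_def \<nu>_def)
    qed
    moreover have "\<not> V.lin_dep (col A ` J)"
    proof
      assume "V.lin_dep (col A ` J)"
      then obtain S a v where S: "finite S" "S \<subseteq> col A ` J" "V.lincomb a S = 0\<^sub>v m" "v \<in> S" "a v \<noteq> 0"
        unfolding V.lin_dep_def by (auto simp: class_ring_simps)
      define \<alpha> where "\<alpha> x = (if col A x \<in> S then a (col A x) else 0)" for x
      obtain j where j: "j \<in> J" "col A j = v" using S by auto
      have "\<alpha> j = 0"
      proof (rule family_independentD[OF F _ j(1)])
        fix i assume i: "i < m"
        have "(\<Sum>x\<in>J. \<alpha> x * A $$ (i, x)) = (\<Sum>x\<in>J. (if col A x \<in> S then a (col A x) * col A x $ i else 0))"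
          using entry i by (intro sum.cong) (auto simp: \<alpha>_def)
        also have "\<dots> = (\<Sum>x\<in>{x \<in> J. col A x \<in> S}. a (col A x) * col A x $ i)"
          using finJ by (simp add: sum.inter_filter)
        also have "\<dots> = (\<Sum>u\<in>S. a u * u $ i)"
          by (rule sum.reindex_cong[symmetric, where l = "col A"]) (use S(2) inj in \<open>auto intro: inj_on_subset\<close>)
        also have "\<dots> = V.lincomb a S $ i"
          using V.lincomb_index[OF i, of S a] S(2) car by auto
        also have "\<dots> = 0" using S(3) i by simp
        finally show "(\<Sum>x\<in>J. \<alpha> x * A $$ (i, x)) = 0" .
      qed
      then show False using S j by (simp add: \<alpha>_def)
    qed
    ultimately show "cols_lin_indpt A J" by (simp add: cols_lin_indpt_def m_def)
  qed
qed

lemma family_independent_image: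
  assumes "inj_on l X"
  shows "family_independent m a (l ` X) \<longleftrightarrow> family_independent m (\<lambda>i x. a i (l x)) X"
proof
  assume F: "family_independent m a (l ` X)"
  show "family_independent m (\<lambda>i x. a i (l x)) X"
    unfolding family_independent_def
  proof (intro allI impI ballI)
    fix \<alpha> x assume 0: "\<forall>i<m. (\<Sum>x\<in>X. \<alpha> x * a i (l x)) = 0" and x: "x \<in> X"
    have "(\<alpha> \<circ> the_inv_into X l) (l x) = 0"
    proof (rule family_independentD[OF F])
      fix i assume i: "i < m"
      have "(\<Sum>j\<in>l ` X. (\<alpha> \<circ> the_inv_into X l) j * a i j) = (\<Sum>x\<in>X. \<alpha> x * a i (l x))"
        by (rule sum.reindex_cong[OF assms]) (simp_all add: the_inv_into_f_f[OF assms])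
      then show "(\<Sum>j\<in>l ` X. (\<alpha> \<circ> the_inv_into X l) j * a i j) = 0" using 0 i by simp
    qed (use x in simp)
    then show "\<alpha> x = 0" using the_inv_into_f_f[OF assms x] by simp
  qed
next
  assume F: "family_independent m (\<lambda>i x. a i (l x)) X"
  show "family_independent m a (l ` X)"
    unfolding family_independent_def
  proof (intro allI impI ballI)
    fix \<alpha> j assume 0: "\<forall>i<m. (\<Sum>x\<in>l ` X. \<alpha> x * a i x) = 0" and j: "j \<in> l ` X"
    then obtain x where x: "x \<in> X" "j = l x" by auto
    have "(\<alpha> \<circ> l) x = 0"
    proof (rule family_independentD[OF F _ x(1)])
      fix i assume i: "i < m"
      have "(\<Sum>j\<in>l ` X. \<alpha> j * a i j) = (\<Sum>x\<in>X. (\<alpha> \<circ> l) x * a i (l x))"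
        by (rule sum.reindex_cong[OF assms]) simp_all
      then show "(\<Sum>x\<in>X. (\<alpha> \<circ> l) x * a i (l x)) = 0" using 0 i by simp
    qed
    then show "\<alpha> j = 0" using x by simp
  qed
qed

lemma family_independent_mono:
  assumes "family_independent m a X" "Y \<subseteq> X" "finite X" shows "family_independent m a Y"
  unfolding family_independent_def
proof (intro allI impI ballI)
  fix \<alpha> y assume 0: "\<forall>i<m. (\<Sum>x\<in>Y. \<alpha> x * a i x) = 0" and y: "y \<in> Y"
  have "(\<lambda>x. if x \<in> Y then \<alpha> x else 0) y = 0"
  proof (rule family_independentD[OF assms(1)])
    fix i assume i: "i < m"
    have "(\<Sum>x\<in>X. (if x \<in> Y then \<alpha> x else 0) * a i x) = (\<Sum>x\<in>Y. \<alpha> x * a i x)"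
      using assms by (intro sum.mono_neutral_cong_right) auto
    then show "(\<Sum>x\<in>X. (if x \<in> Y then \<alpha> x else 0) * a i x) = 0" using 0 i by simp
  qed (use y assms in auto)
  then show "\<alpha> y = 0" using y by simp
qed

text \<open>Expansions over each basis exist because a basis with one more element is dependent.
  Only those over one \<open>B0\<close> build the standard matrix; the others provide its inverses
  on the remaining bases. The second conclusion ties the coordinates to the given vectors for use
  with Cramer's rule.\<close>

lemma coordinatization_of_representation:
  fixes a :: "nat \<Rightarrow> 'a \<Rightarrow> 'k::field"
  assumes M: "matroid E Bs"
    and rep: "\<And>X. X \<subseteq> E \<Longrightarrow> matroid_indep Bs X \<longleftrightarrow> family_independent m a X"
  obtains N where "coordinatization E Bs N"
    "\<forall>B\<in>Bs. \<forall>e\<in>E. \<forall>i<m. a i e = (\<Sum>b\<in>B. N B b e * a i b)"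
proof -
  interpret M: matroid E Bs by fact
  have fin: "finite X" if "X \<subseteq> E" for X using that M.finite_ground finite_subset by blast
  have anti: "B = B'" if BB: "B \<in> Bs" "B' \<in> Bs" "B \<subseteq> B'" for B B'
  proof (rule ccontr)
    assume "B \<noteq> B'"
    then obtain x where "x \<in> B' - B" using BB(3) by blast
    then show False using M.basis_exchange[OF BB(2,1)] BB(3) by auto
  qed
  have indep: "family_independent m a B" if "B \<in> Bs" for B
    using rep[OF M.bases_subset[OF that]] that by (auto simp: matroid_indep_def)
  have "\<exists>\<kappa>. \<forall>i<m. a i e = (\<Sum>b\<in>B. \<kappa> b * a i b)" if B: "B \<in> Bs" and e: "e \<in> E" for B e
  proof (cases "e \<in> B")
    case True
    then show ?thesis using fin[OF M.bases_subset[OF B]]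
      by (intro exI[of _ "\<lambda>b. if b = e then 1 else 0"]) (simp add: if_one_mult)
  next
    case False
    have finB: "finite B" by (rule fin[OF M.bases_subset[OF B]])
    have "\<not> matroid_indep Bs (insert e B)"
      using anti[OF B] False by (auto simp: matroid_indep_def)
    then have "\<not> family_independent m a (insert e B)"
      using rep[of "insert e B"] M.bases_subset[OF B] e by simp
    then obtain \<alpha> x where l: "\<And>i. i < m \<Longrightarrow> (\<Sum>x\<in>insert e B. \<alpha> x * a i x) = 0"
      and x: "x \<in> insert e B" "\<alpha> x \<noteq> 0"
      unfolding family_independent_def by blast
    have l': "\<alpha> e * a i e = - (\<Sum>b\<in>B. \<alpha> b * a i b)" if "i < m" for i
      using l[OF that] False finB by (simp add: eq_neg_iff_add_eq_0)
    have "\<alpha> e \<noteq> 0"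
    proof
      assume 0: "\<alpha> e = 0"
      have "\<alpha> b = 0" if "b \<in> B" for b
        by (rule family_independentD[OF indep[OF B] _ that, where \<alpha> = \<alpha>]) (use l' 0 in simp)
      then show False using x 0 by auto
    qed
    note nz = this
    have "a i e = (\<Sum>b\<in>B. - (\<alpha> b / \<alpha> e) * a i b)" if "i < m" for i
    proof -
      have "a i e = \<alpha> e * a i e / \<alpha> e" using nz by simp
      also have "\<dots> = (\<Sum>b\<in>B. - (\<alpha> b / \<alpha> e) * a i b)"
        unfolding l'[OF that] by (simp add: sum_negf sum_divide_distrib)
      finally show ?thesis .
    qed
    then show ?thesis by (intro exI[of _ "\<lambda>b. - (\<alpha> b / \<alpha> e)"]) simp
  qed
  note ex = this
  define K where "K B e = (SOME \<kappa>. \<forall>i<m. a i e = (\<Sum>b\<in>B. \<kappa> b * a i b))" for B e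
  have K: "a i e = (\<Sum>b\<in>B. K B e b * a i b)" if "B \<in> Bs" "e \<in> E" "i < m" for B e i
    using someI_ex[OF ex[OF that(1,2)], folded K_def] that(3) by (elim allE impE)
  obtain B0 where B0: "B0 \<in> Bs" using M.bases_nonempty by blast
  note B0E = M.bases_subset[OF B0]
  \<comment> \<open>Unit columns are put in explicitly, so that \<open>std_matrix\<close> holds by
    definition.\<close>
  define w where "w b e = (if e \<in> B0 then if b = e then 1 else 0 else K B0 e b)" for b e
  have std: "std_matrix E B0 w"
    by unfold_locales (use M.finite_ground B0E in \<open>auto simp: w_def\<close>)
  interpret W: std_matrix E B0 w by (rule std)
  have w: "a i e = (\<Sum>c\<in>B0. w c e * a i c)" if "e \<in> E" "i < m" for i e
  proof (cases "e \<in> B0")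
    case True
    then show ?thesis using W.finB0 by (simp add: w_def if_one_mult)
  next
    case False
    then show ?thesis using K[OF B0 that] by (simp add: w_def)
  qed
  have swap: "(\<Sum>b\<in>B. f b * a i b) = (\<Sum>c\<in>B0. (\<Sum>b\<in>B. w c b * f b) * a i c)"
    if "B \<subseteq> E" "i < m" for B f i
  proof -
    have "(\<Sum>b\<in>B. f b * a i b) = (\<Sum>b\<in>B. f b * (\<Sum>c\<in>B0. w c b * a i c))"
      using that by (intro sum.cong arg_cong2[where f = "(*)"] w refl) auto
    also have "\<dots> = (\<Sum>b\<in>B. \<Sum>c\<in>B0. w c b * f b * a i c)"
      by (simp add: sum_distrib_left ac_simps)
    also have "\<dots> = (\<Sum>c\<in>B0. \<Sum>b\<in>B. w c b * f b * a i c)" by (rule sum.swap)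
    finally show ?thesis by (simp add: sum_distrib_right)
  qed
  have sub: "B \<in> matrix_bases E B0 w" if B: "B \<in> Bs" for B
  proof -
    note BE = M.bases_subset[OF B]
    have "matrix_inverse w B0 B (\<lambda>b c. K B c b)"
      unfolding matrix_inverse_def
    proof (intro conjI ballI)
      fix c d assume cd: "c \<in> B0" "d \<in> B0"
      have dE: "d \<in> E" using cd B0E by blast
      show "(\<Sum>b\<in>B. w c b * K B d b) = (if c = d then 1 else 0)"
      proof (rule family_independent_eq[OF indep[OF B0] cd(1), where \<mu> = "\<lambda>c. \<Sum>b\<in>B. w c b * K B d b"])
        fix i assume i: "i < m"
        show "(\<Sum>x\<in>B0. (\<Sum>b\<in>B. w x b * K B d b) * a i x) = (\<Sum>x\<in>B0. (if x = d then 1 else 0) * a i x)"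
          using swap[OF BE i, of "K B d"] K[OF B dE i] cd W.finB0 by (simp add: if_one_mult)
      qed
    next
      fix b b' assume b: "b \<in> B" "b' \<in> B"
      have b'E: "b' \<in> E" using b BE by blast
      show "(\<Sum>c\<in>B0. K B c b * w c b') = (if b = b' then 1 else 0)"
      proof (rule family_independent_eq[OF indep[OF B] b(1), where \<mu> = "\<lambda>b. \<Sum>c\<in>B0. K B c b * w c b'"])
        fix i assume i: "i < m"
        have "(\<Sum>x\<in>B. (\<Sum>c\<in>B0. K B c x * w c b') * a i x) = (\<Sum>c\<in>B0. w c b' * (\<Sum>x\<in>B. K B c x * a i x))"
          by (simp add: sum_distrib_left sum_distrib_right ac_simps) (rule sum.swap)
        also have "\<dots> = (\<Sum>c\<in>B0. w c b' * a i c)"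
          using K[OF B _ i] B0E by (intro sum.cong arg_cong2[where f = "(*)"] refl) auto
        also have "\<dots> = a i b'" using w[OF b'E i] by simp
        finally show "(\<Sum>x\<in>B. (\<Sum>c\<in>B0. K B c x * w c b') * a i x) = (\<Sum>x\<in>B. (if x = b' then 1 else 0) * a i x)"
          using b fin[OF BE] by (simp add: if_one_mult)
      qed
    qed
    then show ?thesis using BE by (auto simp: matrix_bases_def)
  qed
  have sup: "B \<in> Bs" if B: "B \<in> matrix_bases E B0 w" for B
  proof -
    obtain T where BE: "B \<subseteq> E" and T: "matrix_inverse w B0 B T" using B by (auto simp: matrix_bases_def)
    have "family_independent m a B"
      unfolding family_independent_def
    proof (intro allI impI ballI)
      fix \<alpha> b assume 0: "\<forall>i<m. (\<Sum>x\<in>B. \<alpha> x * a i x) = 0" and b: "b \<in> B"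
      have z: "(\<Sum>x\<in>B. w c x * \<alpha> x) = 0" if "c \<in> B0" for c
        by (rule family_independentD[OF indep[OF B0] _ that, where \<alpha> = "\<lambda>c. \<Sum>x\<in>B. w c x * \<alpha> x"])
          (use 0 swap[OF BE] in simp)
      have "\<alpha> b = (\<Sum>x\<in>B. (if b = x then 1 else 0) * \<alpha> x)"
        using b fin[OF BE] by (simp add: if_one_mult)
      also have "\<dots> = (\<Sum>x\<in>B. (\<Sum>c\<in>B0. T b c * w c x) * \<alpha> x)"
        using T b by (intro sum.cong) (auto simp: matrix_inverse_def)
      also have "\<dots> = (\<Sum>c\<in>B0. T b c * (\<Sum>x\<in>B. w c x * \<alpha> x))"
        by (simp add: sum_distrib_left sum_distrib_right ac_simps) (rule sum.swap)
      also have "\<dots> = 0" using z by simp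
      finally show "\<alpha> b = 0" .
    qed
    \<comment> \<open>An invertible set of columns is independent and so lies in a basis, which is
      itself a member of \<open>matrix_bases\<close>; comparable members are equal.\<close>
    then obtain C where "C \<in> Bs" "B \<subseteq> C" using rep[OF BE] by (auto simp: matroid_indep_def)
    then show ?thesis using W.antichain[OF B sub] by blast
  qed
  have Bs: "matrix_bases E B0 w = Bs" using sub sup by blast
  have coords: "coordinatization E Bs (matrix_coords B0 w)" using W.coordinatization_axioms by (simp add: Bs)
  interpret N: coordinatization E Bs "matrix_coords B0 w" by (rule coords)
  show thesis
  proof (rule that[OF coords], intro ballI allI impI)
    fix B e i assume B: "B \<in> Bs" and e: "e \<in> E" and i: "i < m"
    have "(\<Sum>b\<in>B. matrix_coords B0 w B b e * a i b) =
        (\<Sum>c\<in>B0. (\<Sum>b\<in>B. w c b * matrix_coords B0 w B b e) * a i c)"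
      by (rule swap[OF M.bases_subset[OF B] i])
    also have "\<dots> = (\<Sum>c\<in>B0. w c e * a i c)"
    proof (rule sum.cong)
      fix c assume c: "c \<in> B0"
      have "w c e = matrix_coords B0 w B0 c e" using W.coords_B0[OF c] by simp
      also have "\<dots> = (\<Sum>b\<in>B. matrix_coords B0 w B0 c b * matrix_coords B0 w B b e)"
        by (rule N.N_cocycle[OF B0 B c e])
      also have "\<dots> = (\<Sum>b\<in>B. w c b * matrix_coords B0 w B b e)" using W.coords_B0[OF c] by simp
      finally show "(\<Sum>b\<in>B. w c b * matrix_coords B0 w B b e) * a i c = w c e * a i c" by simp
    qed simp
    also have "\<dots> = a i e" using w[OF e i] by simp
    finally show "a i e = (\<Sum>b\<in>B. matrix_coords B0 w B b e * a i b)" by simp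
  qed
qed

lemma coordinatization_of_represents:
  fixes A :: "'k::field mat"
  assumes "matroid E Bs" "represents A l E Bs"
  obtains N where "coordinatization E Bs N"
    "\<forall>B\<in>Bs. \<forall>e\<in>E. \<forall>i<dim_row A. A $$ (i, l e) = (\<Sum>b\<in>B. N B b e * A $$ (i, l b))"
proof -
  have l: "bij_betw l E {..<dim_col A}" and rep: "\<And>X. X \<subseteq> E \<Longrightarrow> matroid_indep Bs X \<longleftrightarrow> cols_lin_indpt A (l ` X)"
    using assms(2) by (auto simp: represents_def)
  have rep': "matroid_indep Bs X \<longleftrightarrow> family_independent (dim_row A) (\<lambda>i e. A $$ (i, l e)) X" if X: "X \<subseteq> E" for X
  proof -
    have "l ` X \<subseteq> {..<dim_col A}" "inj_on l X" using l X by (auto simp: bij_betw_def intro: inj_on_subset)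
    then show ?thesis using rep[OF X] by (simp add: cols_lin_indpt_iff family_independent_image)
  qed
  obtain N where "coordinatization E Bs N"
    "\<forall>B\<in>Bs. \<forall>e\<in>E. \<forall>i<dim_row A. A $$ (i, l e) = (\<Sum>b\<in>B. N B b e * A $$ (i, l b))"
    by (rule coordinatization_of_representation[OF assms(1) rep'])
  then show thesis by (rule that)
qed

section \<open>Minors with arbitrarily enumerated rows and columns\<close>

lemma det_function_permute_rows:
  fixes a :: "nat \<Rightarrow> nat \<Rightarrow> 'k::comm_ring_1"
  assumes p: "p permutes {0..<k}"
  shows "det (mat k k (\<lambda>(i, j). a (p i) j)) = signof p * det (mat k k (\<lambda>(i, j). a i j))"
proof -
  have "mat k k (\<lambda>(i, j). a (p i) j) = mat k k (\<lambda>(i, j). mat k k (\<lambda>(i, j). a i j) $$ (p i, j))"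
    using permutes_in_image[OF p] by (intro eq_matI) auto
  then show ?thesis using det_permute_rows[of "mat k k (\<lambda>(i, j). a i j)" k p] p by simp
qed

lemma det_function_transpose:
  "det (mat k k (\<lambda>(i, j). a j i)) = det (mat k k (\<lambda>(i, j). (a i j :: 'k::comm_ring_1)))"
proof -
  have "mat k k (\<lambda>(i, j). a j i) = transpose_mat (mat k k (\<lambda>(i, j). a i j))" by (intro eq_matI) auto
  then show ?thesis using det_transpose[of "mat k k (\<lambda>(i, j). a i j)" k] by simp
qed

lemma det_function_not_inj:
  fixes a :: "'i \<Rightarrow> nat \<Rightarrow> 'k::comm_ring_1"
  assumes "\<not> inj_on r {..<k}"
  shows "det (mat k k (\<lambda>(i, j). a (r i) j)) = 0"
proof -
  obtain p q where pq: "p < k" "q < k" "p \<noteq> q" "r p = r q" using assms by (auto simp: inj_on_def)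
  show ?thesis
    by (rule det_identical_rows[OF _ pq(3,1,2)]) (use pq in \<open>auto intro!: eq_vecI\<close>)
qed

text \<open>\<open>pick\<close> lists a set in increasing order. The rank of \<open>r i\<close> in
  the range of \<open>r\<close> compares this order with the given enumeration.\<close>

lemma pick_permutation:
  assumes inj: "inj_on r {..<k}"
  obtains p where "p permutes {0..<k}" "\<And>i. i < k \<Longrightarrow> r i = pick (r ` {..<k}) (p i)"
proof -
  let ?I = "r ` {..<k}"
  define p where "p i = (if i < k then card {a \<in> ?I. a < r i} else i)" for i
  have pick: "r i = pick ?I (p i)" if "i < k" for i
    using pick_card_in_set[of "r i" ?I] that by (simp add: p_def)
  have lt: "p i < k" if "i < k" for i
  proof -
    have "{a \<in> ?I. a < r i} \<subset> ?I" using that by auto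
    then have "card {a \<in> ?I. a < r i} < card ?I" by (intro psubset_card_mono) auto
    then show ?thesis using that card_image[OF inj] by (simp add: p_def)
  qed
  have "inj_on p {0..<k}"
  proof (rule inj_onI)
    fix i j assume "i \<in> {0..<k}" "j \<in> {0..<k}" "p i = p j"
    then have "r i = r j" "i < k" "j < k" using pick[of i] pick[of j] by auto
    then show "i = j" using inj by (auto dest: inj_onD)
  qed
  then have "bij_betw p {0..<k} {0..<k}"
    using lt by (intro bij_betw_imageI endo_inj_surj) auto
  then have "p permutes {0..<k}" by (rule bij_imp_permutes) (simp add: p_def)
  then show thesis using pick that by blast
qed

lemma signof_cases: "signof p = (1 :: 'k::comm_ring_1) \<or> signof p = (-1 :: 'k)"
  by (cases "evenperm p") (simp_all add: sign_def)

text \<open>A repeated row or column makes the determinant zero, and reordering only changes its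
  sign, so increasing index sets suffice.\<close>

lemma totally_unimodular_minor:
  assumes A: "totally_unimodular A"
    and r: "\<And>i. i < k \<Longrightarrow> r i < dim_row A" and c: "\<And>j. j < k \<Longrightarrow> c j < dim_col A"
  shows "det (mat k k (\<lambda>(i, j). A $$ (r i, c j))) \<in> {-1, 0, 1}"
proof (cases "inj_on r {..<k} \<and> inj_on c {..<k}")
  case False
  then consider "\<not> inj_on r {..<k}" | "\<not> inj_on c {..<k}" by blast
  then show ?thesis
  proof cases
    case 1
    then show ?thesis using det_function_not_inj[OF 1, of "\<lambda>i j. A $$ (i, c j)"] by simp
  next
    case 2
    then show ?thesis
      using det_function_not_inj[OF 2, of "\<lambda>j i. A $$ (r i, j)"]
        det_function_transpose[of k "\<lambda>j i. A $$ (r i, c j)"] by simp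
  qed
next
  case True
  let ?I = "r ` {..<k}" and ?J = "c ` {..<k}"
  obtain p where p: "p permutes {0..<k}" "\<And>i. i < k \<Longrightarrow> r i = pick ?I (p i)"
    using pick_permutation True by metis
  obtain q where q: "q permutes {0..<k}" "\<And>j. j < k \<Longrightarrow> c j = pick ?J (q j)"
    using pick_permutation True by metis
  have card: "card ?I = k" "card ?J = k" using True by (auto simp: card_image)
  have I: "{i. i < dim_row A \<and> i \<in> ?I} = ?I" "{j. j < dim_col A \<and> j \<in> ?J} = ?J" using r c by auto
  define S where "S i j = A $$ (pick ?I i, pick ?J j)" for i j
  have "submatrix A ?I ?J = mat k k (\<lambda>(i, j). S i j)"
    unfolding submatrix_def I card by (simp add: S_def)
  moreover have "det (submatrix A ?I ?J) \<in> {-1, 0, 1}"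
  proof -
    have "?I \<subseteq> {..<dim_row A}" "?J \<subseteq> {..<dim_col A}" "card ?I = card ?J" using r c card by auto
    then show ?thesis using A[unfolded totally_unimodular_def] by blast
  qed
  ultimately have S: "det (mat k k (\<lambda>(i, j). S i j)) \<in> {-1, 0, 1}" by simp
  have "mat k k (\<lambda>(i, j). A $$ (r i, c j)) = mat k k (\<lambda>(i, j). S (p i) (q j))"
    using p(2) q(2) by (intro eq_matI) (auto simp: S_def)
  then have "det (mat k k (\<lambda>(i, j). A $$ (r i, c j))) = signof p * det (mat k k (\<lambda>(i, j). S i (q j)))"
    using det_function_permute_rows[OF p(1), of "\<lambda>i j. S i (q j)"] by simp
  also have "det (mat k k (\<lambda>(i, j). S i (q j))) = det (mat k k (\<lambda>(i, j). S j (q i)))"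
    by (rule det_function_transpose[symmetric])
  also have "\<dots> = signof q * det (mat k k (\<lambda>(i, j). S j i))"
    using det_function_permute_rows[OF q(1), of "\<lambda>i j. S j i"] .
  also have "det (mat k k (\<lambda>(i, j). S j i)) = det (mat k k (\<lambda>(i, j). S i j))"
    by (rule det_function_transpose)
  finally show ?thesis
    using S signof_cases[of p, where 'k = real] signof_cases[of q, where 'k = real] by auto
qed

text \<open>The square matrix for \<open>k\<close> is bordered by the next column and a free row
  \<open>x\<close>. Expanded along that row, the determinant is a linear form whose coefficients
  \<open>\<gamma>\<close> do not depend on \<open>x\<close>, with \<open>\<gamma> k\<close> nonzero.
  If it vanished for all \<open>x\<close>, then \<open>\<gamma>\<close> would be a relation between
  the columns.\<close>

lemma nonsingular_rows:
  fixes a :: "nat \<Rightarrow> nat \<Rightarrow> 'k::field"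
  assumes "family_independent m a {..<k}"
  shows "\<exists>r. (\<forall>i<k. r i < m) \<and> det (mat k k (\<lambda>(i, j). a (r i) j)) \<noteq> 0"
  using assms
proof (induction k)
  case 0
  show ?case by simp
next
  case (Suc k)
  have "family_independent m a {..<k}" by (rule family_independent_mono[OF Suc.prems]) auto
  then obtain r where r: "\<And>i. i < k \<Longrightarrow> r i < m" and D: "det (mat k k (\<lambda>(i, j). a (r i) j)) \<noteq> 0"
    using Suc.IH by blast
  define M where "M x = mat (Suc k) (Suc k) (\<lambda>(i, j). a ((r(k := x)) i) j)" for x
  define \<gamma> where "\<gamma> j = cofactor (M 0) k j" for j
  have cof: "cofactor (M x) k j = \<gamma> j" if "j < Suc k" for x j
  proof -
    have "mat_delete (M x) k j = mat_delete (M 0) k j"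
      unfolding mat_delete_def M_def by (intro eq_matI) auto
    then show ?thesis by (simp add: cofactor_def \<gamma>_def)
  qed
  have det: "det (M x) = (\<Sum>j<Suc k. \<gamma> j * a x j)" for x
  proof -
    have "det (M x) = (\<Sum>j<Suc k. M x $$ (k, j) * cofactor (M x) k j)"
      by (rule laplace_expansion_row) (auto simp: M_def)
    also have "\<dots> = (\<Sum>j<Suc k. \<gamma> j * a x j)"
    proof (rule sum.cong)
      fix j assume j: "j \<in> {..<Suc k}"
      have "M x $$ (k, j) = a x j" using j by (simp add: M_def)
      then show "M x $$ (k, j) * cofactor (M x) k j = \<gamma> j * a x j" using cof[of j x] j by simp
    qed simp
    finally show ?thesis .
  qed
  have "mat_delete (M 0) k k = mat k k (\<lambda>(i, j). a (r i) j)"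
    unfolding mat_delete_def M_def by (intro eq_matI) auto
  then have "\<gamma> k \<noteq> 0" using D by (simp add: \<gamma>_def cofactor_def)
  moreover have "\<gamma> k = 0" if "\<And>x. x < m \<Longrightarrow> det (M x) = 0"
    by (rule family_independentD[OF Suc.prems, where \<alpha> = \<gamma>]) (use that det in auto)
  ultimately obtain x where x: "x < m" "det (M x) \<noteq> 0" by blast
  then show ?case using r by (intro exI[of _ "r(k := x)"]) (auto simp: M_def less_Suc_eq)
qed

text \<open>Cramer's rule: a coordinate is a quotient of two minors of \<open>A\<close>. Since
  \<open>A\<close> may have more rows than its rank, \<open>nonsingular_rows\<close> selects the
  rows for the denominator.\<close>

lemma signable_of_totally_unimodular:
  assumes M: "matroid E Bs" and A: "totally_unimodular A" and rep: "represents A l E Bs"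
  shows "signable E Bs"
proof -
  obtain N where N: "coordinatization E Bs N"
    and AN: "\<forall>B\<in>Bs. \<forall>e\<in>E. \<forall>i<dim_row A. A $$ (i, l e) = (\<Sum>b\<in>B. N B b e * A $$ (i, l b))"
    by (rule coordinatization_of_represents[OF M rep])
  interpret N: coordinatization E Bs N by fact
  have lE: "l e < dim_col A" if "e \<in> E" for e using rep that by (auto simp: represents_def bij_betw_def)
  have "N B b e \<in> {-1, 0, 1}" if B: "B \<in> Bs" and b: "b \<in> B" and e: "e \<in> E" for B b e
  proof -
    define k where "k = card B"
    obtain \<beta> where \<beta>: "bij_betw \<beta> {..<k} B"
      using ex_bij_betw_nat_finite[OF N.finite_base[OF B]] by (auto simp: k_def atLeast0LessThan)
    have \<beta>B: "\<beta> j \<in> B" if "j < k" for j using \<beta> that by (auto simp: bij_betw_def)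
    have \<beta>E: "\<beta> j \<in> E" if "j < k" for j using \<beta>B[OF that] N.base_sub[OF B] by blast
    obtain q where q: "q < k" "\<beta> q = b" using \<beta> b by (auto simp: bij_betw_def)
    have BE: "B \<subseteq> E" by (rule N.base_sub[OF B])
    have inj: "inj_on l E" using rep by (auto simp: represents_def bij_betw_def)
    have "matroid_indep Bs B" using B by (auto simp: matroid_indep_def)
    then have "cols_lin_indpt A (l ` B)" using rep BE by (simp add: represents_def)
    moreover have "l ` B \<subseteq> {..<dim_col A}" using lE BE by auto
    ultimately have "family_independent (dim_row A) (\<lambda>i j. A $$ (i, j)) (l ` B)"
      by (simp add: cols_lin_indpt_iff)
    moreover have "l ` B = (l \<circ> \<beta>) ` {..<k}" using \<beta> by (auto simp: bij_betw_def image_image)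
    ultimately have F: "family_independent (dim_row A) (\<lambda>i j. A $$ (i, j)) ((l \<circ> \<beta>) ` {..<k})" by simp
    have "inj_on (l \<circ> \<beta>) {..<k}"
      using \<beta> inj_on_subset[OF inj BE] by (intro comp_inj_on) (auto simp: bij_betw_def)
    from iffD1[OF family_independent_image[OF this] F]
    have "family_independent (dim_row A) (\<lambda>i j. A $$ (i, l (\<beta> j))) {..<k}" by simp
    then obtain r where r: "\<And>i. i < k \<Longrightarrow> r i < dim_row A"
      and D: "det (mat k k (\<lambda>(i, j). A $$ (r i, l (\<beta> j)))) \<noteq> 0"
      using nonsingular_rows by blast
    define S where "S = mat k k (\<lambda>(i, j). A $$ (r i, l (\<beta> j)))"
    define x where "x = vec k (\<lambda>j. N B (\<beta> j) e)"
    have Sx: "S *\<^sub>v x = vec k (\<lambda>i. A $$ (r i, l e))"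
    proof (rule eq_vecI)
      fix i assume "i < dim_vec (vec k (\<lambda>i. A $$ (r i, l e)))"
      then have i: "i < k" by simp
      have "(S *\<^sub>v x) $ i = (\<Sum>j<k. A $$ (r i, l (\<beta> j)) * N B (\<beta> j) e)"
        using i by (simp add: S_def x_def scalar_prod_def atLeast0LessThan)
      also have "\<dots> = (\<Sum>b\<in>B. A $$ (r i, l b) * N B b e)"
        by (rule sum.reindex_bij_betw[OF \<beta>])
      also have "\<dots> = A $$ (r i, l e)"
        using AN B e r[OF i] by (simp add: mult.commute)
      finally show "(S *\<^sub>v x) $ i = vec k (\<lambda>i. A $$ (r i, l e)) $ i" using i by simp
    qed (simp add: S_def)
    have "det (replace_col S (S *\<^sub>v x) q) = x $ q * det S"
      by (rule cramer_lemma_mat) (use q in \<open>auto simp: S_def x_def\<close>)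
    moreover have "replace_col S (S *\<^sub>v x) q = mat k k (\<lambda>(i, j). A $$ (r i, (l \<circ> \<beta>(q := e)) j))"
      unfolding Sx replace_col_def by (intro eq_matI) (auto simp: S_def)
    moreover have "det (mat k k (\<lambda>(i, j). A $$ (r i, (l \<circ> \<beta>(q := e)) j))) \<in> {-1, 0, 1}"
      by (rule totally_unimodular_minor[OF A r]) (use lE \<beta>E e in auto)
    moreover have "det S \<in> {-1, 0, 1}"
      unfolding S_def by (rule totally_unimodular_minor[OF A r]) (use lE \<beta>E in auto)
    moreover have "x $ q = N B b e" using q by (simp add: x_def)
    ultimately show ?thesis using D unfolding S_def[symmetric] by auto
  qed
  then have "unimodular E Bs N" by (rule unimodularI[OF N])
  then show ?thesis by (auto simp: signable_def)
qed

section \<open>From unimodular coordinates to a totally unimodular matrix\<close>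

text \<open>The Schur complement formula, from a factorization into a unit lower triangular
  \<open>L\<close> and a \<open>U\<close> whose first column vanishes below the corner.\<close>

lemma det_pivot:
  fixes a :: "nat \<Rightarrow> nat \<Rightarrow> 'k::field"
  assumes nz: "a 0 0 \<noteq> 0"
  shows "det (mat (Suc k) (Suc k) (\<lambda>(i, j). a i j)) =
    a 0 0 * det (mat k k (\<lambda>(i, j). a (Suc i) (Suc j) - a (Suc i) 0 * a 0 (Suc j) / a 0 0))"
proof -
  let ?n = "Suc k"
  define L where "L = mat ?n ?n (\<lambda>(i, j). if i = j then 1 else if j = 0 then a i 0 / a 0 0 else 0)"
  define U where "U = mat ?n ?n (\<lambda>(i, j). if i = 0 then a 0 j else a i j - a i 0 * a 0 j / a 0 0)"
  have L: "L \<in> carrier_mat ?n ?n" and U: "U \<in> carrier_mat ?n ?n" by (auto simp: L_def U_def)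
  have "mat ?n ?n (\<lambda>(i, j). a i j) = L * U"
  proof (rule eq_matI)
    fix i j assume "i < dim_row (L * U)" "j < dim_col (L * U)"
    then have ij: "i < ?n" "j < ?n" by (auto simp: L_def U_def)
    have "(L * U) $$ (i, j) = (\<Sum>h<?n. L $$ (i, h) * U $$ (h, j))"
      using ij L U by (simp add: scalar_prod_def atLeast0LessThan L_def U_def)
    also have "\<dots> = (\<Sum>h<?n. if h = i then U $$ (i, j) else if h = 0 then a i 0 / a 0 0 * U $$ (0, j) else 0)"
      using ij by (intro sum.cong) (auto simp: L_def)
    also have "\<dots> = a i j"
    proof (cases "i = 0")
      case True
      then have "(\<Sum>h<?n. if h = i then U $$ (i, j) else if h = 0 then a i 0 / a 0 0 * U $$ (0, j) else 0)
        = (\<Sum>h<?n. if h = 0 then U $$ (0, j) else 0)" by (intro sum.cong) auto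
      also have "\<dots> = U $$ (0, j)" using sum.delta[of "{..<?n}" 0 "\<lambda>_. U $$ (0, j)"] by simp
      finally show ?thesis using True ij by (simp add: U_def)
    next
      case False
      have "(\<Sum>h<?n. if h = i then U $$ (i, j) else if h = 0 then a i 0 / a 0 0 * U $$ (0, j) else 0)
        = (\<Sum>h<?n. if h = i then U $$ (i, j) else 0) + (\<Sum>h<?n. if h = 0 then a i 0 / a 0 0 * U $$ (0, j) else 0)"
        unfolding sum.distrib[symmetric] using False by (intro sum.cong) auto
      also have "\<dots> = U $$ (i, j) + a i 0 / a 0 0 * U $$ (0, j)" using ij by (simp add: sum.delta)
      finally show ?thesis using ij False by (simp add: U_def)
    qed
    finally show "mat ?n ?n (\<lambda>(i, j). a i j) $$ (i, j) = (L * U) $$ (i, j)" using ij by simp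
  qed (auto simp: L_def U_def)
  moreover have "det L = 1"
  proof -
    have "det L = prod_list (diag_mat L)"
      by (rule det_lower_triangular[OF _ L]) (auto simp: L_def)
    also have "diag_mat L = replicate ?n 1"
      by (intro nth_equalityI) (auto simp: diag_mat_def L_def simp del: upt_Suc replicate_Suc)
    finally show ?thesis by simp
  qed
  moreover have "det U = a 0 0 * det (mat k k (\<lambda>(i, j). a (Suc i) (Suc j) - a (Suc i) 0 * a 0 (Suc j) / a 0 0))"
  proof -
    have "det U = (\<Sum>i<?n. U $$ (i, 0) * cofactor U i 0)" by (rule laplace_expansion_column[OF U]) simp
    also have "\<dots> = (\<Sum>i<?n. if i = 0 then a 0 0 * cofactor U 0 0 else 0)"
      using nz by (intro sum.cong) (auto simp: U_def)
    also have "\<dots> = a 0 0 * cofactor U 0 0" by simp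
    also have "cofactor U 0 0 = det (mat k k (\<lambda>(i, j). a (Suc i) (Suc j) - a (Suc i) 0 * a 0 (Suc j) / a 0 0))"
    proof -
      have "mat_delete U 0 0 = mat k k (\<lambda>(i, j). a (Suc i) (Suc j) - a (Suc i) 0 * a 0 (Suc j) / a 0 0)"
        unfolding mat_delete_def U_def by (intro eq_matI) auto
      then show ?thesis by (simp add: cofactor_def)
    qed
    finally show ?thesis .
  qed
  ultimately show ?thesis using det_mult[OF L U] by simp
qed

text \<open>The Schur complement of a nonzero entry is a submatrix of the coordinates after the
  corresponding exchange. So a minor is, up to sign, an entry times a smaller minor over another
  basis, and the bound on entries over all bases is what the induction consumes.\<close>

lemma (in unimodular) minor:
  assumes "B \<in> Bs" "\<And>i. i < k \<Longrightarrow> r i \<in> B" "\<And>j. j < k \<Longrightarrow> c j \<in> E"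
  shows "det (mat k k (\<lambda>(i, j). N B (r i) (c j))) \<in> {-1, 0, 1}"
  using assms
proof (induction k arbitrary: B r c)
  case 0
  show ?case by simp
next
  case (Suc k)
  note B = Suc.prems(1) and r = Suc.prems(2) and c = Suc.prems(3)
  let ?n = "Suc k"
  let ?M = "mat ?n ?n (\<lambda>(i, j). N B (r i) (c j))"
  show ?case
  proof (cases "inj_on r {..<?n}")
    case False
    then show ?thesis using det_function_not_inj[OF False, of "\<lambda>i j. N B i (c j)"] by simp
  next
    case inj: True
    show ?thesis
    proof (cases "\<exists>p<?n. N B (r p) (c 0) \<noteq> 0")
      case False
      have "det ?M = (\<Sum>i<?n. ?M $$ (i, 0) * cofactor ?M i 0)"
        by (rule laplace_expansion_column) auto
      also have "\<dots> = 0" using False by (intro sum.neutral) auto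
      finally show ?thesis by simp
    next
      case True
      then obtain p where p: "p < ?n" "N B (r p) (c 0) \<noteq> 0" by blast
      \<comment> \<open>The swap brings a row with a nonzero entry in column \<open>c 0\<close> to
        the top, as \<open>det_pivot\<close> expects.\<close>
      define t where "t = transpose 0 p"
      have t: "t permutes {0..<?n}" unfolding t_def using p by (intro permutes_swap_id) auto
      define s where "s = r \<circ> t"
      have tl: "t i < ?n" if "i < ?n" for i using permutes_in_image[OF t] that by auto
      have sB: "s i \<in> B" if "i < ?n" for i using r[OF tl[OF that]] by (simp add: s_def)
      have "inj_on t {..<?n}" using permutes_inj[OF t] by (auto intro: inj_on_subset)
      then have sinj: "inj_on s {..<?n}"
        unfolding s_def using inj tl by (intro comp_inj_on) (auto intro: inj_on_subset)
      have s0: "N B (s 0) (c 0) \<noteq> 0" using p by (simp add: s_def t_def)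
      have s0B: "s 0 \<in> B" and c0: "c 0 \<in> E" using sB[of 0] c[of 0] by auto
      let ?B = "insert (c 0) (B - {s 0})"
      have B': "?B \<in> Bs" using N_exchange[OF B s0B c0] s0 by simp
      have sne: "s (Suc i) \<noteq> s 0" if "i < k" for i
        using sinj that by (auto dest: inj_onD)
      have piv: "N ?B (s (Suc i)) g = N B (s (Suc i)) g - N B (s (Suc i)) (c 0) * N B (s 0) g / N B (s 0) (c 0)"
        if "i < k" "g \<in> E" for i g
      proof (cases "c 0 \<in> B")
        case True
        \<comment> \<open>A basis element \<open>c 0\<close> has a unit column, so the exchange is
          trivial and there is nothing to correct.\<close>
        then have eq: "c 0 = s 0" using N_base[OF B s0B True] s0 by (auto split: if_splits)
        then have "?B = B" using s0B by auto
        moreover have "N B (s (Suc i)) (c 0) = 0"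
          using N_base[OF B sB[of "Suc i"] True] sne[OF that(1)] that eq by auto
        ultimately show ?thesis by simp
      next
        case False
        show ?thesis by (rule pivot[OF B s0B c0 False B' that(2)]) (use sB sne that in auto)
      qed
      have "det (mat k k (\<lambda>(i, j). N ?B (s (Suc i)) (c (Suc j)))) \<in> {-1, 0, 1}"
        by (rule Suc.IH[OF B']) (use sB sne c in auto)
      moreover have "mat k k (\<lambda>(i, j). N ?B (s (Suc i)) (c (Suc j))) =
          mat k k (\<lambda>(i, j). N B (s (Suc i)) (c (Suc j)) - N B (s (Suc i)) (c 0) * N B (s 0) (c (Suc j)) / N B (s 0) (c 0))"
        by (intro eq_matI) (auto simp: piv c)
      ultimately have "det (mat ?n ?n (\<lambda>(i, j). N B (s i) (c j))) \<in> {-1, 0, 1}"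
        using det_pivot[of "\<lambda>i j. N B (s i) (c j)" k, OF s0] entries[OF B s0B c0] by auto
      moreover have "det (mat ?n ?n (\<lambda>(i, j). N B (s i) (c j))) = signof t * det ?M"
        unfolding s_def using det_function_permute_rows[OF t, of "\<lambda>i j. N B (r i) (c j)"] by simp
      ultimately show ?thesis using signof_cases[of t, where 'k = real] by auto
    qed
  qed
qed

text \<open>For the converse, take a largest independent \<open>Y\<close> in \<open>X\<close> and a
  basis \<open>B\<close> containing it. An element of \<open>X\<close> outside \<open>Y\<close> has
  nonzero coordinates over \<open>B\<close> only at \<open>Y\<close>, since any other would allow an
  exchange that enlarges \<open>Y\<close>; this is a linear relation on \<open>X\<close>.\<close>

lemma (in coordinatization) indep_iff:
  assumes B0: "B0 \<in> Bs" and \<beta>: "bij_betw \<beta> {..<m} B0" and X: "X \<subseteq> E"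
  shows "matroid_indep Bs X \<longleftrightarrow> family_independent m (\<lambda>i x. N B0 (\<beta> i) x) X"
proof
  assume "matroid_indep Bs X"
  then obtain B where B: "B \<in> Bs" "X \<subseteq> B" by (auto simp: matroid_indep_def)
  have "family_independent m (\<lambda>i x. N B0 (\<beta> i) x) B"
    unfolding family_independent_def
  proof (intro allI impI ballI)
    fix \<alpha> b assume 0: "\<forall>i<m. (\<Sum>x\<in>B. \<alpha> x * N B0 (\<beta> i) x) = 0" and b: "b \<in> B"
    have z: "(\<Sum>x\<in>B. \<alpha> x * N B0 c x) = 0" if c: "c \<in> B0" for c
    proof -
      obtain i where "i < m" "\<beta> i = c" using \<beta> c by (auto simp: bij_betw_def)
      then show ?thesis using 0 by auto
    qed
    have "\<alpha> b = (\<Sum>x\<in>B. \<alpha> x * (if x = b then 1 else 0))"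
      using b finite_base[OF B(1)] by (simp add: mult_if_one)
    also have "\<dots> = (\<Sum>x\<in>B. \<alpha> x * (\<Sum>c\<in>B0. N B b c * N B0 c x))"
    proof (rule sum.cong)
      fix x assume x: "x \<in> B"
      then have "x \<in> E" using base_sub B by blast
      then show "\<alpha> x * (if x = b then 1 else 0) = \<alpha> x * (\<Sum>c\<in>B0. N B b c * N B0 c x)"
        using N_cocycle[OF B(1) B0 b] N_base[OF B(1) b x] by simp
    qed simp
    also have "\<dots> = (\<Sum>c\<in>B0. N B b c * (\<Sum>x\<in>B. \<alpha> x * N B0 c x))"
      by (simp add: sum_distrib_left ac_simps) (rule sum.swap)
    also have "\<dots> = 0" using z by simp
    finally show "\<alpha> b = 0" .
  qed
  then show "family_independent m (\<lambda>i x. N B0 (\<beta> i) x) X"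
    by (rule family_independent_mono[OF _ B(2) finite_base[OF B(1)]])
next
  have \<beta>B: "\<beta> i \<in> B0" if "i < m" for i using \<beta> that by (auto simp: bij_betw_def)
  assume F: "family_independent m (\<lambda>i x. N B0 (\<beta> i) x) X"
  have finX: "finite X" using X finite_E finite_subset by blast
  have "matroid_indep Bs {}" using nonempty by (auto simp: matroid_indep_def)
  then have "\<exists>Y. matroid_indep Bs Y \<and> Y \<subseteq> X \<and> (\<forall>Z. matroid_indep Bs Z \<and> Z \<subseteq> X \<longrightarrow> card Z \<le> card Y)"
    using ex_has_greatest_nat[of "\<lambda>Z. matroid_indep Bs Z \<and> Z \<subseteq> X" "{}" card "Suc (card X)"]
      card_mono[OF finX] by (auto simp: less_Suc_eq_le)
  then obtain Y where Y: "matroid_indep Bs Y" "Y \<subseteq> X"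
    and max: "\<forall>Z. matroid_indep Bs Z \<and> Z \<subseteq> X \<longrightarrow> card Z \<le> card Y"
    by (elim exE conjE)
  have finY: "finite Y" using Y finX finite_subset by blast
  have maxY: "\<not> matroid_indep Bs (insert x Y)" if "x \<in> X - Y" for x
    using spec[OF max, of "insert x Y"] that Y(2) finY by auto
  have "X \<subseteq> Y"
  proof (rule ccontr)
    assume "\<not> X \<subseteq> Y"
    then obtain x where x: "x \<in> X - Y" by blast
    obtain B where B: "B \<in> Bs" "Y \<subseteq> B" using Y(1) by (auto simp: matroid_indep_def)
    have xE: "x \<in> E" using x X by blast
    have zero: "N B b x = 0" if "b \<in> B - Y" for b
    proof (rule ccontr)
      assume "N B b x \<noteq> 0"
      then have B': "insert x (B - {b}) \<in> Bs" using N_exchange[OF B(1) _ xE] that by blast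
      have "insert x Y \<subseteq> insert x (B - {b})" using that B(2) by auto
      then have "matroid_indep Bs (insert x Y)" using B' unfolding matroid_indep_def by (intro bexI)
      then show False using maxY[OF x] by simp
    qed
    define \<alpha> where "\<alpha> y = (if y = x then - 1 else if y \<in> Y then N B y x else 0)" for y
    have "\<alpha> x = 0"
    proof (rule family_independentD[OF F])
      fix i assume "i < m"
      then have c: "\<beta> i \<in> B0" by (rule \<beta>B)
      have "N B0 (\<beta> i) x = (\<Sum>b\<in>B. N B0 (\<beta> i) b * N B b x)" by (rule N_cocycle[OF B0 B(1) c xE])
      also have "\<dots> = (\<Sum>y\<in>Y. N B0 (\<beta> i) y * N B y x)"
        by (rule sum.mono_neutral_right[OF finite_base[OF B(1)] B(2)]) (use zero in auto)
      finally have eq: "N B0 (\<beta> i) x = (\<Sum>y\<in>Y. N B0 (\<beta> i) y * N B y x)" .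
      have "(\<Sum>y\<in>X. \<alpha> y * N B0 (\<beta> i) y) = (\<Sum>y\<in>insert x Y. \<alpha> y * N B0 (\<beta> i) y)"
        by (rule sum.mono_neutral_right[OF finX]) (use x Y in \<open>auto simp: \<alpha>_def\<close>)
      also have "\<dots> = - N B0 (\<beta> i) x + (\<Sum>y\<in>Y. \<alpha> y * N B0 (\<beta> i) y)"
        using x finY by (simp add: \<alpha>_def)
      also have "(\<Sum>y\<in>Y. \<alpha> y * N B0 (\<beta> i) y) = (\<Sum>y\<in>Y. N B0 (\<beta> i) y * N B y x)"
        using x by (intro sum.cong) (auto simp: \<alpha>_def)
      finally show "(\<Sum>y\<in>X. \<alpha> y * N B0 (\<beta> i) y) = 0" using eq by simp
    qed (use x in simp)
    then show False by (simp add: \<alpha>_def)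
  qed
  then show "matroid_indep Bs X" using Y by (metis subset_antisym)
qed

lemma (in unimodular) regular: "regular_matroid E Bs"
proof -
  obtain B0 where B0: "B0 \<in> Bs" using nonempty by blast
  define m where "m = card B0"
  define n where "n = card E"
  obtain \<beta> where \<beta>: "bij_betw \<beta> {..<m} B0"
    using ex_bij_betw_nat_finite[OF finite_base[OF B0]] by (auto simp: m_def atLeast0LessThan)
  obtain \<epsilon> where \<epsilon>: "bij_betw \<epsilon> {..<n} E"
    using ex_bij_betw_nat_finite[OF finite_E] by (auto simp: n_def atLeast0LessThan)
  define l where "l = the_inv_into {..<n} \<epsilon>"
  have l: "bij_betw l E {..<n}" unfolding l_def by (rule bij_betw_the_inv_into[OF \<epsilon>])
  have \<epsilon>l: "\<epsilon> (l e) = e" if "e \<in> E" for e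
    unfolding l_def using \<epsilon> that by (intro f_the_inv_into_f_bij_betw) auto
  define A where "A = mat m n (\<lambda>(i, j). N B0 (\<beta> i) (\<epsilon> j))"
  have dim: "dim_row A = m" "dim_col A = n" by (simp_all add: A_def)
  have TU: "totally_unimodular A"
    unfolding totally_unimodular_def dim
  proof (intro allI impI)
    fix I J assume IJ: "I \<subseteq> {..<m}" "J \<subseteq> {..<n}" "card I = card J"
    have eq: "{i. i < dim_row A \<and> i \<in> I} = I" "{j. j < dim_col A \<and> j \<in> J} = J" using IJ by (auto simp: dim)
    have pI: "pick I i \<in> I" "pick J i \<in> J" if "i < card I" for i
      using pick_in_set_le that IJ(3) by auto
    have "submatrix A I J = mat (card I) (card I) (\<lambda>(i, j). N B0 (\<beta> (pick I i)) (\<epsilon> (pick J j)))"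
      unfolding submatrix_def eq IJ(3)[symmetric]
      by (intro eq_matI) (use pI IJ in \<open>auto simp: A_def subset_iff\<close>)
    moreover have "\<beta> i \<in> B0" if "i \<in> I" for i using \<beta> IJ that by (auto simp: bij_betw_def)
    moreover have "\<epsilon> j \<in> E" if "j \<in> J" for j using \<epsilon> IJ that by (auto simp: bij_betw_def)
    ultimately show "det (submatrix A I J) \<in> {-1, 0, 1}"
      using minor[OF B0, of "card I" "\<lambda>i. \<beta> (pick I i)" "\<lambda>j. \<epsilon> (pick J j)"] pI by auto
  qed
  have "represents A l E Bs"
    unfolding represents_def dim
  proof (intro conjI l allI impI)
    fix X assume X: "X \<subseteq> E"
    have lX: "l ` X \<subseteq> {..<dim_col A}" "inj_on l X" using l X by (auto simp: bij_betw_def dim intro: inj_on_subset)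
    have "cols_lin_indpt A (l ` X) \<longleftrightarrow> family_independent m (\<lambda>i x. A $$ (i, l x)) X"
      using cols_lin_indpt_iff[OF lX(1)] family_independent_image[OF lX(2)] by (simp add: dim)
    also have "\<dots> \<longleftrightarrow> family_independent m (\<lambda>i x. N B0 (\<beta> i) x) X"
    proof -
      have "A $$ (i, l x) = N B0 (\<beta> i) x" if "i < m" "x \<in> X" for i x
      proof -
        have "l x < n" "x \<in> E" using lX(1) X that unfolding image_subset_iff dim by auto
        then show ?thesis using that \<epsilon>l by (simp add: A_def)
      qed
      then have "(\<forall>i<m. (\<Sum>x\<in>X. \<alpha> x * A $$ (i, l x)) = 0) \<longleftrightarrow>
          (\<forall>i<m. (\<Sum>x\<in>X. \<alpha> x * N B0 (\<beta> i) x) = 0)" for \<alpha>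
        by simp
      then show ?thesis unfolding family_independent_def by simp
    qed
    also have "\<dots> \<longleftrightarrow> matroid_indep Bs X" using indep_iff[OF B0 \<beta> X] by simp
    finally show "matroid_indep Bs X \<longleftrightarrow> cols_lin_indpt A (l ` X)" by simp
  qed
  then show ?thesis using TU matroid unfolding regular_matroid_def by blast
qed

theorem theorem5p5:
  fixes E :: "'a set" and Bs :: "'a set set"
  assumes "binary_matroid E Bs"
  shows "strongly_rayleigh E Bs \<longleftrightarrow> regular_matroid E Bs"
proof
  assume SR: "strongly_rayleigh E Bs"
  obtain A :: "bit mat" and l where M: "matroid E Bs" and A: "represents A l E Bs"
    using assms by (auto simp: binary_matroid_def)
  obtain n where "coordinatization E Bs (n :: 'a set \<Rightarrow> 'a \<Rightarrow> 'a \<Rightarrow> bit)"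
    by (rule coordinatization_of_represents[OF M A])
  then have "signable E Bs" using SR by (rule signable_of_strongly_rayleigh)
  then show "regular_matroid E Bs" by (auto simp: signable_def dest: unimodular.regular)
next
  assume "regular_matroid E Bs"
  then obtain A :: "real mat" and l where M: "matroid E Bs" and A: "totally_unimodular A" "represents A l E Bs"
    by (auto simp: regular_matroid_def)
  have "signable E Bs" by (rule signable_of_totally_unimodular[OF M A])
  then show "strongly_rayleigh E Bs" by (auto simp: signable_def dest: unimodular.strongly_rayleigh)
qed

end
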